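(* Let $(\mathcal{C},\otimes,I)$ be a monoidal category, let $\mathcal{S}$ be the cartesian monoidal category of sets, and let $A$ be a monoid in $[\mathcal{C},\mathcal{S}]$ (with the convolution monoidal structure). Every object of the Cauchy completion $\mathcal{Q}A$ of the monoid $A$ is a retract of a module of the form $A(K\otimes-)$ for some $K\in\mathcal{C}$.
   Context: The category $[\mathcal{C},\mathcal{S}]$ of functors is monoidal by convolution ($\mathcal{C}$ small, so that this exists): $$(M*N)(U)=\int^{X,Y}\mathcal{C}(X\otimes Y,U)\times M(X)\times N(Y),\qquad J(U)=\mathcal{C}(I,U).$$ The bicategory $\mathbf{Mod}[\mathcal{C},\mathcal{S}]$ has monoids in $[\mathcal{C},\mathcal{S}]$ as objects. Its morphisms $M:A\to B$ are modules, i.e. functors $M$ with a two-sided (left $A$-, right $B$-) action $A*M*B\to M$, equivalently families $A(X)\times M(Y)\times B(Z)\to M(X\otimes Y\otimes Z)$; its 2-cells are natural transformations respecting the actions. The composite of $M:A\to B$ and $N:B\to C$ is $M*_BN$, the coequalizer of the two action maps $M*B*N\rightrightarrows M*N$, and the identity of $A$ is $A$. A module $M:J\to A$ is thus a right $A$-module. The Cauchy completion $\mathcal{Q}A$ consists of the modules $M:J\to A$ which have a right adjoint $N:A\to J$ in $\mathbf{Mod}[\mathcal{C},\mathcal{S}]$ (with right $A$-module morphisms between them). For $K\in\mathcal{C}$, the functor $A(K\otimes-)$ is a module $J\to A$ with action $A(K\otimes U)\times A(V)\to A(K\otimes U\otimes V)$ given by the monoid structure of $A$. Retracts are taken in the category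 of right $A$-modules. *)

theory Defs
  imports Main
begin

section \<open>Monoidal categories\<close>

text \<open>The sets of objects and of arrows are sets in the sense of HOL, so every category here
  is small. The coherence arrows go
  \<open>Assoc X Y Z : (X \<otimes> Y) \<otimes> Z \<rightarrow> X \<otimes> (Y \<otimes> Z)\<close>, \<open>Lun X : I \<otimes> X \<rightarrow> X\<close>, \<open>Run X : X \<otimes> I \<rightarrow> X\<close>.\<close>

record ('o, 'a) mcat =
  Obj :: "'o set"
  Arr :: "'a set"
  Dom :: "'a \<Rightarrow> 'o"
  Cod :: "'a \<Rightarrow> 'o"
  Idn :: "'o \<Rightarrow> 'a"
  Cmp :: "'a \<Rightarrow> 'a \<Rightarrow> 'a"  (infixr "\<cdot>\<index>" 75)
  Unt :: "'o"  ("\<I>\<index>")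
  Ten :: "'o \<Rightarrow> 'o \<Rightarrow> 'o"  (infixr "\<otimes>\<index>" 80)
  TenA :: "'a \<Rightarrow> 'a \<Rightarrow> 'a"  (infixr "\<odot>\<index>" 80)
  Assoc :: "'o \<Rightarrow> 'o \<Rightarrow> 'o \<Rightarrow> 'a"
  Lun :: "'o \<Rightarrow> 'a"
  Run :: "'o \<Rightarrow> 'a"

definition hom :: "('o, 'a) mcat \<Rightarrow> 'o \<Rightarrow> 'o \<Rightarrow> 'a set" where
  "hom C X Y = {f \<in> Arr C. Dom C f = X \<and> Cod C f = Y}"

definition inverse_arrows :: "('o, 'a) mcat \<Rightarrow> 'a \<Rightarrow> 'a \<Rightarrow> bool" where
  "inverse_arrows C f g \<longleftrightarrow>
     f \<in> Arr C \<and> g \<in> hom C (Cod C f) (Dom C f) \<and>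
     Cmp C g f = Idn C (Dom C f) \<and> Cmp C f g = Idn C (Cod C f)"

definition inv_arr :: "('o, 'a) mcat \<Rightarrow> 'a \<Rightarrow> 'a" where
  "inv_arr C f = (THE g. inverse_arrows C f g)"

definition iso_arr :: "('o, 'a) mcat \<Rightarrow> 'a \<Rightarrow> bool" where
  "iso_arr C f \<longleftrightarrow> (\<exists>g. inverse_arrows C f g)"

locale monoidal_category =
  fixes C :: "('o, 'a) mcat" (structure)
  assumes dom_obj: "f \<in> Arr C \<Longrightarrow> Dom C f \<in> Obj C"
    and cod_obj: "f \<in> Arr C \<Longrightarrow> Cod C f \<in> Obj C"
    and idn_hom: "X \<in> Obj C \<Longrightarrow> Idn C X \<in> hom C X X"
    and cmp_hom: "f \<in> hom C X Y \<Longrightarrow> g \<in> hom C Y Z \<Longrightarrow> g \<cdot> f \<in> hom C X Z"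
    and cmp_idn_right: "f \<in> hom C X Y \<Longrightarrow> f \<cdot> Idn C X = f"
    and cmp_idn_left: "f \<in> hom C X Y \<Longrightarrow> Idn C Y \<cdot> f = f"
    and cmp_assoc: "f \<in> hom C W X \<Longrightarrow> g \<in> hom C X Y \<Longrightarrow> h \<in> hom C Y Z
          \<Longrightarrow> (h \<cdot> g) \<cdot> f = h \<cdot> (g \<cdot> f)"
    and unt_obj: "\<I> \<in> Obj C"
    and ten_obj: "X \<in> Obj C \<Longrightarrow> Y \<in> Obj C \<Longrightarrow> X \<otimes> Y \<in> Obj C"
    and ten_hom: "f \<in> hom C X X' \<Longrightarrow> g \<in> hom C Y Y' \<Longrightarrow> f \<odot> g \<in> hom C (X \<otimes> Y) (X' \<otimes> Y')"
    and ten_idn: "X \<in> Obj C \<Longrightarrow> Y \<in> Obj C \<Longrightarrow> Idn C X \<odot> Idn C Y = Idn C (X \<otimes> Y)"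
    and ten_cmp: "f \<in> hom C X X' \<Longrightarrow> f' \<in> hom C X' X'' \<Longrightarrow> g \<in> hom C Y Y' \<Longrightarrow> g' \<in> hom C Y' Y''
          \<Longrightarrow> (f' \<cdot> f) \<odot> (g' \<cdot> g) = (f' \<odot> g') \<cdot> (f \<odot> g)"
    and assoc_hom: "X \<in> Obj C \<Longrightarrow> Y \<in> Obj C \<Longrightarrow> Z \<in> Obj C
          \<Longrightarrow> Assoc C X Y Z \<in> hom C ((X \<otimes> Y) \<otimes> Z) (X \<otimes> (Y \<otimes> Z))"
    and assoc_iso: "X \<in> Obj C \<Longrightarrow> Y \<in> Obj C \<Longrightarrow> Z \<in> Obj C \<Longrightarrow> iso_arr C (Assoc C X Y Z)"
    and assoc_nat: "f \<in> hom C X X' \<Longrightarrow> g \<in> hom C Y Y' \<Longrightarrow> h \<in> hom C Z Z'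
          \<Longrightarrow> Assoc C X' Y' Z' \<cdot> ((f \<odot> g) \<odot> h) = (f \<odot> (g \<odot> h)) \<cdot> Assoc C X Y Z"
    and lun_hom: "X \<in> Obj C \<Longrightarrow> Lun C X \<in> hom C (\<I> \<otimes> X) X"
    and lun_iso: "X \<in> Obj C \<Longrightarrow> iso_arr C (Lun C X)"
    and lun_nat: "f \<in> hom C X Y \<Longrightarrow> Lun C Y \<cdot> (Idn C \<I> \<odot> f) = f \<cdot> Lun C X"
    and run_hom: "X \<in> Obj C \<Longrightarrow> Run C X \<in> hom C (X \<otimes> \<I>) X"
    and run_iso: "X \<in> Obj C \<Longrightarrow> iso_arr C (Run C X)"
    and run_nat: "f \<in> hom C X Y \<Longrightarrow> Run C Y \<cdot> (f \<odot> Idn C \<I>) = f \<cdot> Run C X"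
    and pentagon: "W \<in> Obj C \<Longrightarrow> X \<in> Obj C \<Longrightarrow> Y \<in> Obj C \<Longrightarrow> Z \<in> Obj C
          \<Longrightarrow> Assoc C W X (Y \<otimes> Z) \<cdot> Assoc C (W \<otimes> X) Y Z =
              (Idn C W \<odot> Assoc C X Y Z) \<cdot> Assoc C W (X \<otimes> Y) Z \<cdot> (Assoc C W X Y \<odot> Idn C Z)"
    and triangle: "X \<in> Obj C \<Longrightarrow> Y \<in> Obj C
          \<Longrightarrow> (Idn C X \<odot> Lun C Y) \<cdot> Assoc C X \<I> Y = Run C X \<odot> Idn C Y"


section \<open>Quotients by generated equivalence relations\<close>

text \<open>In all uses \<open>R \<subseteq> S \<times> S\<close> under the standing hypotheses, so that the classes are subsets of \<open>S\<close>.\<close>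

definition eqcl :: "('t \<times> 't) set \<Rightarrow> 't \<Rightarrow> 't set" where
  "eqcl R t = (R \<union> R\<inverse>)\<^sup>* `` {t}"

definition quot :: "'t set \<Rightarrow> ('t \<times> 't) set \<Rightarrow> 't set set" where
  "quot S R = eqcl R ` S"

text \<open>The value at a class \<open>c\<close> of the map induced by a map \<open>\<phi>\<close> that is constant on classes.\<close>

definition induced :: "('t \<Rightarrow> 's) \<Rightarrow> 't set \<Rightarrow> 's" where
  "induced \<phi> c = the_elem (\<phi> ` c)"


section \<open>Set-valued functors and convolution\<close>

text \<open>The category of sets is represented by the sets over arbitrary HOL types; different
  functors may take their values in sets over different types.\<close>

record ('o, 'a, 'x) set_functor =
  FO :: "'o \<Rightarrow> 'x set"
  FA :: "'a \<Rightarrow> 'x \<Rightarrow> 'x"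

type_synonym ('o, 'a, 'x, 'y) conv_elem = "('o \<times> 'o \<times> 'a \<times> 'x \<times> 'y) set"

record ('o, 'a, 'x) fmonoid =
  mon_fun :: "('o, 'a, 'x) set_functor"
  mon_mult :: "'o \<Rightarrow> ('o, 'a, 'x, 'x) conv_elem \<Rightarrow> 'x"
  mon_unit :: "'o \<Rightarrow> 'a \<Rightarrow> 'x"

text \<open>In \<open>('o, 'a, 'b, 'x) rmod\<close> the elements of the module have type \<open>'x\<close> and those of the
  monoid acting on the right have type \<open>'b\<close>. In \<open>('o, 'a, 'b, 'x, 'l) bimod\<close> those of the monoid
  acting on the left have type \<open>'l\<close>.\<close>

record ('o, 'a, 'b, 'x) rmod =
  mod_fun :: "('o, 'a, 'x) set_functor"
  ract :: "'o \<Rightarrow> ('o, 'a, 'x, 'b) conv_elem \<Rightarrow> 'x"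

record ('o, 'a, 'b, 'x, 'l) bimod = "('o, 'a, 'b, 'x) rmod" +
  lact :: "'o \<Rightarrow> ('o, 'a, 'l, 'x) conv_elem \<Rightarrow> 'x"

definition idt :: "'o \<Rightarrow> 'x \<Rightarrow> 'x" where
  "idt X x = x"

context monoidal_category
begin

definition is_functor :: "('o, 'a, 'x) set_functor \<Rightarrow> bool" where
  "is_functor F \<longleftrightarrow>
     (\<forall>X Y. \<forall>f \<in> hom C X Y. \<forall>x \<in> FO F X. FA F f x \<in> FO F Y) \<and>
     (\<forall>X \<in> Obj C. \<forall>x \<in> FO F X. FA F (Idn C X) x = x) \<and>
     (\<forall>X Y Z. \<forall>f \<in> hom C X Y. \<forall>g \<in> hom C Y Z. \<forall>x \<in> FO F X.
        FA F (g \<cdot> f) x = FA F g (FA F f x))"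

definition nat_trans ::
  "('o, 'a, 'x) set_functor \<Rightarrow> ('o, 'a, 'y) set_functor \<Rightarrow> ('o \<Rightarrow> 'x \<Rightarrow> 'y) \<Rightarrow> bool" where
  "nat_trans F G \<sigma> \<longleftrightarrow>
     (\<forall>X \<in> Obj C. \<forall>x \<in> FO F X. \<sigma> X x \<in> FO G X) \<and>
     (\<forall>X Y. \<forall>f \<in> hom C X Y. \<forall>x \<in> FO F X. \<sigma> Y (FA F f x) = FA G f (\<sigma> X x))"

text \<open>The coend \<open>\<integral>\<^sup>X\<^sup>,\<^sup>Y C(X \<otimes> Y, U) \<times> M(X) \<times> N(Y)\<close>: the coproduct over all \<open>X\<close> and \<open>Y\<close>,
  divided by the equivalence relation generated by dinaturality in \<open>X\<close> and \<open>Y\<close>.\<close>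

definition conv_pre ::
  "('o, 'a, 'x) set_functor \<Rightarrow> ('o, 'a, 'y) set_functor \<Rightarrow> 'o \<Rightarrow> ('o, 'a, 'x, 'y) conv_elem" where
  "conv_pre M N U = {(X, Y, f, m, n) | X Y f m n.
     X \<in> Obj C \<and> Y \<in> Obj C \<and> f \<in> hom C (X \<otimes> Y) U \<and> m \<in> FO M X \<and> n \<in> FO N Y}"

definition conv_rel ::
  "('o, 'a, 'x) set_functor \<Rightarrow> ('o, 'a, 'y) set_functor \<Rightarrow> 'o
     \<Rightarrow> (('o \<times> 'o \<times> 'a \<times> 'x \<times> 'y) \<times> ('o \<times> 'o \<times> 'a \<times> 'x \<times> 'y)) set" where
  "conv_rel M N U =
     {((X, Y, f \<cdot> (g \<odot> h), m, n), (X', Y', f, FA M g m, FA N h n)) | X Y X' Y' f g h m n.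
        g \<in> hom C X X' \<and> h \<in> hom C Y Y' \<and> f \<in> hom C (X' \<otimes> Y') U \<and> m \<in> FO M X \<and> n \<in> FO N Y}"

definition conv_cl ::
  "('o, 'a, 'x) set_functor \<Rightarrow> ('o, 'a, 'y) set_functor \<Rightarrow> 'o
     \<Rightarrow> 'o \<times> 'o \<times> 'a \<times> 'x \<times> 'y \<Rightarrow> ('o, 'a, 'x, 'y) conv_elem" where
  "conv_cl M N U t = eqcl (conv_rel M N U) t"

definition conv ::
  "('o, 'a, 'x) set_functor \<Rightarrow> ('o, 'a, 'y) set_functor
     \<Rightarrow> ('o, 'a, ('o, 'a, 'x, 'y) conv_elem) set_functor"  (infixl "\<star>" 70) where
  "M \<star> N = \<lparr> FO = (\<lambda>U. quot (conv_pre M N U) (conv_rel M N U)),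
             FA = (\<lambda>k. induced (\<lambda>(X, Y, f, m, n). conv_cl M N (Cod C k) (X, Y, k \<cdot> f, m, n))) \<rparr>"

definition J :: "('o, 'a, 'a) set_functor" where
  "J = \<lparr> FO = (\<lambda>U. hom C \<I> U), FA = (\<lambda>k j. k \<cdot> j) \<rparr>"

text \<open>In \<open>conv_map M' N' \<sigma> \<tau> : M \<star> N \<rightarrow> M' \<star> N'\<close> only the codomains are recorded.\<close>

definition conv_map ::
  "('o, 'a, 'x2) set_functor \<Rightarrow> ('o, 'a, 'y2) set_functor
     \<Rightarrow> ('o \<Rightarrow> 'x1 \<Rightarrow> 'x2) \<Rightarrow> ('o \<Rightarrow> 'y1 \<Rightarrow> 'y2)
     \<Rightarrow> 'o \<Rightarrow> ('o, 'a, 'x1, 'y1) conv_elem \<Rightarrow> ('o, 'a, 'x2, 'y2) conv_elem" where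
  "conv_map M' N' \<sigma> \<tau> U =
     induced (\<lambda>(X, Y, f, m, n). conv_cl M' N' U (X, Y, f, \<sigma> X m, \<tau> Y n))"

definition conv_assoc ::
  "('o, 'a, 'x) set_functor \<Rightarrow> ('o, 'a, 'y) set_functor \<Rightarrow> ('o, 'a, 'z) set_functor
     \<Rightarrow> 'o \<Rightarrow> ('o, 'a, ('o, 'a, 'x, 'y) conv_elem, 'z) conv_elem
     \<Rightarrow> ('o, 'a, 'x, ('o, 'a, 'y, 'z) conv_elem) conv_elem" where
  "conv_assoc M N P U =
     induced (\<lambda>(W, Z, f, c, p).
       induced (\<lambda>(X, Y, g, m, n).
         conv_cl M (N \<star> P) U
           (X, Y \<otimes> Z, f \<cdot> (g \<odot> Idn C Z) \<cdot> inv_arr C (Assoc C X Y Z), m,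
            conv_cl N P (Y \<otimes> Z) (Y, Z, Idn C (Y \<otimes> Z), n, p))) c)"

definition conv_assoc_inv ::
  "('o, 'a, 'x) set_functor \<Rightarrow> ('o, 'a, 'y) set_functor \<Rightarrow> ('o, 'a, 'z) set_functor
     \<Rightarrow> 'o \<Rightarrow> ('o, 'a, 'x, ('o, 'a, 'y, 'z) conv_elem) conv_elem
     \<Rightarrow> ('o, 'a, ('o, 'a, 'x, 'y) conv_elem, 'z) conv_elem" where
  "conv_assoc_inv M N P U =
     induced (\<lambda>(X, W, f, m, c).
       induced (\<lambda>(Y, Z, g, n, p).
         conv_cl (M \<star> N) P U
           (X \<otimes> Y, Z, f \<cdot> (Idn C X \<odot> g) \<cdot> Assoc C X Y Z,
            conv_cl M N (X \<otimes> Y) (X, Y, Idn C (X \<otimes> Y), m, n), p)) c)"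

definition conv_lun ::
  "('o, 'a, 'x) set_functor \<Rightarrow> 'o \<Rightarrow> ('o, 'a, 'a, 'x) conv_elem \<Rightarrow> 'x" where
  "conv_lun M U =
     induced (\<lambda>(X, Y, f, j, m). FA M (f \<cdot> (j \<odot> Idn C Y) \<cdot> inv_arr C (Lun C Y)) m)"

definition conv_run ::
  "('o, 'a, 'x) set_functor \<Rightarrow> 'o \<Rightarrow> ('o, 'a, 'x, 'a) conv_elem \<Rightarrow> 'x" where
  "conv_run M U =
     induced (\<lambda>(X, Y, f, m, j). FA M (f \<cdot> (Idn C X \<odot> j) \<cdot> inv_arr C (Run C X)) m)"


section \<open>Monoids and modules\<close>

definition is_monoid :: "('o, 'a, 'x) fmonoid \<Rightarrow> bool" where
  "is_monoid A \<longleftrightarrow>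
     is_functor (mon_fun A) \<and>
     nat_trans (mon_fun A \<star> mon_fun A) (mon_fun A) (mon_mult A) \<and>
     nat_trans J (mon_fun A) (mon_unit A) \<and>
     (\<forall>U \<in> Obj C. \<forall>z \<in> FO ((mon_fun A \<star> mon_fun A) \<star> mon_fun A) U.
        mon_mult A U (conv_map (mon_fun A) (mon_fun A) (mon_mult A) idt U z) =
        mon_mult A U (conv_map (mon_fun A) (mon_fun A) idt (mon_mult A) U
          (conv_assoc (mon_fun A) (mon_fun A) (mon_fun A) U z))) \<and>
     (\<forall>U \<in> Obj C. \<forall>z \<in> FO (J \<star> mon_fun A) U.
        mon_mult A U (conv_map (mon_fun A) (mon_fun A) (mon_unit A) idt U z) =
        conv_lun (mon_fun A) U z) \<and>
     (\<forall>U \<in> Obj C. \<forall>z \<in> FO (mon_fun A \<star> J) U.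
        mon_mult A U (conv_map (mon_fun A) (mon_fun A) idt (mon_unit A) U z) =
        conv_run (mon_fun A) U z)"

definition unit_monoid :: "('o, 'a, 'a) fmonoid" where
  "unit_monoid = \<lparr> mon_fun = J, mon_mult = conv_lun J, mon_unit = idt \<rparr>"

definition right_module ::
  "('o, 'a, 'b) fmonoid \<Rightarrow> ('o, 'a, 'b, 'x, 'r) rmod_scheme \<Rightarrow> bool" where
  "right_module B M \<longleftrightarrow>
     is_functor (mod_fun M) \<and>
     nat_trans (mod_fun M \<star> mon_fun B) (mod_fun M) (ract M) \<and>
     (\<forall>U \<in> Obj C. \<forall>z \<in> FO ((mod_fun M \<star> mon_fun B) \<star> mon_fun B) U.
        ract M U (conv_map (mod_fun M) (mon_fun B) (ract M) idt U z) =
        ract M U (conv_map (mod_fun M) (mon_fun B) idt (mon_mult B) U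
          (conv_assoc (mod_fun M) (mon_fun B) (mon_fun B) U z))) \<and>
     (\<forall>U \<in> Obj C. \<forall>z \<in> FO (mod_fun M \<star> J) U.
        ract M U (conv_map (mod_fun M) (mon_fun B) idt (mon_unit B) U z) =
        conv_run (mod_fun M) U z)"

definition left_module ::
  "('o, 'a, 'l) fmonoid \<Rightarrow> ('o, 'a, 'b, 'x, 'l) bimod \<Rightarrow> bool" where
  "left_module A M \<longleftrightarrow>
     is_functor (mod_fun M) \<and>
     nat_trans (mon_fun A \<star> mod_fun M) (mod_fun M) (lact M) \<and>
     (\<forall>U \<in> Obj C. \<forall>z \<in> FO ((mon_fun A \<star> mon_fun A) \<star> mod_fun M) U.
        lact M U (conv_map (mon_fun A) (mod_fun M) (mon_mult A) idt U z) =
        lact M U (conv_map (mon_fun A) (mod_fun M) idt (lact M) U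
          (conv_assoc (mon_fun A) (mon_fun A) (mod_fun M) U z))) \<and>
     (\<forall>U \<in> Obj C. \<forall>z \<in> FO (J \<star> mod_fun M) U.
        lact M U (conv_map (mon_fun A) (mod_fun M) (mon_unit A) idt U z) =
        conv_lun (mod_fun M) U z)"

text \<open>\<open>bimodule A B M\<close> says that \<open>M\<close> is a module \<open>A \<rightarrow> B\<close>. Its two-sided action
  \<open>A \<star> M \<star> B \<rightarrow> M\<close> is the common value of the two composites in the last clause.\<close>

definition bimodule ::
  "('o, 'a, 'l) fmonoid \<Rightarrow> ('o, 'a, 'b) fmonoid \<Rightarrow> ('o, 'a, 'b, 'x, 'l) bimod \<Rightarrow> bool" where
  "bimodule A B M \<longleftrightarrow>
     left_module A M \<and> right_module B M \<and>
     (\<forall>U \<in> Obj C. \<forall>z \<in> FO ((mon_fun A \<star> mod_fun M) \<star> mon_fun B) U.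
        ract M U (conv_map (mod_fun M) (mon_fun B) (lact M) idt U z) =
        lact M U (conv_map (mon_fun A) (mod_fun M) idt (ract M) U
          (conv_assoc (mon_fun A) (mod_fun M) (mon_fun B) U z)))"

definition right_module_hom ::
  "('o, 'a, 'b) fmonoid \<Rightarrow> ('o, 'a, 'b, 'x, 'r) rmod_scheme \<Rightarrow> ('o, 'a, 'b, 'y, 's) rmod_scheme
     \<Rightarrow> ('o \<Rightarrow> 'x \<Rightarrow> 'y) \<Rightarrow> bool" where
  "right_module_hom B M N \<sigma> \<longleftrightarrow>
     nat_trans (mod_fun M) (mod_fun N) \<sigma> \<and>
     (\<forall>U \<in> Obj C. \<forall>z \<in> FO (mod_fun M \<star> mon_fun B) U.
        \<sigma> U (ract M U z) = ract N U (conv_map (mod_fun N) (mon_fun B) \<sigma> idt U z))"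

definition two_cell ::
  "('o, 'a, 'l) fmonoid \<Rightarrow> ('o, 'a, 'b) fmonoid \<Rightarrow> ('o, 'a, 'b, 'x, 'l) bimod
     \<Rightarrow> ('o, 'a, 'b, 'y, 'l) bimod \<Rightarrow> ('o \<Rightarrow> 'x \<Rightarrow> 'y) \<Rightarrow> bool" where
  "two_cell A B M N \<sigma> \<longleftrightarrow>
     right_module_hom B M N \<sigma> \<and>
     (\<forall>U \<in> Obj C. \<forall>z \<in> FO (mon_fun A \<star> mod_fun M) U.
        \<sigma> U (lact M U z) = lact N U (conv_map (mon_fun A) (mod_fun N) idt \<sigma> U z))"


section \<open>The bicategory of modules\<close>

definition id_mod :: "('o, 'a, 'x) fmonoid \<Rightarrow> ('o, 'a, 'x, 'x, 'x) bimod" where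
  "id_mod A = \<lparr> mod_fun = mon_fun A, ract = mon_mult A, lact = mon_mult A \<rparr>"

text \<open>Coequalizers in the functor category are computed pointwise. \<open>bal_rel B M N U\<close> relates the
  two images in \<open>(M \<star> N)(U)\<close> of each element of \<open>((M \<star> B) \<star> N)(U)\<close>, and \<open>bal_fun B M N\<close> is the
  functor \<open>M *\<^sub>B N\<close>.\<close>

definition bal_rel ::
  "('o, 'a, 'b) fmonoid \<Rightarrow> ('o, 'a, 'b, 'x, 'l) bimod \<Rightarrow> ('o, 'a, 'd, 'y, 'b) bimod \<Rightarrow> 'o
     \<Rightarrow> (('o, 'a, 'x, 'y) conv_elem \<times> ('o, 'a, 'x, 'y) conv_elem) set" where
  "bal_rel B M N U =
     {(conv_map (mod_fun M) (mod_fun N) (ract M) idt U z,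
       conv_map (mod_fun M) (mod_fun N) idt (lact N) U
         (conv_assoc (mod_fun M) (mon_fun B) (mod_fun N) U z)) | z.
      z \<in> FO ((mod_fun M \<star> mon_fun B) \<star> mod_fun N) U}"

definition bal_cl ::
  "('o, 'a, 'b) fmonoid \<Rightarrow> ('o, 'a, 'b, 'x, 'l) bimod \<Rightarrow> ('o, 'a, 'd, 'y, 'b) bimod \<Rightarrow> 'o
     \<Rightarrow> ('o, 'a, 'x, 'y) conv_elem \<Rightarrow> ('o, 'a, 'x, 'y) conv_elem set" where
  "bal_cl B M N U c = eqcl (bal_rel B M N U) c"

definition bal_fun ::
  "('o, 'a, 'b) fmonoid \<Rightarrow> ('o, 'a, 'b, 'x, 'l) bimod \<Rightarrow> ('o, 'a, 'd, 'y, 'b) bimod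
     \<Rightarrow> ('o, 'a, ('o, 'a, 'x, 'y) conv_elem set) set_functor" where
  "bal_fun B M N =
     \<lparr> FO = (\<lambda>U. quot (FO (mod_fun M \<star> mod_fun N) U) (bal_rel B M N U)),
       FA = (\<lambda>k. induced (\<lambda>c. bal_cl B M N (Cod C k) (FA (mod_fun M \<star> mod_fun N) k c))) \<rparr>"

text \<open>The composite of \<open>M : A \<rightarrow> B\<close> and \<open>N : B \<rightarrow> D\<close> is \<open>mod_comp A B D M N : A \<rightarrow> D\<close>. Its right
  action is induced by \<open>(M \<star> N) \<star> D \<cong> M \<star> (N \<star> D) \<rightarrow> M \<star> N\<close>, its left action by
  \<open>A \<star> (M \<star> N) \<cong> (A \<star> M) \<star> N \<rightarrow> M \<star> N\<close>.\<close>

definition mod_comp ::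
  "('o, 'a, 'l) fmonoid \<Rightarrow> ('o, 'a, 'b) fmonoid \<Rightarrow> ('o, 'a, 'd) fmonoid
     \<Rightarrow> ('o, 'a, 'b, 'x, 'l) bimod \<Rightarrow> ('o, 'a, 'd, 'y, 'b) bimod
     \<Rightarrow> ('o, 'a, 'd, ('o, 'a, 'x, 'y) conv_elem set, 'l) bimod" where
  "mod_comp A B D M N =
     \<lparr> mod_fun = bal_fun B M N,
       ract = (\<lambda>U. induced (\<lambda>(X, Y, f, q, d). induced (\<lambda>c.
         bal_cl B M N U (conv_map (mod_fun M) (mod_fun N) idt (ract N) U
           (conv_assoc (mod_fun M) (mod_fun N) (mon_fun D) U
             (conv_cl (mod_fun M \<star> mod_fun N) (mon_fun D) U (X, Y, f, c, d))))) q)),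
       lact = (\<lambda>U. induced (\<lambda>(X, Y, f, a, q). induced (\<lambda>c.
         bal_cl B M N U (conv_map (mod_fun M) (mod_fun N) (lact M) idt U
           (conv_assoc_inv (mon_fun A) (mod_fun M) (mod_fun N) U
             (conv_cl (mon_fun A) (mod_fun M \<star> mod_fun N) U (X, Y, f, a, c))))) q)) \<rparr>"

text \<open>The horizontal composite \<open>\<sigma> *\<^sub>B \<tau> : M *\<^sub>B N \<rightarrow> M' *\<^sub>B N'\<close>; only the codomains are recorded.\<close>

definition hcomp ::
  "('o, 'a, 'b) fmonoid \<Rightarrow> ('o, 'a, 'b, 'x2, 'l) bimod \<Rightarrow> ('o, 'a, 'd, 'y2, 'b) bimod
     \<Rightarrow> ('o \<Rightarrow> 'x1 \<Rightarrow> 'x2) \<Rightarrow> ('o \<Rightarrow> 'y1 \<Rightarrow> 'y2)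
     \<Rightarrow> 'o \<Rightarrow> ('o, 'a, 'x1, 'y1) conv_elem set \<Rightarrow> ('o, 'a, 'x2, 'y2) conv_elem set" where
  "hcomp B M' N' \<sigma> \<tau> U =
     induced (\<lambda>c. bal_cl B M' N' U (conv_map (mod_fun M') (mod_fun N') \<sigma> \<tau> U c))"

text \<open>The associativity constraint \<open>(M *\<^sub>B N) *\<^sub>D P \<rightarrow> M *\<^sub>B (N *\<^sub>D P)\<close> for \<open>M : A \<rightarrow> B\<close>,
  \<open>N : B \<rightarrow> D\<close>, \<open>P : D \<rightarrow> E\<close>, induced by that of the convolution, and its inverse.\<close>

definition mod_assoc ::
  "('o, 'a, 'b) fmonoid \<Rightarrow> ('o, 'a, 'd) fmonoid \<Rightarrow> ('o, 'a, 'e) fmonoid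
     \<Rightarrow> ('o, 'a, 'b, 'x, 'l) bimod \<Rightarrow> ('o, 'a, 'd, 'y, 'b) bimod \<Rightarrow> ('o, 'a, 'e, 'z, 'd) bimod
     \<Rightarrow> 'o \<Rightarrow> ('o, 'a, ('o, 'a, 'x, 'y) conv_elem set, 'z) conv_elem set
     \<Rightarrow> ('o, 'a, 'x, ('o, 'a, 'y, 'z) conv_elem set) conv_elem set" where
  "mod_assoc B D E M N P U =
     induced (induced (\<lambda>(X, Y, f, q, p). induced (\<lambda>c.
       bal_cl B M (mod_comp B D E N P) U
         (conv_map (mod_fun M) (bal_fun D N P) idt (bal_cl D N P) U
           (conv_assoc (mod_fun M) (mod_fun N) (mod_fun P) U
             (conv_cl (mod_fun M \<star> mod_fun N) (mod_fun P) U (X, Y, f, c, p))))) q))"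

definition mod_assoc_inv ::
  "('o, 'a, 'l) fmonoid \<Rightarrow> ('o, 'a, 'b) fmonoid \<Rightarrow> ('o, 'a, 'd) fmonoid
     \<Rightarrow> ('o, 'a, 'b, 'x, 'l) bimod \<Rightarrow> ('o, 'a, 'd, 'y, 'b) bimod \<Rightarrow> ('o, 'a, 'e, 'z, 'd) bimod
     \<Rightarrow> 'o \<Rightarrow> ('o, 'a, 'x, ('o, 'a, 'y, 'z) conv_elem set) conv_elem set
     \<Rightarrow> ('o, 'a, ('o, 'a, 'x, 'y) conv_elem set, 'z) conv_elem set" where
  "mod_assoc_inv A B D M N P U =
     induced (induced (\<lambda>(X, Y, f, m, q). induced (\<lambda>c.
       bal_cl D (mod_comp A B D M N) P U
         (conv_map (bal_fun B M N) (mod_fun P) (bal_cl B M N) idt U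
           (conv_assoc_inv (mod_fun M) (mod_fun N) (mod_fun P) U
             (conv_cl (mod_fun M) (mod_fun N \<star> mod_fun P) U (X, Y, f, m, c))))) q))"

text \<open>The unit constraints \<open>A *\<^sub>A M \<rightarrow> M\<close> and \<open>M *\<^sub>B B \<rightarrow> M\<close> are induced by the actions.\<close>

definition mod_lun ::
  "('o, 'a, 'b, 'x, 'l) bimod \<Rightarrow> 'o \<Rightarrow> ('o, 'a, 'l, 'x) conv_elem set \<Rightarrow> 'x" where
  "mod_lun M U = induced (lact M U)"

definition mod_run ::
  "('o, 'a, 'b, 'x, 'l) bimod \<Rightarrow> 'o \<Rightarrow> ('o, 'a, 'x, 'b) conv_elem set \<Rightarrow> 'x" where
  "mod_run M U = induced (ract M U)"

text \<open>\<open>M : A \<rightarrow> B\<close> is left adjoint to \<open>N : B \<rightarrow> A\<close> with unit \<open>\<eta> : A \<rightarrow> M *\<^sub>B N\<close> and counit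
  \<open>\<epsilon> : N *\<^sub>A M \<rightarrow> B\<close> (composites in diagrammatic order). The triangle identities are stated as
  equations between maps \<open>A *\<^sub>A M \<rightarrow> M\<close> and \<open>N *\<^sub>A A \<rightarrow> N\<close>.\<close>

definition adjunction ::
  "('o, 'a, 'l) fmonoid \<Rightarrow> ('o, 'a, 'b) fmonoid
     \<Rightarrow> ('o, 'a, 'b, 'x, 'l) bimod \<Rightarrow> ('o, 'a, 'l, 'y, 'b) bimod
     \<Rightarrow> ('o \<Rightarrow> 'l \<Rightarrow> ('o, 'a, 'x, 'y) conv_elem set)
     \<Rightarrow> ('o \<Rightarrow> ('o, 'a, 'y, 'x) conv_elem set \<Rightarrow> 'b) \<Rightarrow> bool" where
  "adjunction A B M N \<eta> \<epsilon> \<longleftrightarrow>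
     two_cell A A (id_mod A) (mod_comp A B A M N) \<eta> \<and>
     two_cell B B (mod_comp B A B N M) (id_mod B) \<epsilon> \<and>
     (\<forall>U \<in> Obj C. \<forall>z \<in> FO (bal_fun A (id_mod A) M) U.
        mod_run M U (hcomp B M (id_mod B) idt \<epsilon> U
          (mod_assoc B A B M N M U (hcomp A (mod_comp A B A M N) M \<eta> idt U z))) =
        mod_lun M U z) \<and>
     (\<forall>U \<in> Obj C. \<forall>z \<in> FO (bal_fun A N (id_mod A)) U.
        mod_lun N U (hcomp B (id_mod B) N \<epsilon> idt U
          (mod_assoc_inv B A B N M N U (hcomp A N (mod_comp A B A M N) idt \<eta> U z))) =
        mod_run N U z)"


section \<open>The Cauchy completion, representable modules and retracts\<close>

text \<open>HOL cannot quantify existentially over types, so the type \<open>'n\<close> of the elements of the right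
  adjoint is a parameter.\<close>

definition cauchy_completion ::
  "'n itself \<Rightarrow> ('o, 'a, 'b) fmonoid \<Rightarrow> ('o, 'a, 'b, 'x, 'a) bimod set" where
  "cauchy_completion T A =
     {M. bimodule unit_monoid A M \<and>
         (\<exists>(N :: ('o, 'a, 'a, 'n, 'b) bimod) \<eta> \<epsilon>.
            bimodule A unit_monoid N \<and> adjunction unit_monoid A M N \<eta> \<epsilon>)}"

text \<open>The right module \<open>A(K \<otimes> -)\<close>. The element \<open>conv_cl \<dots> (K \<otimes> X, Y, Idn, a, b)\<close> is the image of
  \<open>(a, b)\<close> under \<open>A(K \<otimes> X) \<times> A(Y) \<rightarrow> (A \<star> A)((K \<otimes> X) \<otimes> Y)\<close>.\<close>

definition rep_mod :: "('o, 'a, 'b) fmonoid \<Rightarrow> 'o \<Rightarrow> ('o, 'a, 'b, 'b) rmod" where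
  "rep_mod A K =
     \<lparr> mod_fun = \<lparr> FO = (\<lambda>U. FO (mon_fun A) (K \<otimes> U)),
                   FA = (\<lambda>g. FA (mon_fun A) (Idn C K \<odot> g)) \<rparr>,
       ract = (\<lambda>U. induced (\<lambda>(X, Y, f, a, b).
         FA (mon_fun A) ((Idn C K \<odot> f) \<cdot> Assoc C K X Y)
           (mon_mult A ((K \<otimes> X) \<otimes> Y)
             (conv_cl (mon_fun A) (mon_fun A) ((K \<otimes> X) \<otimes> Y)
               (K \<otimes> X, Y, Idn C ((K \<otimes> X) \<otimes> Y), a, b))))) \<rparr>"

definition right_module_retract ::
  "('o, 'a, 'b) fmonoid \<Rightarrow> ('o, 'a, 'b, 'x, 'r) rmod_scheme \<Rightarrow> ('o, 'a, 'b, 'y, 's) rmod_scheme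
     \<Rightarrow> bool" where
  "right_module_retract A M P \<longleftrightarrow>
     right_module A M \<and> right_module A P \<and>
     (\<exists>s r. right_module_hom A M P s \<and> right_module_hom A P M r \<and>
        (\<forall>U \<in> Obj C. \<forall>m \<in> FO (mod_fun M) U. r U (s U m) = m))"

end

end

theory Submission
  imports Defs
begin

text \<open>Let \<open>M : J \<rightarrow> A\<close> have the right adjoint \<open>N\<close>, with unit \<open>\<eta>\<close> and counit \<open>\<epsilon>\<close>. The element
  \<open>\<eta>(1\<^sub>I)\<close> of \<open>(M *\<^sub>A N)(I)\<close> is represented by a single quintuple \<open>(X, K, f, m, n)\<close> with
  \<open>f : X \<otimes> K \<rightarrow> I\<close>, \<open>m \<in> M(X)\<close> and \<open>n \<in> N(K)\<close>. The retraction is given by \<open>s(u) = \<epsilon>[n, u]\<close> from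
  \<open>M(U)\<close> to \<open>A(K \<otimes> U)\<close> and by \<open>r(a) = m \<cdot> a\<close>, transported along
  \<open>X \<otimes> (K \<otimes> U) \<cong> (X \<otimes> K) \<otimes> U \<rightarrow> I \<otimes> U \<cong> U\<close>; the first triangle identity at \<open>[1\<^sub>I, u]\<close> reads
  \<open>r(s(u)) = u\<close>.

  The rest is well-definedness of the maps on quotients. Natural transformations out of a convolution
  \<open>F \<star> G\<close> are handled through the corresponding natural families
  \<open>F(X) \<times> G(Y) \<rightarrow> H(X \<otimes> Y)\<close>, in terms of which the laws of monoids, modules and balanced
  tensor products become equations between elements.\<close>

subsection \<open>Coherence in monoidal categories\<close>

text \<open>The pair \<open>(m, n)\<close> behaves like a dual basis with a single element:
  \<open>r(s(u)) = u\<close> says that \<open>u\<close> is \<open>m\<close> multiplied by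
  \<open>\<epsilon>[n, u]\<close>, up to transport. One element is enough because the coend and the
  coequalizer are quotients of a coproduct of sets, where every class has one representative; hence
  one object \<open>K\<close> appears and no sum of modules \<open>A(K \<otimes> -)\<close>.

  The obstacle is the nesting of quotients. Every structure map is an \<open>induced\<close> map,
  whose value at a representative is known only after invariance has been proved, and the
  associativity constraint of modules passes through three such layers. The proofs therefore work
  with one normal form: every element of a convolution or of a balanced tensor product is the
  transport, along an arrow, of an elementary tensor.

  The category is not strict, so each familiar identity of elements carries associators. The
  pentagon reconciles bracketings in composite modules and in \<open>A(K \<otimes> -)\<close>; of
  the two consequences of pentagon and triangle, the one for the left unitor enters the right
  linearity of \<open>r\<close>, the one for the right unitor the unit law of
  \<open>A(K \<otimes> -)\<close>.\<close>

context monoidal_category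
begin

section \<open>Arrow calculus: typing, inverses, cancellation\<close>

lemma hom_iff: "f \<in> hom C X Y \<longleftrightarrow> f \<in> Arr C \<and> Dom C f = X \<and> Cod C f = Y"
  by (simp add: hom_def)

lemma hom_obj:
  assumes "f \<in> hom C X Y"
  shows "X \<in> Obj C" "Y \<in> Obj C"
  using assms dom_obj cod_obj by (auto simp: hom_iff)

lemma idn_arr:
  assumes "X \<in> Obj C"
  shows "Idn C X \<in> Arr C" "Dom C (Idn C X) = X" "Cod C (Idn C X) = X"
  using idn_hom[OF assms] by (auto simp: hom_iff)

lemma cmp_arr:
  assumes "f \<in> Arr C" "g \<in> Arr C" "Cod C f = Dom C g"
  shows "g \<cdot> f \<in> Arr C" "Dom C (g \<cdot> f) = Dom C f" "Cod C (g \<cdot> f) = Cod C g"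
  using cmp_hom[of f "Dom C f" "Cod C f" g "Cod C g"] assms by (auto simp: hom_iff)

lemma ten_arr:
  assumes "f \<in> Arr C" "g \<in> Arr C"
  shows "f \<odot> g \<in> Arr C" "Dom C (f \<odot> g) = Dom C f \<otimes> Dom C g" "Cod C (f \<odot> g) = Cod C f \<otimes> Cod C g"
  using ten_hom[of f "Dom C f" "Cod C f" g "Dom C g" "Cod C g"] assms by (auto simp: hom_iff)

lemma idn_left: "f \<in> Arr C \<Longrightarrow> Cod C f = X \<Longrightarrow> Idn C X \<cdot> f = f"
  using cmp_idn_left[of f "Dom C f" X] by (auto simp: hom_iff)

lemma idn_right: "f \<in> Arr C \<Longrightarrow> Dom C f = X \<Longrightarrow> f \<cdot> Idn C X = f"
  using cmp_idn_right[of f X "Cod C f"] by (auto simp: hom_iff)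

lemma assoc_cmp:
  assumes "f \<in> Arr C" "g \<in> Arr C" "h \<in> Arr C" "Cod C f = Dom C g" "Cod C g = Dom C h"
  shows "(h \<cdot> g) \<cdot> f = h \<cdot> g \<cdot> f"
  using cmp_assoc[of f "Dom C f" "Cod C f" g "Cod C g" h "Cod C h"] assms by (auto simp: hom_iff)

lemma interchange:
  assumes "f \<in> Arr C" "f' \<in> Arr C" "g \<in> Arr C" "g' \<in> Arr C"
    and "Cod C f = Dom C f'" "Cod C g = Dom C g'"
  shows "(f' \<odot> g') \<cdot> (f \<odot> g) = (f' \<cdot> f) \<odot> (g' \<cdot> g)"
  using ten_cmp[of f "Dom C f" "Cod C f" f' "Cod C f'" g "Dom C g" "Cod C g" g' "Cod C g'"] assms
  by (auto simp: hom_iff)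

text \<open>Composites are kept nested to the right, so inside a longer composite two adjacent
  factors do not stand together as a subterm. Each \<open>_tail\<close> version is the same equation
  followed by a further arrow \<open>k\<close>.\<close>

lemma interchange_tail:
  assumes "f \<in> Arr C" "f' \<in> Arr C" "g \<in> Arr C" "g' \<in> Arr C" "k \<in> Arr C"
    and "Cod C f = Dom C f'" "Cod C g = Dom C g'" "Cod C k = Dom C f \<otimes> Dom C g"
  shows "(f' \<odot> g') \<cdot> (f \<odot> g) \<cdot> k = ((f' \<cdot> f) \<odot> (g' \<cdot> g)) \<cdot> k"
proof -
  have "(f' \<odot> g') \<cdot> (f \<odot> g) \<cdot> k = ((f' \<odot> g') \<cdot> (f \<odot> g)) \<cdot> k"
    using assms by (simp add: assoc_cmp ten_arr)
  then show ?thesis using assms by (simp add: interchange)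
qed

lemma inverse_arrows_unique:
  assumes g: "inverse_arrows C f g" and h: "inverse_arrows C f h"
  shows "g = h"
proof -
  from g h have m: "f \<in> Arr C" "g \<in> Arr C" "h \<in> Arr C"
    and e: "Dom C g = Cod C f" "Cod C g = Dom C f" "Dom C h = Cod C f" "Cod C h = Dom C f"
      "g \<cdot> f = Idn C (Dom C f)" "f \<cdot> h = Idn C (Cod C f)"
    by (auto simp: inverse_arrows_def hom_iff)
  have "g = g \<cdot> (f \<cdot> h)" using m e by (simp add: idn_right)
  also have "\<dots> = (g \<cdot> f) \<cdot> h" by (rule assoc_cmp[symmetric]) (use m e in simp_all)
  also have "\<dots> = h" using m e by (simp add: idn_left)
  finally show ?thesis .
qed

lemma inverse_arrows_inv:
  assumes "iso_arr C f"
  shows "inverse_arrows C f (inv_arr C f)"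
proof -
  obtain g where "inverse_arrows C f g" using assms by (auto simp: iso_arr_def)
  then have "\<exists>!g. inverse_arrows C f g" using inverse_arrows_unique by blast
  then show ?thesis unfolding inv_arr_def by (rule theI')
qed

lemma inv_arr:
  assumes "iso_arr C f"
  shows "inv_arr C f \<in> Arr C" "Dom C (inv_arr C f) = Cod C f" "Cod C (inv_arr C f) = Dom C f"
    "inv_arr C f \<cdot> f = Idn C (Dom C f)" "f \<cdot> inv_arr C f = Idn C (Cod C f)" "f \<in> Arr C"
  using inverse_arrows_inv[OF assms] by (auto simp: inverse_arrows_def hom_iff)

lemma inv_arr_tail:
  assumes "iso_arr C f" "k \<in> Arr C"
  shows "Cod C k = Dom C f \<Longrightarrow> inv_arr C f \<cdot> f \<cdot> k = k"
    and "Cod C k = Cod C f \<Longrightarrow> f \<cdot> inv_arr C f \<cdot> k = k"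
proof -
  note f = inv_arr[OF assms(1)]
  show "inv_arr C f \<cdot> f \<cdot> k = k" if "Cod C k = Dom C f"
  proof -
    have "inv_arr C f \<cdot> f \<cdot> k = (inv_arr C f \<cdot> f) \<cdot> k"
      by (rule assoc_cmp[symmetric]) (use f assms(2) that in simp_all)
    then show ?thesis using f assms(2) that by (simp add: idn_left)
  qed
  show "f \<cdot> inv_arr C f \<cdot> k = k" if "Cod C k = Cod C f"
  proof -
    have "f \<cdot> inv_arr C f \<cdot> k = (f \<cdot> inv_arr C f) \<cdot> k"
      by (rule assoc_cmp[symmetric]) (use f assms(2) that in simp_all)
    then show ?thesis using f assms(2) that by (simp add: idn_left)
  qed
qed

lemma iso_cancel_right:
  assumes "iso_arr C e" "f \<in> Arr C" "g \<in> Arr C" "Dom C f = Cod C e" "Dom C g = Cod C e"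
    and "f \<cdot> e = g \<cdot> e"
  shows "f = g"
proof -
  have "h = (h \<cdot> e) \<cdot> inv_arr C e" if "h \<in> Arr C" "Dom C h = Cod C e" for h
    using that assms(1) by (simp add: assoc_cmp inv_arr idn_right)
  then show ?thesis using assms by metis
qed

lemma iso_cancel_left:
  assumes "iso_arr C e" "f \<in> Arr C" "g \<in> Arr C" "Cod C f = Dom C e" "Cod C g = Dom C e"
    and "e \<cdot> f = e \<cdot> g"
  shows "f = g"
  using assms inv_arr_tail(1) by metis

lemma iso_cmp:
  assumes "iso_arr C f" "iso_arr C g" "Cod C f = Dom C g"
  shows "iso_arr C (g \<cdot> f)"
  unfolding iso_arr_def inverse_arrows_def
  using assms inv_arr[OF assms(1)] inv_arr[OF assms(2)] inv_arr_tail
  by (intro exI[of _ "inv_arr C f \<cdot> inv_arr C g"]) (simp add: hom_iff assoc_cmp cmp_arr)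

lemma iso_ten:
  assumes "iso_arr C f" "iso_arr C g"
  shows "iso_arr C (f \<odot> g)"
  unfolding iso_arr_def inverse_arrows_def
  using assms inv_arr[OF assms(1)] inv_arr[OF assms(2)]
  by (intro exI[of _ "inv_arr C f \<odot> inv_arr C g"])
    (simp add: hom_iff ten_arr interchange ten_idn dom_obj cod_obj)

lemma iso_idn: "X \<in> Obj C \<Longrightarrow> iso_arr C (Idn C X)"
  unfolding iso_arr_def inverse_arrows_def
  by (intro exI[of _ "Idn C X"]) (simp add: hom_iff idn_arr idn_left)

abbreviation Assoc_inv :: "'o \<Rightarrow> 'o \<Rightarrow> 'o \<Rightarrow> 'a" where
  "Assoc_inv X Y Z \<equiv> inv_arr C (Assoc C X Y Z)"

lemma assoc_arr:
  assumes "X \<in> Obj C" "Y \<in> Obj C" "Z \<in> Obj C"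
  shows "Assoc C X Y Z \<in> Arr C" "Dom C (Assoc C X Y Z) = (X \<otimes> Y) \<otimes> Z"
    "Cod C (Assoc C X Y Z) = X \<otimes> Y \<otimes> Z"
  using assoc_hom[OF assms] by (auto simp: hom_iff)

lemma lun_arr:
  assumes "X \<in> Obj C"
  shows "Lun C X \<in> Arr C" "Dom C (Lun C X) = \<I> \<otimes> X" "Cod C (Lun C X) = X"
  using lun_hom[OF assms] by (auto simp: hom_iff)

lemma run_arr:
  assumes "X \<in> Obj C"
  shows "Run C X \<in> Arr C" "Dom C (Run C X) = X \<otimes> \<I>" "Cod C (Run C X) = X"
  using run_hom[OF assms] by (auto simp: hom_iff)

text \<open>Membership in a hom set is split into \<open>Arr\<close>, \<open>Dom\<close> and
  \<open>Cod\<close>, so that typing conditions become computations of domains and codomains.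
  \<open>cmp_simps\<close> adds the laws that nest composites to the right, merge adjacent tensors
  and cancel inverse pairs.\<close>

lemmas arr_simps = hom_iff idn_arr cmp_arr ten_arr inv_arr(1-3) assoc_arr lun_arr run_arr
  assoc_iso lun_iso run_iso iso_ten iso_cmp iso_idn ten_obj unt_obj dom_obj cod_obj

lemmas cmp_simps = arr_simps idn_left idn_right ten_idn assoc_cmp interchange interchange_tail
  inv_arr(4-5) inv_arr_tail

lemma assoc_natural:
  assumes "f \<in> Arr C" "g \<in> Arr C" "h \<in> Arr C" "Cod C f = X" "Cod C g = Y" "Cod C h = Z"
  shows "Assoc C X Y Z \<cdot> ((f \<odot> g) \<odot> h) = (f \<odot> g \<odot> h) \<cdot> Assoc C (Dom C f) (Dom C g) (Dom C h)"
  using assoc_nat[of f "Dom C f" X g "Dom C g" Y h "Dom C h" Z] assms by (auto simp: hom_iff)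

text \<open>The associator cancels on the left; what remains is \<open>assoc_natural\<close>
  composed with an inverse associator.\<close>

lemma assoc_inv_natural:
  assumes "f \<in> Arr C" "g \<in> Arr C" "h \<in> Arr C" "Cod C f = X" "Cod C g = Y" "Cod C h = Z"
  shows "Assoc_inv X Y Z \<cdot> (f \<odot> g \<odot> h) = ((f \<odot> g) \<odot> h) \<cdot> Assoc_inv (Dom C f) (Dom C g) (Dom C h)"
proof (rule iso_cancel_left)
  have XYZ: "X \<in> Obj C" "Y \<in> Obj C" "Z \<in> Obj C" using assms cod_obj by auto
  show "iso_arr C (Assoc C X Y Z)" using XYZ by (rule assoc_iso)
  have "Assoc C X Y Z \<cdot> ((f \<odot> g) \<odot> h) \<cdot> Assoc_inv (Dom C f) (Dom C g) (Dom C h)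
    = (Assoc C X Y Z \<cdot> ((f \<odot> g) \<odot> h)) \<cdot> Assoc_inv (Dom C f) (Dom C g) (Dom C h)"
    using assms XYZ by (simp add: arr_simps assoc_cmp)
  also have "\<dots> = f \<odot> g \<odot> h"
    using assms XYZ by (simp add: assoc_natural) (simp add: cmp_simps)
  finally show "Assoc C X Y Z \<cdot> Assoc_inv X Y Z \<cdot> (f \<odot> g \<odot> h) =
    Assoc C X Y Z \<cdot> ((f \<odot> g) \<odot> h) \<cdot> Assoc_inv (Dom C f) (Dom C g) (Dom C h)"
    using assms XYZ by (simp add: cmp_simps)
qed (use assms cod_obj in \<open>auto simp: arr_simps\<close>)

lemma assoc_inv_natural_tail:
  assumes "f \<in> Arr C" "g \<in> Arr C" "h \<in> Arr C" "Cod C f = X" "Cod C g = Y" "Cod C h = Z"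
    and "k \<in> Arr C" "Cod C k = Dom C f \<otimes> Dom C g \<otimes> Dom C h"
  shows "Assoc_inv X Y Z \<cdot> (f \<odot> g \<odot> h) \<cdot> k
    = ((f \<odot> g) \<odot> h) \<cdot> Assoc_inv (Dom C f) (Dom C g) (Dom C h) \<cdot> k"
proof -
  have XYZ: "X \<in> Obj C" "Y \<in> Obj C" "Z \<in> Obj C" using assms cod_obj by auto
  have "Assoc_inv X Y Z \<cdot> (f \<odot> g \<odot> h) \<cdot> k = (Assoc_inv X Y Z \<cdot> (f \<odot> g \<odot> h)) \<cdot> k"
    using assms XYZ by (simp add: arr_simps assoc_cmp)
  also have "\<dots> = ((f \<odot> g) \<odot> h) \<cdot> Assoc_inv (Dom C f) (Dom C g) (Dom C h) \<cdot> k"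
    unfolding assoc_inv_natural[OF assms(1-6)] using assms XYZ by (simp add: arr_simps assoc_cmp)
  finally show ?thesis .
qed

lemma assoc_natural_tail:
  assumes "f \<in> Arr C" "g \<in> Arr C" "h \<in> Arr C" "Cod C f = X" "Cod C g = Y" "Cod C h = Z"
    and "k \<in> Arr C" "Cod C k = (Dom C f \<otimes> Dom C g) \<otimes> Dom C h"
  shows "Assoc C X Y Z \<cdot> ((f \<odot> g) \<odot> h) \<cdot> k
    = (f \<odot> g \<odot> h) \<cdot> Assoc C (Dom C f) (Dom C g) (Dom C h) \<cdot> k"
proof -
  have XYZ: "X \<in> Obj C" "Y \<in> Obj C" "Z \<in> Obj C" using assms cod_obj by auto
  have "Assoc C X Y Z \<cdot> ((f \<odot> g) \<odot> h) \<cdot> k = (Assoc C X Y Z \<cdot> ((f \<odot> g) \<odot> h)) \<cdot> k"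
    using assms XYZ by (simp add: arr_simps assoc_cmp)
  also have "\<dots> = (f \<odot> g \<odot> h) \<cdot> Assoc C (Dom C f) (Dom C g) (Dom C h) \<cdot> k"
    unfolding assoc_natural[OF assms(1-6)] using assms XYZ by (simp add: arr_simps assoc_cmp)
  finally show ?thesis .
qed

text \<open>Naturality of the left unitor reads
  \<open>f \<cdot> Lun C X = Lun C Y \<cdot> (Idn C \<I> \<odot> f)\<close>, so tensoring with the
  unit object is conjugate to the identity and therefore faithful.\<close>

lemma idn_ten_cancel:
  assumes "f \<in> hom C X Y" "g \<in> hom C X Y" "Idn C \<I> \<odot> f = Idn C \<I> \<odot> g"
  shows "f = g"
proof (rule iso_cancel_right)
  show "iso_arr C (Lun C X)" using assms hom_obj lun_iso by blast
  show "f \<cdot> Lun C X = g \<cdot> Lun C X" using lun_nat assms by metis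
qed (use assms hom_obj in \<open>auto simp: hom_iff lun_arr\<close>)

lemma ten_idn_cancel:
  assumes "f \<in> hom C X Y" "g \<in> hom C X Y" "f \<odot> Idn C \<I> = g \<odot> Idn C \<I>"
  shows "f = g"
proof (rule iso_cancel_right)
  show "iso_arr C (Run C X)" using assms hom_obj run_iso by blast
  show "f \<cdot> Run C X = g \<cdot> Run C X" using run_nat assms by metis
qed (use assms hom_obj in \<open>auto simp: hom_iff run_arr\<close>)

text \<open>Kelly's two consequences of the pentagon and the triangle: each is checked after tensoring
  with the unit object, which is faithful.\<close>

lemma lun_ten:
  assumes X: "X \<in> Obj C" and Y: "Y \<in> Obj C"
  shows "Lun C (X \<otimes> Y) \<cdot> Assoc C \<I> X Y = Lun C X \<odot> Idn C Y"
proof (rule idn_ten_cancel)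
  \<comment> \<open>These are the first two edges on the three-edge side of the pentagon for
    \<open>\<I>\<close>, \<open>\<I>\<close>, \<open>X\<close>, \<open>Y\<close>. Precomposing with
    them lets the pentagon produce the associators to which the triangle applies.\<close>
  let ?e = "Assoc C \<I> (\<I> \<otimes> X) Y \<cdot> (Assoc C \<I> \<I> X \<odot> Idn C Y)"
  show "Idn C \<I> \<odot> (Lun C (X \<otimes> Y) \<cdot> Assoc C \<I> X Y) = Idn C \<I> \<odot> (Lun C X \<odot> Idn C Y)"
  proof (rule iso_cancel_right)
    show "iso_arr C ?e" using X Y by (simp add: arr_simps)
    have "(Idn C \<I> \<odot> (Lun C (X \<otimes> Y) \<cdot> Assoc C \<I> X Y)) \<cdot> ?e
      = (Idn C \<I> \<odot> Lun C (X \<otimes> Y)) \<cdot> (Idn C \<I> \<odot> Assoc C \<I> X Y) \<cdot> ?e"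
      using X Y by (simp add: cmp_simps)
    also have "\<dots> = (Idn C \<I> \<odot> Lun C (X \<otimes> Y)) \<cdot> Assoc C \<I> \<I> (X \<otimes> Y) \<cdot> Assoc C (\<I> \<otimes> \<I>) X Y"
      using X Y by (simp add: pentagon unt_obj)
    also have "\<dots> = ((Idn C \<I> \<odot> Lun C (X \<otimes> Y)) \<cdot> Assoc C \<I> \<I> (X \<otimes> Y)) \<cdot> Assoc C (\<I> \<otimes> \<I>) X Y"
      using X Y by (simp add: arr_simps assoc_cmp)
    also have "\<dots> = (Run C \<I> \<odot> Idn C X \<odot> Idn C Y) \<cdot> Assoc C (\<I> \<otimes> \<I>) X Y"
      using X Y by (simp add: triangle arr_simps ten_idn)
    also have "\<dots> = Assoc C \<I> X Y \<cdot> ((Run C \<I> \<odot> Idn C X) \<odot> Idn C Y)"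
      using X Y by (simp add: assoc_natural arr_simps)
    also have "\<dots> = Assoc C \<I> X Y \<cdot> (((Idn C \<I> \<odot> Lun C X) \<cdot> Assoc C \<I> \<I> X) \<odot> Idn C Y)"
      using X Y by (simp add: triangle arr_simps)
    also have "\<dots> = Assoc C \<I> X Y \<cdot> ((Idn C \<I> \<odot> Lun C X) \<odot> Idn C Y) \<cdot> (Assoc C \<I> \<I> X \<odot> Idn C Y)"
      using X Y by (simp add: cmp_simps)
    also have "\<dots> = (Idn C \<I> \<odot> (Lun C X \<odot> Idn C Y)) \<cdot> ?e"
      using X Y by (simp add: assoc_natural_tail arr_simps)
    finally show "(Idn C \<I> \<odot> (Lun C (X \<otimes> Y) \<cdot> Assoc C \<I> X Y)) \<cdot> ?e
      = (Idn C \<I> \<odot> (Lun C X \<odot> Idn C Y)) \<cdot> ?e" .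
  qed (use X Y in \<open>simp_all add: arr_simps\<close>)
qed (use X Y in \<open>simp_all add: arr_simps\<close>)

lemma run_ten:
  assumes X: "X \<in> Obj C" and Y: "Y \<in> Obj C"
  shows "(Idn C X \<odot> Run C Y) \<cdot> Assoc C X Y \<I> = Run C (X \<otimes> Y)"
proof (rule ten_idn_cancel)
  show "((Idn C X \<odot> Run C Y) \<cdot> Assoc C X Y \<I>) \<odot> Idn C \<I> = Run C (X \<otimes> Y) \<odot> Idn C \<I>"
  proof (rule iso_cancel_left)
    \<comment> \<open>Postcomposing with this associator brings in the pentagon for
      \<open>X\<close>, \<open>Y\<close>, \<open>\<I>\<close>, \<open>\<I>\<close>; the triangle at
      \<open>Y\<close> opens the computation and the triangle at \<open>X \<otimes> Y\<close> closes
      it.\<close>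
    show "iso_arr C (Assoc C X Y \<I>)" using X Y by (simp add: arr_simps)
    have "Assoc C X Y \<I> \<cdot> (((Idn C X \<odot> Run C Y) \<cdot> Assoc C X Y \<I>) \<odot> Idn C \<I>)
      = Assoc C X Y \<I> \<cdot> ((Idn C X \<odot> Run C Y) \<odot> Idn C \<I>) \<cdot> (Assoc C X Y \<I> \<odot> Idn C \<I>)"
      using X Y by (simp add: cmp_simps)
    also have "\<dots> = (Idn C X \<odot> (Run C Y \<odot> Idn C \<I>)) \<cdot> Assoc C X (Y \<otimes> \<I>) \<I> \<cdot> (Assoc C X Y \<I> \<odot> Idn C \<I>)"
      using X Y by (simp add: assoc_natural_tail arr_simps)
    also have "\<dots> = (Idn C X \<odot> ((Idn C Y \<odot> Lun C \<I>) \<cdot> Assoc C Y \<I> \<I>)) \<cdot> Assoc C X (Y \<otimes> \<I>) \<I> \<cdot> (Assoc C X Y \<I> \<odot> Idn C \<I>)"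
      using X Y by (simp add: triangle arr_simps)
    also have "\<dots> = (Idn C X \<odot> Idn C Y \<odot> Lun C \<I>) \<cdot> (Idn C X \<odot> Assoc C Y \<I> \<I>) \<cdot> Assoc C X (Y \<otimes> \<I>) \<I> \<cdot> (Assoc C X Y \<I> \<odot> Idn C \<I>)"
      using X Y by (simp add: cmp_simps)
    also have "\<dots> = (Idn C X \<odot> Idn C Y \<odot> Lun C \<I>) \<cdot> Assoc C X Y (\<I> \<otimes> \<I>) \<cdot> Assoc C (X \<otimes> Y) \<I> \<I>"
      using X Y by (simp add: pentagon unt_obj)
    also have "\<dots> = Assoc C X Y \<I> \<cdot> ((Idn C X \<odot> Idn C Y) \<odot> Lun C \<I>) \<cdot> Assoc C (X \<otimes> Y) \<I> \<I>"
      using X Y by (simp add: assoc_natural_tail arr_simps)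
    also have "\<dots> = Assoc C X Y \<I> \<cdot> (Run C (X \<otimes> Y) \<odot> Idn C \<I>)"
      using X Y by (simp add: triangle arr_simps ten_idn)
    finally show "Assoc C X Y \<I> \<cdot> (((Idn C X \<odot> Run C Y) \<cdot> Assoc C X Y \<I>) \<odot> Idn C \<I>)
      = Assoc C X Y \<I> \<cdot> (Run C (X \<otimes> Y) \<odot> Idn C \<I>)" .
  qed (use X Y in \<open>simp_all add: arr_simps\<close>)
qed (use X Y in \<open>simp_all add: arr_simps\<close>)

end

subsection \<open>Convolution and natural pairings\<close>

lemma eqcl_eqI:
  assumes "(a, b) \<in> R"
  shows "eqcl R a = eqcl R b"
proof -
  let ?S = "(R \<union> R\<inverse>)\<^sup>*"
  have "(a, b) \<in> ?S" "(b, a) \<in> ?S" using assms by auto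
  then show ?thesis unfolding eqcl_def by (auto intro: rtrancl_trans)
qed

text \<open>Agreement on generating pairs propagates along zigzags, so the image of a class is a
  singleton and \<open>the_elem\<close> returns its member. Evaluations of \<open>induced\<close>
  maps on convolutions and on balanced tensor products all rest on this.\<close>

lemma induced_eqcl:
  assumes "\<And>a b. (a, b) \<in> R \<Longrightarrow> \<phi> a = \<phi> b"
  shows "induced \<phi> (eqcl R t) = \<phi> t"
proof -
  have "\<phi> u = \<phi> t" if "(t, u) \<in> (R \<union> R\<inverse>)\<^sup>*" for u
    using that
  proof (induction rule: rtrancl_induct)
    case (step u v)
    from step.hyps(2) consider "(u, v) \<in> R" | "(v, u) \<in> R" by blast
    then have "\<phi> u = \<phi> v" by cases (blast dest: assms intro: sym)+
    then show ?case using step.IH by metis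
  qed simp
  then have "\<phi> ` eqcl R t = {\<phi> t}" unfolding eqcl_def by (intro image_eqI set_eqI iffI; blast)
  then show ?thesis by (simp add: induced_def)
qed

context monoidal_category
begin

section \<open>Functors and the elementary tensors of a convolution\<close>

lemma fun_typ:
  "is_functor F \<Longrightarrow> f \<in> Arr C \<Longrightarrow> Cod C f = Y \<Longrightarrow> x \<in> FO F (Dom C f) \<Longrightarrow> FA F f x \<in> FO F Y"
  by (auto simp: is_functor_def hom_iff)

lemma fun_idn: "is_functor F \<Longrightarrow> X \<in> Obj C \<Longrightarrow> x \<in> FO F X \<Longrightarrow> FA F (Idn C X) x = x"
  by (auto simp: is_functor_def)

lemma fun_cmp:
  "is_functor F \<Longrightarrow> f \<in> Arr C \<Longrightarrow> g \<in> Arr C \<Longrightarrow> Cod C f = Dom C g \<Longrightarrow> x \<in> FO F (Dom C f)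
    \<Longrightarrow> FA F g (FA F f x) = FA F (g \<cdot> f) x"
  by (auto simp: is_functor_def hom_iff)

lemmas fun_simps = fun_typ fun_idn fun_cmp

lemma nat_typ: "nat_trans F G \<sigma> \<Longrightarrow> X \<in> Obj C \<Longrightarrow> x \<in> FO F X \<Longrightarrow> \<sigma> X x \<in> FO G X"
  by (auto simp: nat_trans_def)

lemma nat_FA:
  "nat_trans F G \<sigma> \<Longrightarrow> f \<in> Arr C \<Longrightarrow> Cod C f = Y \<Longrightarrow> x \<in> FO F (Dom C f)
    \<Longrightarrow> \<sigma> Y (FA F f x) = FA G f (\<sigma> (Dom C f) x)"
  by (auto simp: nat_trans_def hom_iff)

lemma nat_trans_idt: "is_functor F \<Longrightarrow> nat_trans F F idt"
  by (auto simp: nat_trans_def idt_def hom_iff)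

lemma induced_conv:
  assumes "\<And>X X' Y Y' g h f m n. g \<in> hom C X X' \<Longrightarrow> h \<in> hom C Y Y' \<Longrightarrow> f \<in> hom C (X' \<otimes> Y') U
      \<Longrightarrow> m \<in> FO M X \<Longrightarrow> n \<in> FO N Y
      \<Longrightarrow> \<phi> (X, Y, f \<cdot> (g \<odot> h), m, n) = \<phi> (X', Y', f, FA M g m, FA N h n)"
  shows "induced \<phi> (conv_cl M N U t) = \<phi> t"
  unfolding conv_cl_def by (rule induced_eqcl) (use assms in \<open>auto simp: conv_rel_def\<close>)

lemma conv_cl_slide:
  assumes "g \<in> hom C X X'" "h \<in> hom C Y Y'" "f \<in> hom C (X' \<otimes> Y') U" "m \<in> FO M X" "n \<in> FO N Y"
  shows "conv_cl M N U (X, Y, f \<cdot> (g \<odot> h), m, n) = conv_cl M N U (X', Y', f, FA M g m, FA N h n)"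
  unfolding conv_cl_def by (rule eqcl_eqI) (use assms in \<open>auto simp: conv_rel_def\<close>)

text \<open>The elementary tensor of \<open>m\<close> and \<open>n\<close>, that is, the universal
  natural pairing into the convolution. The class of a general quintuple
  \<open>(X, Y, f, m, n)\<close> is its transport along \<open>f\<close>, as
  \<open>conv_cl_cpr\<close> shows.\<close>

definition cpr ::
  "('o, 'a, 'x) set_functor \<Rightarrow> ('o, 'a, 'y) set_functor \<Rightarrow> 'o \<Rightarrow> 'o \<Rightarrow> 'x \<Rightarrow> 'y
     \<Rightarrow> ('o, 'a, 'x, 'y) conv_elem" where
  "cpr M N X Y m n = conv_cl M N (X \<otimes> Y) (X, Y, Idn C (X \<otimes> Y), m, n)"

lemma conv_FA_cl:
  assumes "k \<in> hom C U V" "f \<in> hom C (X \<otimes> Y) U"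
  shows "FA (M \<star> N) k (conv_cl M N U (X, Y, f, m, n)) = conv_cl M N V (X, Y, k \<cdot> f, m, n)"
proof -
  have "induced (\<lambda>(X, Y, f, m, n). conv_cl M N V (X, Y, k \<cdot> f, m, n)) (conv_cl M N U (X, Y, f, m, n))
    = (\<lambda>(X, Y, f, m, n). conv_cl M N V (X, Y, k \<cdot> f, m, n)) (X, Y, f, m, n)"
  proof (rule induced_conv, clarify)
    fix X X' Y Y' g h f m n
    assume a: "g \<in> hom C X X'" "h \<in> hom C Y Y'" "f \<in> hom C (X' \<otimes> Y') U" "m \<in> FO M X" "n \<in> FO N Y"
    have "k \<cdot> f \<in> hom C (X' \<otimes> Y') V" using a assms cmp_hom by blast
    from conv_cl_slide[OF a(1,2) this a(4,5)] a assms
    show "conv_cl M N V (X, Y, k \<cdot> f \<cdot> (g \<odot> h), m, n) = conv_cl M N V (X', Y', k \<cdot> f, FA M g m, FA N h n)"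
      by (simp add: cmp_simps)
  qed
  then show ?thesis using assms by (simp add: conv_def hom_iff)
qed

lemma conv_cl_cpr:
  assumes "f \<in> hom C (X \<otimes> Y) U" "X \<in> Obj C" "Y \<in> Obj C"
  shows "conv_cl M N U (X, Y, f, m, n) = FA (M \<star> N) f (cpr M N X Y m n)"
  using assms conv_FA_cl[OF assms(1), of "Idn C (X \<otimes> Y)" X Y M N m n]
  by (simp add: cpr_def cmp_simps)

text \<open>The normal form of elements of a convolution: since the coend of sets is a quotient of a
  coproduct, one transported elementary tensor represents each element. It makes checks on classes
  into checks on elementary tensors.\<close>

lemma conv_FO_iff:
  "z \<in> FO (M \<star> N) U \<longleftrightarrow> (\<exists>X Y f m n. X \<in> Obj C \<and> Y \<in> Obj C \<and> f \<in> hom C (X \<otimes> Y) U \<and>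
     m \<in> FO M X \<and> n \<in> FO N Y \<and> z = FA (M \<star> N) f (cpr M N X Y m n))"
proof -
  have "FO (M \<star> N) U = conv_cl M N U ` conv_pre M N U"
    by (simp add: conv_def quot_def conv_cl_def cong: image_cong)
  then have "z \<in> FO (M \<star> N) U \<longleftrightarrow> (\<exists>t \<in> conv_pre M N U. z = conv_cl M N U t)"
    by (simp add: image_iff)
  also have "\<dots> \<longleftrightarrow> (\<exists>X Y f m n. (X, Y, f, m, n) \<in> conv_pre M N U \<and> z = conv_cl M N U (X, Y, f, m, n))"
    by (simp add: Bex_def split_paired_Ex)
  also have "\<dots> \<longleftrightarrow> (\<exists>X Y f m n. X \<in> Obj C \<and> Y \<in> Obj C \<and> f \<in> hom C (X \<otimes> Y) U \<and>
     m \<in> FO M X \<and> n \<in> FO N Y \<and> z = conv_cl M N U (X, Y, f, m, n))"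
    by (simp only: conv_pre_def mem_Collect_eq prod.inject ex_simps simp_thms conj_assoc)
  finally show ?thesis by (simp add: conv_cl_cpr cong: conj_cong)
qed

lemma conv_FO_cases:
  assumes "z \<in> FO (M \<star> N) U"
  obtains X Y f m n where "X \<in> Obj C" "Y \<in> Obj C" "f \<in> hom C (X \<otimes> Y) U" "m \<in> FO M X" "n \<in> FO N Y"
    "z = FA (M \<star> N) f (cpr M N X Y m n)"
  using assms by (auto simp: conv_FO_iff)

lemma FA_cpr_typ:
  "X \<in> Obj C \<Longrightarrow> Y \<in> Obj C \<Longrightarrow> f \<in> hom C (X \<otimes> Y) U \<Longrightarrow> m \<in> FO M X \<Longrightarrow> n \<in> FO N Y
    \<Longrightarrow> FA (M \<star> N) f (cpr M N X Y m n) \<in> FO (M \<star> N) U"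
  unfolding conv_FO_iff by blast

lemma conv_FA_cpr:
  assumes "f \<in> hom C (X \<otimes> Y) U" "k \<in> hom C U V" "X \<in> Obj C" "Y \<in> Obj C"
  shows "FA (M \<star> N) k (FA (M \<star> N) f (cpr M N X Y m n)) = FA (M \<star> N) (k \<cdot> f) (cpr M N X Y m n)"
  using conv_FA_cl[OF assms(2,1), of M N m n] conv_cl_cpr[OF assms(1,3,4), of M N m n]
    conv_cl_cpr[OF cmp_hom[OF assms(1,2)] assms(3,4), of M N m n] by simp

lemma conv_functor: "is_functor (M \<star> N)"
  unfolding is_functor_def
proof (intro conjI allI ballI)
  fix X Y f z assume "f \<in> hom C X Y" "z \<in> FO (M \<star> N) X"
  then show "FA (M \<star> N) f z \<in> FO (M \<star> N) Y"
    by (auto elim!: conv_FO_cases simp: conv_FA_cpr FA_cpr_typ cmp_hom)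
next
  fix X z assume "X \<in> Obj C" "z \<in> FO (M \<star> N) X"
  then show "FA (M \<star> N) (Idn C X) z = z"
    by (auto elim!: conv_FO_cases simp: conv_FA_cpr[OF _ idn_hom] cmp_idn_left)
next
  fix X Y Z f g z assume fg: "f \<in> hom C X Y" "g \<in> hom C Y Z" and "z \<in> FO (M \<star> N) X"
  from this(3) show "FA (M \<star> N) (g \<cdot> f) z = FA (M \<star> N) g (FA (M \<star> N) f z)"
  proof (cases rule: conv_FO_cases)
    case (1 V W h m n)
    then show ?thesis using fg
      by (simp add: conv_FA_cpr[OF 1(3) fg(1)] conv_FA_cpr[OF 1(3) cmp_hom[OF fg]]
          conv_FA_cpr[OF cmp_hom[OF 1(3) fg(1)] fg(2)] cmp_assoc[OF 1(3) fg])
  qed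
qed

section \<open>Natural pairings and maps out of a convolution\<close>

definition is_pairing ::
  "('o, 'a, 'x) set_functor \<Rightarrow> ('o, 'a, 'y) set_functor \<Rightarrow> ('o, 'a, 'z) set_functor
     \<Rightarrow> ('o \<Rightarrow> 'o \<Rightarrow> 'x \<Rightarrow> 'y \<Rightarrow> 'z) \<Rightarrow> bool" where
  "is_pairing F G H p \<longleftrightarrow>
     (\<forall>X \<in> Obj C. \<forall>Y \<in> Obj C. \<forall>x \<in> FO F X. \<forall>y \<in> FO G Y. p X Y x y \<in> FO H (X \<otimes> Y)) \<and>
     (\<forall>X X' Y Y'. \<forall>g \<in> hom C X X'. \<forall>h \<in> hom C Y Y'. \<forall>x \<in> FO F X. \<forall>y \<in> FO G Y.
        p X' Y' (FA F g x) (FA G h y) = FA H (g \<odot> h) (p X Y x y))"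

lemma pairing_typ:
  "is_pairing F G H p \<Longrightarrow> X \<in> Obj C \<Longrightarrow> Y \<in> Obj C \<Longrightarrow> x \<in> FO F X \<Longrightarrow> y \<in> FO G Y
    \<Longrightarrow> p X Y x y \<in> FO H (X \<otimes> Y)"
  by (auto simp: is_pairing_def)

lemma pairing_FA:
  "is_pairing F G H p \<Longrightarrow> g \<in> Arr C \<Longrightarrow> h \<in> Arr C \<Longrightarrow> Cod C g = X' \<Longrightarrow> Cod C h = Y'
    \<Longrightarrow> x \<in> FO F (Dom C g) \<Longrightarrow> y \<in> FO G (Dom C h)
    \<Longrightarrow> p X' Y' (FA F g x) (FA G h y) = FA H (g \<odot> h) (p (Dom C g) (Dom C h) x y)"
  by (auto simp: is_pairing_def hom_iff)

lemma pairing_FA_left: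
  "is_pairing F G H p \<Longrightarrow> is_functor G \<Longrightarrow> g \<in> Arr C \<Longrightarrow> Y \<in> Obj C \<Longrightarrow> Cod C g = X'
    \<Longrightarrow> x \<in> FO F (Dom C g) \<Longrightarrow> y \<in> FO G Y
    \<Longrightarrow> p X' Y (FA F g x) y = FA H (g \<odot> Idn C Y) (p (Dom C g) Y x y)"
  using pairing_FA[of F G H p g "Idn C Y" X' Y x y] by (simp add: idn_arr fun_idn)

lemma pairing_FA_right:
  "is_pairing F G H p \<Longrightarrow> is_functor F \<Longrightarrow> h \<in> Arr C \<Longrightarrow> X \<in> Obj C \<Longrightarrow> Cod C h = Y'
    \<Longrightarrow> x \<in> FO F X \<Longrightarrow> y \<in> FO G (Dom C h)
    \<Longrightarrow> p X Y' x (FA G h y) = FA H (Idn C X \<odot> h) (p X (Dom C h) x y)"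
  using pairing_FA[of F G H p "Idn C X" h X Y' x y] by (simp add: idn_arr fun_idn)

lemmas pairing_simps = pairing_typ pairing_FA pairing_FA_left pairing_FA_right

lemma is_pairing_cpr: "is_pairing M N (M \<star> N) (cpr M N)"
  unfolding is_pairing_def
proof (intro conjI allI ballI)
  fix X Y x y assume a: "X \<in> Obj C" "Y \<in> Obj C" "x \<in> FO M X" "y \<in> FO N Y"
  have "cpr M N X Y x y = FA (M \<star> N) (Idn C (X \<otimes> Y)) (cpr M N X Y x y)"
    using a conv_cl_cpr[of "Idn C (X \<otimes> Y)" X Y "X \<otimes> Y" M N x y] by (simp add: cpr_def arr_simps)
  then show "cpr M N X Y x y \<in> FO (M \<star> N) (X \<otimes> Y)"
    unfolding conv_FO_iff using a idn_hom ten_obj by blast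
next
  fix X X' Y Y' g h x y
  assume a: "g \<in> hom C X X'" "h \<in> hom C Y Y'" "x \<in> FO M X" "y \<in> FO N Y"
  then have o: "X \<in> Obj C" "X' \<in> Obj C" "Y \<in> Obj C" "Y' \<in> Obj C" using hom_obj by auto
  have "cpr M N X' Y' (FA M g x) (FA N h y) = conv_cl M N (X' \<otimes> Y') (X, Y, Idn C (X' \<otimes> Y') \<cdot> (g \<odot> h), x, y)"
    unfolding cpr_def by (rule conv_cl_slide[symmetric]) (use a o in \<open>simp_all add: arr_simps\<close>)
  also have "\<dots> = FA (M \<star> N) (g \<odot> h) (cpr M N X Y x y)"
    using a o by (subst conv_cl_cpr) (simp_all add: cmp_simps)
  finally show "cpr M N X' Y' (FA M g x) (FA N h y) = FA (M \<star> N) (g \<odot> h) (cpr M N X Y x y)" .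
qed

lemmas cpr_simps = pairing_simps[OF is_pairing_cpr]

text \<open>Invariance under the coend relation is naturality of \<open>p\<close> together with
  functoriality of \<open>H\<close>: both related quintuples are sent to
  \<open>FA H (f \<cdot> (g \<odot> h)) (p X Y m n)\<close>.\<close>

lemma induced_conv_pairing:
  assumes \<phi>: "\<And>X Y f m n. X \<in> Obj C \<Longrightarrow> Y \<in> Obj C \<Longrightarrow> f \<in> hom C (X \<otimes> Y) U \<Longrightarrow> m \<in> FO M X
      \<Longrightarrow> n \<in> FO N Y \<Longrightarrow> \<phi> (X, Y, f, m, n) = FA H f (p X Y m n)"
    and p: "is_pairing M N H p" and F: "is_functor M" "is_functor N" "is_functor H"
    and a: "X \<in> Obj C" "Y \<in> Obj C" "f \<in> hom C (X \<otimes> Y) U" "m \<in> FO M X" "n \<in> FO N Y"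
  shows "induced \<phi> (FA (M \<star> N) f (cpr M N X Y m n)) = FA H f (p X Y m n)"
proof -
  have "induced \<phi> (conv_cl M N U (X, Y, f, m, n)) = \<phi> (X, Y, f, m, n)"
  proof (rule induced_conv)
    fix X X' Y Y' g h f m n
    assume b: "g \<in> hom C X X'" "h \<in> hom C Y Y'" "f \<in> hom C (X' \<otimes> Y') U" "m \<in> FO M X" "n \<in> FO N Y"
    then have o: "X \<in> Obj C" "X' \<in> Obj C" "Y \<in> Obj C" "Y' \<in> Obj C" using hom_obj by auto
    show "\<phi> (X, Y, f \<cdot> (g \<odot> h), m, n) = \<phi> (X', Y', f, FA M g m, FA N h n)"
      using b o F by (simp add: \<phi> cmp_simps fun_simps pairing_simps[OF p])
  qed
  then show ?thesis using a \<phi> conv_cl_cpr by metis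
qed

definition pairing ::
  "('o, 'a, 'x) set_functor \<Rightarrow> ('o, 'a, 'y) set_functor
     \<Rightarrow> ('o \<Rightarrow> ('o, 'a, 'x, 'y) conv_elem \<Rightarrow> 'z) \<Rightarrow> 'o \<Rightarrow> 'o \<Rightarrow> 'x \<Rightarrow> 'y \<Rightarrow> 'z" where
  "pairing F G \<sigma> X Y x y = \<sigma> (X \<otimes> Y) (cpr F G X Y x y)"

lemma is_pairing_pairing:
  "nat_trans (F \<star> G) H \<sigma> \<Longrightarrow> is_pairing F G H (pairing F G \<sigma>)"
  unfolding is_pairing_def
  by (intro conjI allI ballI)
    (auto simp: pairing_def nat_typ ten_obj cpr_simps hom_iff nat_FA ten_arr dom_obj)

lemma nat_trans_conv:
  "nat_trans (F \<star> G) H \<sigma> \<Longrightarrow> X \<in> Obj C \<Longrightarrow> Y \<in> Obj C \<Longrightarrow> f \<in> hom C (X \<otimes> Y) U \<Longrightarrow> x \<in> FO F X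
    \<Longrightarrow> y \<in> FO G Y \<Longrightarrow> \<sigma> U (FA (F \<star> G) f (cpr F G X Y x y)) = FA H f (pairing F G \<sigma> X Y x y)"
  by (auto simp: pairing_def nat_FA hom_iff cpr_simps)

text \<open>Every element is a transported elementary tensor, so naturality of
  \<open>\<sigma>\<close> reduces to functoriality of \<open>H\<close>. As \<open>\<sigma>\<close>
  is already a function on classes, the compatibility of \<open>p\<close> with slides is contained
  in the equation, and \<open>p\<close> is only asked to take values in \<open>H\<close>.\<close>

lemma nat_trans_convI:
  assumes \<sigma>: "\<And>U X Y f m n. X \<in> Obj C \<Longrightarrow> Y \<in> Obj C \<Longrightarrow> f \<in> hom C (X \<otimes> Y) U \<Longrightarrow> m \<in> FO M X
      \<Longrightarrow> n \<in> FO N Y \<Longrightarrow> \<sigma> U (FA (M \<star> N) f (cpr M N X Y m n)) = FA H f (p X Y m n)"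
    and p: "\<And>X Y m n. X \<in> Obj C \<Longrightarrow> Y \<in> Obj C \<Longrightarrow> m \<in> FO M X \<Longrightarrow> n \<in> FO N Y
      \<Longrightarrow> p X Y m n \<in> FO H (X \<otimes> Y)"
    and H: "is_functor H"
  shows "nat_trans (M \<star> N) H \<sigma>"
  unfolding nat_trans_def
proof (intro conjI allI ballI)
  fix X z assume "X \<in> Obj C" "z \<in> FO (M \<star> N) X"
  then show "\<sigma> X z \<in> FO H X"
    by (auto elim!: conv_FO_cases simp: \<sigma> p H fun_simps hom_iff)
next
  fix U V k z assume k: "k \<in> hom C U V" and "z \<in> FO (M \<star> N) U"
  from this(2) show "\<sigma> V (FA (M \<star> N) k z) = FA H k (\<sigma> U z)"
  proof (cases rule: conv_FO_cases)
    case (1 X Y f m n)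
    then show ?thesis using k
      by (simp add: conv_FA_cpr[OF 1(3) k] \<sigma>[OF _ _ cmp_hom[OF 1(3) k]] \<sigma>)
        (simp add: fun_simps H p hom_iff)
  qed
qed

lemma pairing_eq:
  assumes "X \<in> Obj C" "Y \<in> Obj C" "m \<in> FO M X" "n \<in> FO N Y"
    and "\<And>U f. f \<in> hom C (X \<otimes> Y) U \<Longrightarrow> \<sigma> U (FA (M \<star> N) f (cpr M N X Y m n)) = FA H f v"
    and "is_functor H" "v \<in> FO H (X \<otimes> Y)"
  shows "pairing M N \<sigma> X Y m n = v"
  using assms(1-4,6,7) assms(5)[of "Idn C (X \<otimes> Y)" "X \<otimes> Y"]
  by (simp add: pairing_def fun_idn[OF conv_functor] cpr_simps arr_simps fun_idn)

lemma conv_map_cpr: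
  assumes \<sigma>: "nat_trans M M' \<sigma>" and \<tau>: "nat_trans N N' \<tau>"
    and F: "is_functor M" "is_functor N"
    and a: "X \<in> Obj C" "Y \<in> Obj C" "f \<in> hom C (X \<otimes> Y) U" "m \<in> FO M X" "n \<in> FO N Y"
  shows "conv_map M' N' \<sigma> \<tau> U (FA (M \<star> N) f (cpr M N X Y m n))
    = FA (M' \<star> N') f (cpr M' N' X Y (\<sigma> X m) (\<tau> Y n))"
  unfolding conv_map_def
proof (rule induced_conv_pairing[OF _ _ F conv_functor a])
  show "is_pairing M N (M' \<star> N') (\<lambda>X Y m n. cpr M' N' X Y (\<sigma> X m) (\<tau> Y n))"
    unfolding is_pairing_def
    by (intro conjI allI ballI)
      (auto simp: cpr_simps hom_iff nat_FA[OF \<sigma>] nat_FA[OF \<tau>] nat_typ[OF \<sigma>] nat_typ[OF \<tau>] dom_obj)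
qed (simp add: conv_cl_cpr)

lemma conv_map_nat_trans:
  assumes "nat_trans M M' \<sigma>" "nat_trans N N' \<tau>" "is_functor M" "is_functor N"
  shows "nat_trans (M \<star> N) (M' \<star> N') (conv_map M' N' \<sigma> \<tau>)"
  by (rule nat_trans_convI[where p = "\<lambda>X Y m n. cpr M' N' X Y (\<sigma> X m) (\<tau> Y n)"])
    (use assms in \<open>simp_all add: conv_map_cpr[OF assms] cpr_simps nat_typ conv_functor\<close>)

section \<open>Associativity constraints on elementary tensors\<close>

lemma conv_assoc_FA:
  fixes M :: "('o, 'a, 'x) set_functor" and N :: "('o, 'a, 'y) set_functor"
    and P :: "('o, 'a, 'z) set_functor"
  assumes F: "is_functor M" "is_functor N" "is_functor P"
    and a: "X \<in> Obj C" "Y \<in> Obj C" "g \<in> hom C (X \<otimes> Y) W" "m \<in> FO M X" "n \<in> FO N Y"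
    and b: "Z \<in> Obj C" "f \<in> hom C (W \<otimes> Z) U" "p \<in> FO P Z"
  shows "conv_assoc M N P U
      (FA ((M \<star> N) \<star> P) f (cpr (M \<star> N) P W Z (FA (M \<star> N) g (cpr M N X Y m n)) p))
    = FA (M \<star> (N \<star> P)) (f \<cdot> (g \<odot> Idn C Z) \<cdot> Assoc_inv X Y Z)
        (cpr M (N \<star> P) X (Y \<otimes> Z) m (cpr N P Y Z n p))"
proof -
  define \<psi> where "\<psi> = (\<lambda>Z f (p :: 'z) (X, Y, g, m :: 'x, n :: 'y).
    conv_cl M (N \<star> P) U (X, Y \<otimes> Z, f \<cdot> (g \<odot> Idn C Z) \<cdot> Assoc_inv X Y Z, m,
            conv_cl N P (Y \<otimes> Z) (Y, Z, Idn C (Y \<otimes> Z), n, p)))"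
  have \<psi>: "\<psi> Z f p (X, Y, g, m, n) = FA (M \<star> (N \<star> P)) (f \<cdot> (g \<odot> Idn C Z) \<cdot> Assoc_inv X Y Z)
        (cpr M (N \<star> P) X (Y \<otimes> Z) m (cpr N P Y Z n p))"
    if "X \<in> Obj C" "Y \<in> Obj C" "Z \<in> Obj C" "g \<in> hom C (X \<otimes> Y) W" "f \<in> hom C (W \<otimes> Z) U"
    for X Y Z W f g m n p
    using that unfolding \<psi>_def by (simp add: conv_cl_cpr arr_simps flip: cpr_def)
  \<comment> \<open>The constraint is a nested \<open>induced\<close>, hence two invariance proofs:
    here for the inner class with the outer data fixed, then for the outer class through
    \<open>\<chi>\<close>. Each comes down to naturality of the inverse associator. An outer slide
    along \<open>u\<close> changes the inner arrow \<open>g\<close> into \<open>u \<cdot> g\<close>,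
    so \<open>g\<close> has to stay general.\<close>
  have inner: "induced (\<psi> Z f p) (FA (M \<star> N) g (cpr M N X Y m n)) = \<psi> Z f p (X, Y, g, m, n)"
    if c: "X \<in> Obj C" "Y \<in> Obj C" "g \<in> hom C (X \<otimes> Y) W" "m \<in> FO M X" "n \<in> FO N Y"
    "Z \<in> Obj C" "f \<in> hom C (W \<otimes> Z) U" "p \<in> FO P Z" for X Y Z W f g m n p
    unfolding conv_cl_cpr[OF c(3,1,2), symmetric]
  proof (rule induced_conv)
    fix X X' Y Y' u v g m n
    assume d: "u \<in> hom C X X'" "v \<in> hom C Y Y'" "g \<in> hom C (X' \<otimes> Y') W" "m \<in> FO M X" "n \<in> FO N Y"
    then have o: "X \<in> Obj C" "X' \<in> Obj C" "Y \<in> Obj C" "Y' \<in> Obj C" using hom_obj by auto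
    have e: "g \<cdot> (u \<odot> v) \<in> hom C (X \<otimes> Y) W" using d by (simp add: arr_simps)
    show "\<psi> Z f p (X, Y, g \<cdot> (u \<odot> v), m, n) = \<psi> Z f p (X', Y', g, FA M u m, FA N v n)"
      unfolding \<psi>[OF o(1,3) c(6) e c(7)] \<psi>[OF o(2,4) c(6) d(3) c(7)]
      using c(4-) d o F
      by (simp add: cpr_simps conv_functor fun_simps cmp_simps assoc_inv_natural)
  qed
  define \<chi> where "\<chi> = (\<lambda>(W :: 'o, Z, f, c, p). induced (\<psi> Z f p) c)"
  have "conv_assoc M N P U (conv_cl (M \<star> N) P U (W, Z, f, FA (M \<star> N) g (cpr M N X Y m n), p))
    = induced \<chi> (conv_cl (M \<star> N) P U (W, Z, f, FA (M \<star> N) g (cpr M N X Y m n), p))"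
    unfolding conv_assoc_def \<chi>_def \<psi>_def ..
  also have "\<dots> = \<chi> (W, Z, f, FA (M \<star> N) g (cpr M N X Y m n), p)"
  proof (rule induced_conv)
    fix W W' Z Z' u v f c p
    assume d: "u \<in> hom C W W'" "v \<in> hom C Z Z'" "f \<in> hom C (W' \<otimes> Z') U" "c \<in> FO (M \<star> N) W" "p \<in> FO P Z"
    then have o: "W \<in> Obj C" "W' \<in> Obj C" "Z \<in> Obj C" "Z' \<in> Obj C" using hom_obj by auto
    from d(4) obtain X Y g m n where e: "X \<in> Obj C" "Y \<in> Obj C" "g \<in> hom C (X \<otimes> Y) W" "m \<in> FO M X" "n \<in> FO N Y"
      and c: "c = FA (M \<star> N) g (cpr M N X Y m n)" by (rule conv_FO_cases)
    have f: "f \<cdot> (u \<odot> v) \<in> hom C (W \<otimes> Z) U" using d by (simp add: arr_simps)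
    have ug: "u \<cdot> g \<in> hom C (X \<otimes> Y) W'" using d e cmp_hom by blast
    have vp: "FA P v p \<in> FO P Z'" using d F by (simp add: fun_simps hom_iff)
    have "\<chi> (W, Z, f \<cdot> (u \<odot> v), c, p) = \<psi> Z (f \<cdot> (u \<odot> v)) p (X, Y, g, m, n)"
      unfolding \<chi>_def c using inner[OF e o(3) f d(5)] by simp
    also have "\<dots> = \<psi> Z' f (FA P v p) (X, Y, u \<cdot> g, m, n)"
      unfolding \<psi>[OF e(1,2) o(3) e(3) f] \<psi>[OF e(1,2) o(4) ug d(3)]
      using d e o F by (simp add: cpr_simps conv_functor fun_simps cmp_simps assoc_inv_natural)
    also have "\<dots> = \<chi> (W', Z', f, FA (M \<star> N) u c, FA P v p)"
      unfolding \<chi>_def c using inner[OF e(1,2) ug e(4,5) o(4) d(3) vp] conv_FA_cpr[OF e(3) d(1) e(1,2), of M N m n]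
      by simp
    finally show "\<chi> (W, Z, f \<cdot> (u \<odot> v), c, p) = \<chi> (W', Z', f, FA (M \<star> N) u c, FA P v p)" .
  qed
  also have "\<dots> = \<psi> Z f p (X, Y, g, m, n)" unfolding \<chi>_def using inner[OF a b] by simp
  finally show ?thesis
    using \<psi>[OF a(1,2) b(1) a(3) b(2)] conv_cl_cpr[OF b(2) _ b(1)] a(3) hom_obj by metis
qed

text \<open>The inner arrow \<open>g\<close> slides outward and is absorbed as
  \<open>g \<odot> Idn C Z\<close>, so that a threefold convolution also has a normal form with a
  single arrow.\<close>

lemma conv_conv_cases:
  assumes "z \<in> FO ((M \<star> N) \<star> P) U" "is_functor P"
  obtains X Y Z f m n p where "X \<in> Obj C" "Y \<in> Obj C" "Z \<in> Obj C" "f \<in> hom C ((X \<otimes> Y) \<otimes> Z) U"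
    "m \<in> FO M X" "n \<in> FO N Y" "p \<in> FO P Z"
    "z = FA ((M \<star> N) \<star> P) f (cpr (M \<star> N) P (X \<otimes> Y) Z (cpr M N X Y m n) p)"
proof -
  from assms(1) obtain W Z f c p where 1: "W \<in> Obj C" "Z \<in> Obj C" "f \<in> hom C (W \<otimes> Z) U"
    "c \<in> FO (M \<star> N) W" "p \<in> FO P Z" "z = FA ((M \<star> N) \<star> P) f (cpr (M \<star> N) P W Z c p)"
    by (rule conv_FO_cases)
  from 1(4) obtain X Y g m n where 2: "X \<in> Obj C" "Y \<in> Obj C" "g \<in> hom C (X \<otimes> Y) W" "m \<in> FO M X"
    "n \<in> FO N Y" "c = FA (M \<star> N) g (cpr M N X Y m n)"
    by (rule conv_FO_cases)
  show ?thesis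
    by (rule that[of X Y Z "f \<cdot> (g \<odot> Idn C Z)" m n p])
      (use 1 2 assms(2) in \<open>simp_all add: arr_simps cpr_simps fun_simps conv_functor\<close>)
qed

lemma conv_assoc_cpr:
  assumes F: "is_functor M" "is_functor N" "is_functor P"
    and a: "X \<in> Obj C" "Y \<in> Obj C" "Z \<in> Obj C" "f \<in> hom C ((X \<otimes> Y) \<otimes> Z) U"
    "m \<in> FO M X" "n \<in> FO N Y" "p \<in> FO P Z"
  shows "conv_assoc M N P U (FA ((M \<star> N) \<star> P) f (cpr (M \<star> N) P (X \<otimes> Y) Z (cpr M N X Y m n) p))
    = FA (M \<star> (N \<star> P)) (f \<cdot> Assoc_inv X Y Z) (cpr M (N \<star> P) X (Y \<otimes> Z) m (cpr N P Y Z n p))"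
  using conv_assoc_FA[OF F, of X Y "Idn C (X \<otimes> Y)" "X \<otimes> Y" m n Z f U p] a
  by (simp add: cmp_simps cpr_simps fun_idn conv_functor)

lemma conv_assoc_nat_trans:
  assumes F: "is_functor M" "is_functor N" "is_functor P"
  shows "nat_trans ((M \<star> N) \<star> P) (M \<star> (N \<star> P)) (conv_assoc M N P)"
  unfolding nat_trans_def
proof (intro conjI allI ballI)
  fix U z assume "U \<in> Obj C" "z \<in> FO ((M \<star> N) \<star> P) U"
  then show "conv_assoc M N P U z \<in> FO (M \<star> (N \<star> P)) U"
    by (elim conv_conv_cases[OF _ F(3)])
      (simp add: conv_assoc_cpr[OF F] fun_simps conv_functor arr_simps cpr_simps)
next
  fix U V k z assume k: "k \<in> hom C U V" and z: "z \<in> FO ((M \<star> N) \<star> P) U"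
  from z F(3) obtain X Y Z f m n p where
    a: "X \<in> Obj C" "Y \<in> Obj C" "Z \<in> Obj C" "f \<in> hom C ((X \<otimes> Y) \<otimes> Z) U" "m \<in> FO M X" "n \<in> FO N Y" "p \<in> FO P Z"
    and z: "z = FA ((M \<star> N) \<star> P) f (cpr (M \<star> N) P (X \<otimes> Y) Z (cpr M N X Y m n) p)"
    by (rule conv_conv_cases)
  have kf: "k \<cdot> f \<in> hom C ((X \<otimes> Y) \<otimes> Z) V" using a(4) k cmp_hom by blast
  have "FA ((M \<star> N) \<star> P) k z = FA ((M \<star> N) \<star> P) (k \<cdot> f) (cpr (M \<star> N) P (X \<otimes> Y) Z (cpr M N X Y m n) p)"
    unfolding z by (rule conv_FA_cpr[OF a(4) k]) (use a in \<open>simp_all add: ten_obj\<close>)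
  then show "conv_assoc M N P V (FA ((M \<star> N) \<star> P) k z) = FA (M \<star> (N \<star> P)) k (conv_assoc M N P U z)"
    using a k kf
    by (simp add: z conv_assoc_cpr[OF F a(1-3) a(4) a(5-7)] conv_assoc_cpr[OF F a(1-3) kf a(5-7)])
      (simp add: fun_simps conv_functor cmp_simps cpr_simps)
qed

text \<open>Mirror image of \<open>conv_assoc_FA\<close>, with naturality of the associator in place
  of that of its inverse.\<close>

lemma conv_assoc_inv_FA:
  fixes M :: "('o, 'a, 'x) set_functor" and N :: "('o, 'a, 'y) set_functor"
    and P :: "('o, 'a, 'z) set_functor"
  assumes F: "is_functor M" "is_functor N" "is_functor P"
    and a: "Y \<in> Obj C" "Z \<in> Obj C" "g \<in> hom C (Y \<otimes> Z) W" "n \<in> FO N Y" "p \<in> FO P Z"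
    and b: "X \<in> Obj C" "f \<in> hom C (X \<otimes> W) U" "m \<in> FO M X"
  shows "conv_assoc_inv M N P U
      (FA (M \<star> (N \<star> P)) f (cpr M (N \<star> P) X W m (FA (N \<star> P) g (cpr N P Y Z n p))))
    = FA ((M \<star> N) \<star> P) (f \<cdot> (Idn C X \<odot> g) \<cdot> Assoc C X Y Z)
        (cpr (M \<star> N) P (X \<otimes> Y) Z (cpr M N X Y m n) p)"
proof -
  define \<psi> where "\<psi> = (\<lambda>X f (m :: 'x) (Y, Z, g, n :: 'y, p :: 'z).
    conv_cl (M \<star> N) P U (X \<otimes> Y, Z, f \<cdot> (Idn C X \<odot> g) \<cdot> Assoc C X Y Z,
            conv_cl M N (X \<otimes> Y) (X, Y, Idn C (X \<otimes> Y), m, n), p))"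
  have \<psi>: "\<psi> X f m (Y, Z, g, n, p) = FA ((M \<star> N) \<star> P) (f \<cdot> (Idn C X \<odot> g) \<cdot> Assoc C X Y Z)
        (cpr (M \<star> N) P (X \<otimes> Y) Z (cpr M N X Y m n) p)"
    if "X \<in> Obj C" "Y \<in> Obj C" "Z \<in> Obj C" "g \<in> hom C (Y \<otimes> Z) W" "f \<in> hom C (X \<otimes> W) U"
    for X Y Z W f g m n p
    using that unfolding \<psi>_def by (simp add: conv_cl_cpr arr_simps flip: cpr_def)
  have inner: "induced (\<psi> X f m) (FA (N \<star> P) g (cpr N P Y Z n p)) = \<psi> X f m (Y, Z, g, n, p)"
    if c: "Y \<in> Obj C" "Z \<in> Obj C" "g \<in> hom C (Y \<otimes> Z) W" "n \<in> FO N Y" "p \<in> FO P Z"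
    "X \<in> Obj C" "f \<in> hom C (X \<otimes> W) U" "m \<in> FO M X" for X Y Z W f g m n p
    unfolding conv_cl_cpr[OF c(3,1,2), symmetric]
  proof (rule induced_conv)
    fix Y Y' Z Z' u v g n p
    assume d: "u \<in> hom C Y Y'" "v \<in> hom C Z Z'" "g \<in> hom C (Y' \<otimes> Z') W" "n \<in> FO N Y" "p \<in> FO P Z"
    then have o: "Y \<in> Obj C" "Y' \<in> Obj C" "Z \<in> Obj C" "Z' \<in> Obj C" using hom_obj by auto
    have e: "g \<cdot> (u \<odot> v) \<in> hom C (Y \<otimes> Z) W" using d by (simp add: arr_simps)
    show "\<psi> X f m (Y, Z, g \<cdot> (u \<odot> v), n, p) = \<psi> X f m (Y', Z', g, FA N u n, FA P v p)"
      unfolding \<psi>[OF c(6) o(1,3) e c(7)] \<psi>[OF c(6) o(2,4) d(3) c(7)]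
      using c(4-) d o F
      by (simp add: cpr_simps conv_functor fun_simps cmp_simps assoc_natural)
  qed
  define \<chi> where "\<chi> = (\<lambda>(X, W :: 'o, f, m, c). induced (\<psi> X f m) c)"
  have "conv_assoc_inv M N P U (conv_cl M (N \<star> P) U (X, W, f, m, FA (N \<star> P) g (cpr N P Y Z n p)))
    = induced \<chi> (conv_cl M (N \<star> P) U (X, W, f, m, FA (N \<star> P) g (cpr N P Y Z n p)))"
    unfolding conv_assoc_inv_def \<chi>_def \<psi>_def ..
  also have "\<dots> = \<chi> (X, W, f, m, FA (N \<star> P) g (cpr N P Y Z n p))"
  proof (rule induced_conv)
    fix X X' W W' u v f m c
    assume d: "u \<in> hom C X X'" "v \<in> hom C W W'" "f \<in> hom C (X' \<otimes> W') U" "m \<in> FO M X" "c \<in> FO (N \<star> P) W"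
    then have o: "X \<in> Obj C" "X' \<in> Obj C" "W \<in> Obj C" "W' \<in> Obj C" using hom_obj by auto
    from d(5) obtain Y Z g n p where e: "Y \<in> Obj C" "Z \<in> Obj C" "g \<in> hom C (Y \<otimes> Z) W" "n \<in> FO N Y" "p \<in> FO P Z"
      and c: "c = FA (N \<star> P) g (cpr N P Y Z n p)" by (rule conv_FO_cases)
    have f: "f \<cdot> (u \<odot> v) \<in> hom C (X \<otimes> W) U" using d by (simp add: arr_simps)
    have vg: "v \<cdot> g \<in> hom C (Y \<otimes> Z) W'" using d e cmp_hom by blast
    have um: "FA M u m \<in> FO M X'" using d F by (simp add: fun_simps hom_iff)
    have "\<chi> (X, W, f \<cdot> (u \<odot> v), m, c) = \<psi> X (f \<cdot> (u \<odot> v)) m (Y, Z, g, n, p)"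
      unfolding \<chi>_def c using inner[OF e o(1) f d(4)] by simp
    also have "\<dots> = \<psi> X' f (FA M u m) (Y, Z, v \<cdot> g, n, p)"
      unfolding \<psi>[OF o(1) e(1,2,3) f] \<psi>[OF o(2) e(1,2) vg d(3)]
      using d e o F by (simp add: cpr_simps conv_functor fun_simps cmp_simps assoc_natural)
    also have "\<dots> = \<chi> (X', W', f, FA M u m, FA (N \<star> P) v c)"
      unfolding \<chi>_def c
      using inner[OF e(1,2) vg e(4,5) o(2) d(3) um] conv_FA_cpr[OF e(3) d(2) e(1,2), of N P n p]
      by simp
    finally show "\<chi> (X, W, f \<cdot> (u \<odot> v), m, c) = \<chi> (X', W', f, FA M u m, FA (N \<star> P) v c)" .
  qed
  also have "\<dots> = \<psi> X f m (Y, Z, g, n, p)" unfolding \<chi>_def using inner[OF a b] by simp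
  finally show ?thesis
    using \<psi>[OF b(1) a(1,2,3) b(2)] conv_cl_cpr[OF b(2) b(1)] a(3) hom_obj by metis
qed

lemma conv_conv_cases':
  assumes "z \<in> FO (M \<star> (N \<star> P)) U" "is_functor M"
  obtains X Y Z f m n p where "X \<in> Obj C" "Y \<in> Obj C" "Z \<in> Obj C" "f \<in> hom C (X \<otimes> Y \<otimes> Z) U"
    "m \<in> FO M X" "n \<in> FO N Y" "p \<in> FO P Z"
    "z = FA (M \<star> (N \<star> P)) f (cpr M (N \<star> P) X (Y \<otimes> Z) m (cpr N P Y Z n p))"
proof -
  from assms(1) obtain X W f m c where 1: "X \<in> Obj C" "W \<in> Obj C" "f \<in> hom C (X \<otimes> W) U"
    "m \<in> FO M X" "c \<in> FO (N \<star> P) W" "z = FA (M \<star> (N \<star> P)) f (cpr M (N \<star> P) X W m c)"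
    by (rule conv_FO_cases)
  from 1(5) obtain Y Z g n p where 2: "Y \<in> Obj C" "Z \<in> Obj C" "g \<in> hom C (Y \<otimes> Z) W" "n \<in> FO N Y"
    "p \<in> FO P Z" "c = FA (N \<star> P) g (cpr N P Y Z n p)"
    by (rule conv_FO_cases)
  show ?thesis
    by (rule that[of X Y Z "f \<cdot> (Idn C X \<odot> g)" m n p])
      (use 1 2 assms(2) in \<open>simp_all add: arr_simps cpr_simps fun_simps conv_functor\<close>)
qed

lemma conv_assoc_inv_cpr:
  assumes F: "is_functor M" "is_functor N" "is_functor P"
    and a: "X \<in> Obj C" "Y \<in> Obj C" "Z \<in> Obj C" "f \<in> hom C (X \<otimes> Y \<otimes> Z) U"
    "m \<in> FO M X" "n \<in> FO N Y" "p \<in> FO P Z"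
  shows "conv_assoc_inv M N P U (FA (M \<star> (N \<star> P)) f (cpr M (N \<star> P) X (Y \<otimes> Z) m (cpr N P Y Z n p)))
    = FA ((M \<star> N) \<star> P) (f \<cdot> Assoc C X Y Z) (cpr (M \<star> N) P (X \<otimes> Y) Z (cpr M N X Y m n) p)"
  using conv_assoc_inv_FA[OF F, of Y Z "Idn C (Y \<otimes> Z)" "Y \<otimes> Z" n p X f U m] a
  by (simp add: cmp_simps cpr_simps fun_idn conv_functor)

lemma conv_assoc_inv_nat_trans:
  assumes F: "is_functor M" "is_functor N" "is_functor P"
  shows "nat_trans (M \<star> (N \<star> P)) ((M \<star> N) \<star> P) (conv_assoc_inv M N P)"
  unfolding nat_trans_def
proof (intro conjI allI ballI)
  fix U z assume "U \<in> Obj C" "z \<in> FO (M \<star> (N \<star> P)) U"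
  then show "conv_assoc_inv M N P U z \<in> FO ((M \<star> N) \<star> P) U"
    by (elim conv_conv_cases'[OF _ F(1)])
      (simp add: conv_assoc_inv_cpr[OF F] fun_simps conv_functor arr_simps cpr_simps)
next
  fix U V k z assume k: "k \<in> hom C U V" and z: "z \<in> FO (M \<star> (N \<star> P)) U"
  from z F(1) obtain X Y Z f m n p where
    a: "X \<in> Obj C" "Y \<in> Obj C" "Z \<in> Obj C" "f \<in> hom C (X \<otimes> Y \<otimes> Z) U" "m \<in> FO M X" "n \<in> FO N Y" "p \<in> FO P Z"
    and z: "z = FA (M \<star> (N \<star> P)) f (cpr M (N \<star> P) X (Y \<otimes> Z) m (cpr N P Y Z n p))"
    by (rule conv_conv_cases')
  have kf: "k \<cdot> f \<in> hom C (X \<otimes> Y \<otimes> Z) V" using a(4) k cmp_hom by blast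
  have "FA (M \<star> (N \<star> P)) k z = FA (M \<star> (N \<star> P)) (k \<cdot> f) (cpr M (N \<star> P) X (Y \<otimes> Z) m (cpr N P Y Z n p))"
    unfolding z by (rule conv_FA_cpr[OF a(4) k]) (use a in \<open>simp_all add: ten_obj\<close>)
  then show "conv_assoc_inv M N P V (FA (M \<star> (N \<star> P)) k z) = FA ((M \<star> N) \<star> P) k (conv_assoc_inv M N P U z)"
    using a k kf
    by (simp add: z conv_assoc_inv_cpr[OF F a(1-3) a(4) a(5-7)] conv_assoc_inv_cpr[OF F a(1-3) kf a(5-7)])
      (simp add: fun_simps conv_functor cmp_simps cpr_simps)
qed

lemma conv_assoc_inv_pairing:
  assumes F: "is_functor F" "is_functor G" "is_functor K" "is_functor L"
    and \<gamma>: "nat_trans (F \<star> G) H \<gamma>" and \<delta>: "nat_trans (H \<star> K) L \<delta>"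
    and a: "X \<in> Obj C" "Y \<in> Obj C" "Z \<in> Obj C" "f \<in> hom C (X \<otimes> Y \<otimes> Z) U"
    "x \<in> FO F X" "y \<in> FO G Y" "w \<in> FO K Z"
  shows "\<delta> U (conv_map H K \<gamma> idt U (conv_assoc_inv F G K U
      (FA (F \<star> (G \<star> K)) f (cpr F (G \<star> K) X (Y \<otimes> Z) x (cpr G K Y Z y w)))))
    = FA L f (FA L (Assoc C X Y Z) (pairing H K \<delta> (X \<otimes> Y) Z (pairing F G \<gamma> X Y x y) w))"
proof -
  have fa: "f \<cdot> Assoc C X Y Z \<in> hom C ((X \<otimes> Y) \<otimes> Z) U" using a by (simp add: arr_simps)
  note p = pairing_simps[OF is_pairing_pairing[OF \<gamma>]] pairing_simps[OF is_pairing_pairing[OF \<delta>]]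
  have "\<gamma> (X \<otimes> Y) (cpr F G X Y x y) = pairing F G \<gamma> X Y x y" by (simp add: pairing_def)
  then have "\<delta> U (conv_map H K \<gamma> idt U (conv_assoc_inv F G K U
      (FA (F \<star> (G \<star> K)) f (cpr F (G \<star> K) X (Y \<otimes> Z) x (cpr G K Y Z y w)))))
    = FA L (f \<cdot> Assoc C X Y Z) (pairing H K \<delta> (X \<otimes> Y) Z (pairing F G \<gamma> X Y x y) w)"
    using a fa by (simp add: conv_assoc_inv_cpr[OF F(1-3)]
        conv_map_cpr[OF \<gamma> nat_trans_idt[OF F(3)] conv_functor F(3)] nat_trans_conv[OF \<delta>]
        ten_obj cpr_simps idt_def p)
  then show ?thesis using a F by (simp add: fun_simps cmp_simps p)
qed

text \<open>The composite \<open>(F \<star> G) \<star> K \<cong> F \<star> (G \<star> K)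
  \<rightarrow> F \<star> H \<rightarrow> L\<close> is the right-hand side of every associativity
  law and also yields one leg of the balancing relation; it is computed here once for all of
  them.\<close>

lemma conv_assoc_pairing:
  assumes F: "is_functor F" "is_functor G" "is_functor K" "is_functor L"
    and \<gamma>: "nat_trans (G \<star> K) H \<gamma>" and \<delta>: "nat_trans (F \<star> H) L \<delta>"
    and a: "X \<in> Obj C" "Y \<in> Obj C" "Z \<in> Obj C" "f \<in> hom C ((X \<otimes> Y) \<otimes> Z) U"
    "x \<in> FO F X" "y \<in> FO G Y" "w \<in> FO K Z"
  shows "\<delta> U (conv_map F H idt \<gamma> U (conv_assoc F G K U
      (FA ((F \<star> G) \<star> K) f (cpr (F \<star> G) K (X \<otimes> Y) Z (cpr F G X Y x y) w))))
    = FA L f (FA L (Assoc_inv X Y Z) (pairing F H \<delta> X (Y \<otimes> Z) x (pairing G K \<gamma> Y Z y w)))"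
proof -
  have fa: "f \<cdot> Assoc_inv X Y Z \<in> hom C (X \<otimes> Y \<otimes> Z) U" using a by (simp add: arr_simps)
  note p = pairing_simps[OF is_pairing_pairing[OF \<gamma>]] pairing_simps[OF is_pairing_pairing[OF \<delta>]]
  have "\<gamma> (Y \<otimes> Z) (cpr G K Y Z y w) = pairing G K \<gamma> Y Z y w" by (simp add: pairing_def)
  then have "\<delta> U (conv_map F H idt \<gamma> U (conv_assoc F G K U
      (FA ((F \<star> G) \<star> K) f (cpr (F \<star> G) K (X \<otimes> Y) Z (cpr F G X Y x y) w))))
    = FA L (f \<cdot> Assoc_inv X Y Z) (pairing F H \<delta> X (Y \<otimes> Z) x (pairing G K \<gamma> Y Z y w))"
    using a fa by (simp add: conv_assoc_cpr[OF F(1-3)]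
        conv_map_cpr[OF nat_trans_idt[OF F(1)] \<gamma> F(1) conv_functor] nat_trans_conv[OF \<delta>]
        ten_obj cpr_simps idt_def p)
  then show ?thesis using a F by (simp add: fun_simps cmp_simps p)
qed

text \<open>Separate functors \<open>H\<close>, \<open>H'\<close> and \<open>L\<close> let this one
  equivalence serve the associativity of a monoid, of a right action and of a left action, and the
  compatibility of the two actions of a bimodule. One direction evaluates at an identity arrow, the
  other uses the normal form of threefold convolutions.\<close>

lemma assoc_law_iff:
  assumes F: "is_functor F" "is_functor G" "is_functor K" "is_functor H" "is_functor H'" "is_functor L"
    and \<alpha>: "nat_trans (F \<star> G) H \<alpha>" and \<beta>: "nat_trans (H \<star> K) L \<beta>"
    and \<gamma>: "nat_trans (G \<star> K) H' \<gamma>" and \<delta>: "nat_trans (F \<star> H') L \<delta>"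
  shows "(\<forall>U \<in> Obj C. \<forall>z \<in> FO ((F \<star> G) \<star> K) U.
      \<beta> U (conv_map H K \<alpha> idt U z) = \<delta> U (conv_map F H' idt \<gamma> U (conv_assoc F G K U z)))
    \<longleftrightarrow> (\<forall>X \<in> Obj C. \<forall>Y \<in> Obj C. \<forall>Z \<in> Obj C. \<forall>x \<in> FO F X. \<forall>y \<in> FO G Y. \<forall>w \<in> FO K Z.
      pairing H K \<beta> (X \<otimes> Y) Z (pairing F G \<alpha> X Y x y) w
      = FA L (Assoc_inv X Y Z) (pairing F H' \<delta> X (Y \<otimes> Z) x (pairing G K \<gamma> Y Z y w)))"
    (is "?L \<longleftrightarrow> ?R")
proof -
  note n = nat_trans_idt[OF F(1)] nat_trans_idt[OF F(3)]
  have l: "\<beta> U (conv_map H K \<alpha> idt U z) = FA L f (pairing H K \<beta> (X \<otimes> Y) Z (pairing F G \<alpha> X Y x y) w)"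
    and r: "\<delta> U (conv_map F H' idt \<gamma> U (conv_assoc F G K U z))
      = FA L f (FA L (Assoc_inv X Y Z) (pairing F H' \<delta> X (Y \<otimes> Z) x (pairing G K \<gamma> Y Z y w)))"
    if a: "X \<in> Obj C" "Y \<in> Obj C" "Z \<in> Obj C" "f \<in> hom C ((X \<otimes> Y) \<otimes> Z) U" "x \<in> FO F X" "y \<in> FO G Y" "w \<in> FO K Z"
      and z: "z = FA ((F \<star> G) \<star> K) f (cpr (F \<star> G) K (X \<otimes> Y) Z (cpr F G X Y x y) w)"
    for X Y Z f x y w z U
  proof -
    have "\<alpha> (X \<otimes> Y) (cpr F G X Y x y) = pairing F G \<alpha> X Y x y" by (simp add: pairing_def)
    then show "\<beta> U (conv_map H K \<alpha> idt U z) = FA L f (pairing H K \<beta> (X \<otimes> Y) Z (pairing F G \<alpha> X Y x y) w)"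
      using a by (simp add: z conv_map_cpr[OF \<alpha> n(2) conv_functor F(3)] nat_trans_conv[OF \<beta>]
          ten_obj cpr_simps idt_def pairing_simps[OF is_pairing_pairing[OF \<alpha>]])
    show "\<delta> U (conv_map F H' idt \<gamma> U (conv_assoc F G K U z))
      = FA L f (FA L (Assoc_inv X Y Z) (pairing F H' \<delta> X (Y \<otimes> Z) x (pairing G K \<gamma> Y Z y w)))"
      unfolding z by (rule conv_assoc_pairing[OF F(1-3,6) \<gamma> \<delta> a])
  qed
  show ?thesis
  proof
    assume L: ?L
    show ?R
    proof (intro ballI)
      fix X Y Z x y w
      assume a: "X \<in> Obj C" "Y \<in> Obj C" "Z \<in> Obj C" "x \<in> FO F X" "y \<in> FO G Y" "w \<in> FO K Z"
      let ?z = "FA ((F \<star> G) \<star> K) (Idn C ((X \<otimes> Y) \<otimes> Z)) (cpr (F \<star> G) K (X \<otimes> Y) Z (cpr F G X Y x y) w)"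
      have i: "Idn C ((X \<otimes> Y) \<otimes> Z) \<in> hom C ((X \<otimes> Y) \<otimes> Z) ((X \<otimes> Y) \<otimes> Z)"
        using a idn_hom ten_obj by blast
      have z: "?z \<in> FO ((F \<star> G) \<star> K) ((X \<otimes> Y) \<otimes> Z)"
        using a by (simp add: fun_simps conv_functor cpr_simps arr_simps)
      show "pairing H K \<beta> (X \<otimes> Y) Z (pairing F G \<alpha> X Y x y) w
        = FA L (Assoc_inv X Y Z) (pairing F H' \<delta> X (Y \<otimes> Z) x (pairing G K \<gamma> Y Z y w))"
        using L[rule_format, OF _ z] l[OF a(1-3) i a(4-6) refl] r[OF a(1-3) i a(4-6) refl] a
        by (simp add: fun_simps F arr_simps idn_left pairing_simps[OF is_pairing_pairing[OF \<alpha>]]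
            pairing_simps[OF is_pairing_pairing[OF \<beta>]] pairing_simps[OF is_pairing_pairing[OF \<gamma>]]
            pairing_simps[OF is_pairing_pairing[OF \<delta>]])
    qed
  next
    assume R: ?R
    show ?L
    proof (intro ballI)
      fix U z assume "z \<in> FO ((F \<star> G) \<star> K) U"
      then show "\<beta> U (conv_map H K \<alpha> idt U z) = \<delta> U (conv_map F H' idt \<gamma> U (conv_assoc F G K U z))"
      proof (rule conv_conv_cases[OF _ F(3)])
        fix X Y Z f x y w
        assume a: "X \<in> Obj C" "Y \<in> Obj C" "Z \<in> Obj C" "f \<in> hom C ((X \<otimes> Y) \<otimes> Z) U" "x \<in> FO F X" "y \<in> FO G Y" "w \<in> FO K Z"
          "z = FA ((F \<star> G) \<star> K) f (cpr (F \<star> G) K (X \<otimes> Y) Z (cpr F G X Y x y) w)"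
        show ?thesis using l[OF a] r[OF a] R a by simp
      qed
    qed
  qed
qed

section \<open>The unit functor and the unit constraints\<close>

lemma J_simps: "FO J X = hom C \<I> X" "FA J k = (\<lambda>j. k \<cdot> j)"
  by (simp_all add: J_def)

lemma J_functor: "is_functor J"
  unfolding is_functor_def
  by (auto simp: J_simps cmp_hom cmp_idn_left cmp_assoc)

text \<open>The formula defining the constraint is a natural pairing because the inverse of the
  right unitor is natural, which follows from \<open>run_nat\<close> by cancelling
  \<open>Run\<close>.\<close>

lemma conv_run_cpr:
  assumes F: "is_functor M"
    and a: "X \<in> Obj C" "Y \<in> Obj C" "f \<in> hom C (X \<otimes> Y) U" "m \<in> FO M X" "j \<in> hom C \<I> Y"
  shows "conv_run M U (FA (M \<star> J) f (cpr M J X Y m j))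
    = FA M f (FA M ((Idn C X \<odot> j) \<cdot> inv_arr C (Run C X)) m)"
  unfolding conv_run_def
proof (rule induced_conv_pairing[OF _ _ F J_functor F a(1-4)])
  have nat: "inv_arr C (Run C Y) \<cdot> f = (f \<odot> Idn C \<I>) \<cdot> inv_arr C (Run C X)"
    if f: "f \<in> hom C X Y" for f X Y
  proof (rule iso_cancel_left)
    have o: "X \<in> Obj C" "Y \<in> Obj C" using f hom_obj by auto
    have "Run C Y \<cdot> (f \<odot> Idn C \<I>) \<cdot> inv_arr C (Run C X) = (Run C Y \<cdot> (f \<odot> Idn C \<I>)) \<cdot> inv_arr C (Run C X)"
      using f o by (simp add: arr_simps assoc_cmp)
    then show "Run C Y \<cdot> inv_arr C (Run C Y) \<cdot> f = Run C Y \<cdot> (f \<odot> Idn C \<I>) \<cdot> inv_arr C (Run C X)"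
      unfolding run_nat[OF f] using f o by (simp add: cmp_simps)
  qed (use f hom_obj[OF f] in \<open>simp_all add: arr_simps\<close>)
  show "is_pairing M J M (\<lambda>X Y m j. FA M ((Idn C X \<odot> j) \<cdot> inv_arr C (Run C X)) m)"
    unfolding is_pairing_def
    using F by (auto simp: J_simps fun_simps cmp_simps nat)
qed (use F a in \<open>auto simp: J_simps fun_simps cmp_simps\<close>)

lemma conv_lun_cpr:
  assumes F: "is_functor M"
    and a: "X \<in> Obj C" "Y \<in> Obj C" "f \<in> hom C (X \<otimes> Y) U" "m \<in> FO M Y" "j \<in> hom C \<I> X"
  shows "conv_lun M U (FA (J \<star> M) f (cpr J M X Y j m))
    = FA M f (FA M ((j \<odot> Idn C Y) \<cdot> inv_arr C (Lun C Y)) m)"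
  unfolding conv_lun_def
proof (rule induced_conv_pairing[OF _ _ J_functor F F a(1-3) _ a(4)])
  have nat: "inv_arr C (Lun C Y) \<cdot> f = (Idn C \<I> \<odot> f) \<cdot> inv_arr C (Lun C X)"
    if f: "f \<in> hom C X Y" for f X Y
  proof (rule iso_cancel_left)
    have o: "X \<in> Obj C" "Y \<in> Obj C" using f hom_obj by auto
    have "Lun C Y \<cdot> (Idn C \<I> \<odot> f) \<cdot> inv_arr C (Lun C X) = (Lun C Y \<cdot> (Idn C \<I> \<odot> f)) \<cdot> inv_arr C (Lun C X)"
      using f o by (simp add: arr_simps assoc_cmp)
    then show "Lun C Y \<cdot> inv_arr C (Lun C Y) \<cdot> f = Lun C Y \<cdot> (Idn C \<I> \<odot> f) \<cdot> inv_arr C (Lun C X)"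
      unfolding lun_nat[OF f] using f o by (simp add: cmp_simps)
  qed (use f hom_obj[OF f] in \<open>simp_all add: arr_simps\<close>)
  show "is_pairing J M M (\<lambda>X Y j m. FA M ((j \<odot> Idn C Y) \<cdot> inv_arr C (Lun C Y)) m)"
    unfolding is_pairing_def
    using F by (auto simp: J_simps fun_simps cmp_simps nat)
qed (use F a in \<open>auto simp: J_simps fun_simps cmp_simps\<close>)

lemma conv_lun_nat_trans: "is_functor M \<Longrightarrow> nat_trans (J \<star> M) M (conv_lun M)"
  by (rule nat_trans_convI[where p = "\<lambda>X Y j m. FA M ((j \<odot> Idn C Y) \<cdot> inv_arr C (Lun C Y)) m"])
    (auto simp: conv_lun_cpr J_simps fun_simps arr_simps)

lemma run_law_iff:
  assumes F: "is_functor M" "is_functor B" "nat_trans (M \<star> B) M \<rho>" "nat_trans J B u"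
  shows "(\<forall>U \<in> Obj C. \<forall>z \<in> FO (M \<star> J) U. \<rho> U (conv_map M B idt u U z) = conv_run M U z)
    \<longleftrightarrow> (\<forall>X \<in> Obj C. \<forall>Y \<in> Obj C. \<forall>m \<in> FO M X. \<forall>j \<in> hom C \<I> Y.
      pairing M B \<rho> X Y m (u Y j) = FA M ((Idn C X \<odot> j) \<cdot> inv_arr C (Run C X)) m)"
    (is "?L \<longleftrightarrow> ?R")
proof -
  have J: "FO J X = hom C \<I> X" for X by (simp add: J_def)
  have l: "\<rho> U (conv_map M B idt u U (FA (M \<star> J) f (cpr M J X Y m j))) = FA M f (pairing M B \<rho> X Y m (u Y j))"
    if a: "X \<in> Obj C" "Y \<in> Obj C" "f \<in> hom C (X \<otimes> Y) U" "m \<in> FO M X" "j \<in> hom C \<I> Y" for X Y f U m j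
    using a nat_typ[OF F(4)]
    by (simp add: conv_map_cpr[OF nat_trans_idt[OF F(1)] F(4) F(1) J_functor] J idt_def nat_trans_conv[OF F(3)])
  show ?thesis
  proof
    assume L: ?L
    show ?R
    proof (intro ballI)
      fix X Y m j assume a: "X \<in> Obj C" "Y \<in> Obj C" "m \<in> FO M X" "j \<in> hom C \<I> Y"
      have i: "Idn C (X \<otimes> Y) \<in> hom C (X \<otimes> Y) (X \<otimes> Y)" using a idn_hom ten_obj by blast
      have j: "j \<in> FO J Y" using a J by simp
      have uj: "u Y j \<in> FO B Y" using nat_typ[OF F(4)] a j by blast
      show "pairing M B \<rho> X Y m (u Y j) = FA M ((Idn C X \<odot> j) \<cdot> inv_arr C (Run C X)) m"
        using L[rule_format, OF _ FA_cpr_typ[OF a(1,2) i a(3) j]] l[OF a(1,2) i a(3,4)]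
          conv_run_cpr[OF F(1) a(1,2) i a(3,4)] a uj
        by (simp add: fun_simps F arr_simps pairing_simps[OF is_pairing_pairing[OF F(3)]] idn_left)
    qed
  next
    assume ?R
    then show ?L
      by (auto elim!: conv_FO_cases simp: l J conv_run_cpr F)
  qed
qed

lemma lun_law:
  assumes F: "is_functor M" "is_functor B" "nat_trans (B \<star> M) M \<rho>" "nat_trans J B u"
    and L: "\<forall>U \<in> Obj C. \<forall>z \<in> FO (J \<star> M) U. \<rho> U (conv_map B M u idt U z) = conv_lun M U z"
    and a: "X \<in> Obj C" "Y \<in> Obj C" "m \<in> FO M Y" "j \<in> hom C \<I> X"
  shows "pairing B M \<rho> X Y (u X j) m = FA M ((j \<odot> Idn C Y) \<cdot> inv_arr C (Lun C Y)) m"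
proof -
  have i: "Idn C (X \<otimes> Y) \<in> hom C (X \<otimes> Y) (X \<otimes> Y)" using a idn_hom ten_obj by blast
  have j: "j \<in> FO J X" using a by (simp add: J_def)
  have uj: "u X j \<in> FO B X" using nat_typ[OF F(4)] a j by blast
  have "\<rho> (X \<otimes> Y) (conv_map B M u idt (X \<otimes> Y) (FA (J \<star> M) (Idn C (X \<otimes> Y)) (cpr J M X Y j m)))
    = FA M (Idn C (X \<otimes> Y)) (pairing B M \<rho> X Y (u X j) m)"
    using a j i uj
    by (simp add: conv_map_cpr[OF F(4) nat_trans_idt[OF F(1)] J_functor F(1)] idt_def nat_trans_conv[OF F(3)])
  then show ?thesis
    using L[rule_format, OF _ FA_cpr_typ[OF a(1,2) i j a(3)]] conv_lun_cpr[OF F(1) a(1,2) i a(3,4)] a uj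
    by (simp add: fun_simps F arr_simps pairing_simps[OF is_pairing_pairing[OF F(3)]] idn_left)
qed

lemma nat_trans_comp:
  "nat_trans F G \<sigma> \<Longrightarrow> nat_trans G H \<tau> \<Longrightarrow> nat_trans F H (\<lambda>U x. \<tau> U (\<sigma> U x))"
  unfolding nat_trans_def using hom_obj by metis

text \<open>With \<open>\<tau>\<close> or \<open>\<sigma>\<close> the identity this becomes right or
  left linearity of a map of modules; the equivalence turns linearity on convolution classes into
  linearity on elements.\<close>

lemma hom_law_iff:
  assumes F: "is_functor F" "is_functor G" "is_functor H" "is_functor H'"
    and \<alpha>: "nat_trans (F \<star> G) H \<alpha>" "nat_trans (F' \<star> G') H' \<alpha>'"
    and \<sigma>: "nat_trans F F' \<sigma>" "nat_trans G G' \<tau>" "nat_trans H H' \<rho>"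
  shows "(\<forall>U \<in> Obj C. \<forall>z \<in> FO (F \<star> G) U. \<rho> U (\<alpha> U z) = \<alpha>' U (conv_map F' G' \<sigma> \<tau> U z))
    \<longleftrightarrow> (\<forall>X \<in> Obj C. \<forall>Y \<in> Obj C. \<forall>x \<in> FO F X. \<forall>y \<in> FO G Y.
      \<rho> (X \<otimes> Y) (pairing F G \<alpha> X Y x y) = pairing F' G' \<alpha>' X Y (\<sigma> X x) (\<tau> Y y))"
    (is "?L \<longleftrightarrow> ?R")
proof -
  note p = pairing_simps[OF is_pairing_pairing[OF \<alpha>(1)]] pairing_simps[OF is_pairing_pairing[OF \<alpha>(2)]]
  have e: "\<rho> U (\<alpha> U (FA (F \<star> G) f (cpr F G X Y x y))) = FA H' f (\<rho> (X \<otimes> Y) (pairing F G \<alpha> X Y x y))"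
    "\<alpha>' U (conv_map F' G' \<sigma> \<tau> U (FA (F \<star> G) f (cpr F G X Y x y)))
      = FA H' f (pairing F' G' \<alpha>' X Y (\<sigma> X x) (\<tau> Y y))"
    if "X \<in> Obj C" "Y \<in> Obj C" "f \<in> hom C (X \<otimes> Y) U" "x \<in> FO F X" "y \<in> FO G Y" for X Y f U x y
    using that nat_typ[OF \<sigma>(1)] nat_typ[OF \<sigma>(2)]
    by (simp_all add: conv_map_cpr[OF \<sigma>(1,2) F(1,2)] nat_trans_conv[OF \<alpha>(1)] nat_trans_conv[OF \<alpha>(2)])
      (simp add: nat_FA[OF \<sigma>(3)] p hom_iff)
  show ?thesis
  proof
    assume L: ?L
    show ?R
    proof (intro ballI)
      fix X Y x y assume a: "X \<in> Obj C" "Y \<in> Obj C" "x \<in> FO F X" "y \<in> FO G Y"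
      have i: "Idn C (X \<otimes> Y) \<in> hom C (X \<otimes> Y) (X \<otimes> Y)" using a idn_hom ten_obj by blast
      show "\<rho> (X \<otimes> Y) (pairing F G \<alpha> X Y x y) = pairing F' G' \<alpha>' X Y (\<sigma> X x) (\<tau> Y y)"
        using L[rule_format, OF _ FA_cpr_typ[OF a(1,2) i a(3,4)]] e[OF a(1,2) i a(3,4)] a
        by (simp add: fun_idn F ten_obj nat_typ[OF \<sigma>(1)] nat_typ[OF \<sigma>(2)] nat_typ[OF \<sigma>(3)] p)
    qed
  next
    assume ?R
    then show ?L by (auto elim!: conv_FO_cases simp: e)
  qed
qed

end

subsection \<open>Balanced tensor products\<close>

context monoidal_category
begin

abbreviation rdot where
  "rdot B M \<equiv> pairing (mod_fun M) (mon_fun B) (ract M)"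

abbreviation ldot where
  "ldot A N \<equiv> pairing (mon_fun A) (mod_fun N) (lact N)"

abbreviation bpr where
  "bpr B M N \<equiv> pairing (mod_fun M) (mod_fun N) (bal_cl B M N)"

text \<open>These are the data that make the balanced quotient a functor. Since only naturality of
  the two middle actions is recorded, a composite module qualifies as soon as its actions are known
  to be natural.\<close>

definition composable ::
  "('o, 'a, 'b) fmonoid \<Rightarrow> ('o, 'a, 'b, 'x, 'l) bimod \<Rightarrow> ('o, 'a, 'd, 'y, 'b) bimod \<Rightarrow> bool" where
  "composable B M N \<longleftrightarrow>
     is_functor (mod_fun M) \<and> is_functor (mon_fun B) \<and> is_functor (mod_fun N) \<and>
     nat_trans (mod_fun M \<star> mon_fun B) (mod_fun M) (ract M) \<and>
     nat_trans (mon_fun B \<star> mod_fun N) (mod_fun N) (lact N)"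

lemma composableD:
  assumes "composable B M N"
  shows "is_functor (mod_fun M)" "is_functor (mon_fun B)" "is_functor (mod_fun N)"
    "nat_trans (mod_fun M \<star> mon_fun B) (mod_fun M) (ract M)"
    "nat_trans (mon_fun B \<star> mod_fun N) (mod_fun N) (lact N)"
  using assms by (auto simp: composable_def)

lemma bal_rel_maps:
  assumes c: "composable B M N"
    and a: "X \<in> Obj C" "Y \<in> Obj C" "Z \<in> Obj C" "f \<in> hom C ((X \<otimes> Y) \<otimes> Z) U"
    "m \<in> FO (mod_fun M) X" "b \<in> FO (mon_fun B) Y" "n \<in> FO (mod_fun N) Z"
    and z: "z = FA ((mod_fun M \<star> mon_fun B) \<star> mod_fun N) f
      (cpr (mod_fun M \<star> mon_fun B) (mod_fun N) (X \<otimes> Y) Z (cpr (mod_fun M) (mon_fun B) X Y m b) n)"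
  shows "conv_map (mod_fun M) (mod_fun N) (ract M) idt U z =
      FA (mod_fun M \<star> mod_fun N) f (cpr (mod_fun M) (mod_fun N) (X \<otimes> Y) Z (rdot B M X Y m b) n)"
    and "conv_map (mod_fun M) (mod_fun N) idt (lact N) U
        (conv_assoc (mod_fun M) (mon_fun B) (mod_fun N) U z) =
      FA (mod_fun M \<star> mod_fun N) f (FA (mod_fun M \<star> mod_fun N) (Assoc_inv X Y Z)
        (cpr (mod_fun M) (mod_fun N) X (Y \<otimes> Z) m (ldot B N Y Z b n)))"
proof -
  note F = composableD[OF c]
  have "ract M (X \<otimes> Y) (cpr (mod_fun M) (mon_fun B) X Y m b) = rdot B M X Y m b"
    by (simp add: pairing_def)
  then show "conv_map (mod_fun M) (mod_fun N) (ract M) idt U z =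
      FA (mod_fun M \<star> mod_fun N) f (cpr (mod_fun M) (mod_fun N) (X \<otimes> Y) Z (rdot B M X Y m b) n)"
    using a by (simp add: z conv_map_cpr[OF F(4) nat_trans_idt[OF F(3)] conv_functor F(3)] ten_obj
        cpr_simps idt_def)
  \<comment> \<open>This leg ends in the convolution itself instead of being followed by an action,
    so \<open>conv_assoc_pairing\<close> is applied with the identity of \<open>M \<star> N\<close>
    as \<open>\<delta>\<close>.\<close>
  have "nat_trans (mod_fun M \<star> mod_fun N) (mod_fun M \<star> mod_fun N) (\<lambda>U c. c)"
    using nat_trans_idt[OF conv_functor] by (simp add: idt_def[abs_def])
  from conv_assoc_pairing[OF F(1-3) conv_functor F(5) this a]
  show "conv_map (mod_fun M) (mod_fun N) idt (lact N) U
        (conv_assoc (mod_fun M) (mon_fun B) (mod_fun N) U z) =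
      FA (mod_fun M \<star> mod_fun N) f (FA (mod_fun M \<star> mod_fun N) (Assoc_inv X Y Z)
        (cpr (mod_fun M) (mod_fun N) X (Y \<otimes> Z) m (ldot B N Y Z b n)))"
    unfolding z by (simp add: pairing_def[of "mod_fun M" "mod_fun N"])
qed

text \<open>The generating pairs are indexed by all of \<open>((M \<star> B) \<star> N)(U)\<close>;
  the normal form of threefold convolutions cuts the compatibility condition down to elementary
  tensors of \<open>m\<close>, \<open>b\<close>, \<open>n\<close>.\<close>

lemma induced_bal:
  assumes c: "composable B M N"
    and \<phi>: "\<And>X Y Z f m b n. X \<in> Obj C \<Longrightarrow> Y \<in> Obj C \<Longrightarrow> Z \<in> Obj C \<Longrightarrow> f \<in> hom C ((X \<otimes> Y) \<otimes> Z) U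
      \<Longrightarrow> m \<in> FO (mod_fun M) X \<Longrightarrow> b \<in> FO (mon_fun B) Y \<Longrightarrow> n \<in> FO (mod_fun N) Z
      \<Longrightarrow> \<phi> (FA (mod_fun M \<star> mod_fun N) f (cpr (mod_fun M) (mod_fun N) (X \<otimes> Y) Z (rdot B M X Y m b) n))
        = \<phi> (FA (mod_fun M \<star> mod_fun N) f (FA (mod_fun M \<star> mod_fun N) (Assoc_inv X Y Z)
            (cpr (mod_fun M) (mod_fun N) X (Y \<otimes> Z) m (ldot B N Y Z b n))))"
  shows "induced \<phi> (bal_cl B M N U t) = \<phi> t"
  unfolding bal_cl_def
proof (rule induced_eqcl)
  fix s t assume "(s, t) \<in> bal_rel B M N U"
  then obtain z where z: "z \<in> FO ((mod_fun M \<star> mon_fun B) \<star> mod_fun N) U"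
    and st: "s = conv_map (mod_fun M) (mod_fun N) (ract M) idt U z"
      "t = conv_map (mod_fun M) (mod_fun N) idt (lact N) U
         (conv_assoc (mod_fun M) (mon_fun B) (mod_fun N) U z)"
    unfolding bal_rel_def by blast
  from z composableD(3)[OF c] show "\<phi> s = \<phi> t"
    by (rule conv_conv_cases) (simp add: st bal_rel_maps[OF c] \<phi>)
qed

lemma bal_cl_balanced:
  assumes c: "composable B M N"
    and a: "X \<in> Obj C" "Y \<in> Obj C" "Z \<in> Obj C" "f \<in> hom C ((X \<otimes> Y) \<otimes> Z) U"
    "m \<in> FO (mod_fun M) X" "b \<in> FO (mon_fun B) Y" "n \<in> FO (mod_fun N) Z"
  shows "bal_cl B M N U (FA (mod_fun M \<star> mod_fun N) f
      (cpr (mod_fun M) (mod_fun N) (X \<otimes> Y) Z (rdot B M X Y m b) n))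
    = bal_cl B M N U (FA (mod_fun M \<star> mod_fun N) f (FA (mod_fun M \<star> mod_fun N) (Assoc_inv X Y Z)
      (cpr (mod_fun M) (mod_fun N) X (Y \<otimes> Z) m (ldot B N Y Z b n))))"
proof -
  let ?z = "FA ((mod_fun M \<star> mon_fun B) \<star> mod_fun N) f
      (cpr (mod_fun M \<star> mon_fun B) (mod_fun N) (X \<otimes> Y) Z (cpr (mod_fun M) (mon_fun B) X Y m b) n)"
  have "?z \<in> FO ((mod_fun M \<star> mon_fun B) \<star> mod_fun N) U"
    using a by (simp add: FA_cpr_typ ten_obj cpr_simps)
  then show ?thesis
    unfolding bal_cl_def bal_rel_maps[OF c a refl, symmetric]
    by (intro eqcl_eqI) (auto simp: bal_rel_def)
qed

lemma bal_fun_FO: "FO (bal_fun B M N) U = bal_cl B M N U ` FO (mod_fun M \<star> mod_fun N) U"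
  by (simp add: bal_fun_def quot_def bal_cl_def cong: image_cong)

lemma bal_fun_FA:
  assumes c: "composable B M N" and k: "k \<in> hom C U V" and t: "t \<in> FO (mod_fun M \<star> mod_fun N) U"
  shows "FA (bal_fun B M N) k (bal_cl B M N U t) = bal_cl B M N V (FA (mod_fun M \<star> mod_fun N) k t)"
proof -
  note F = composableD[OF c]
  have "induced (\<lambda>c. bal_cl B M N V (FA (mod_fun M \<star> mod_fun N) k c)) (bal_cl B M N U t)
    = (\<lambda>c. bal_cl B M N V (FA (mod_fun M \<star> mod_fun N) k c)) t"
  proof (rule induced_bal[OF c])
    fix X Y Z f m b n
    assume a: "X \<in> Obj C" "Y \<in> Obj C" "Z \<in> Obj C" "f \<in> hom C ((X \<otimes> Y) \<otimes> Z) U"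
      "m \<in> FO (mod_fun M) X" "b \<in> FO (mon_fun B) Y" "n \<in> FO (mod_fun N) Z"
    have kf: "k \<cdot> f \<in> hom C ((X \<otimes> Y) \<otimes> Z) V" using a k cmp_hom by blast
    show "bal_cl B M N V (FA (mod_fun M \<star> mod_fun N) k (FA (mod_fun M \<star> mod_fun N) f
        (cpr (mod_fun M) (mod_fun N) (X \<otimes> Y) Z (rdot B M X Y m b) n)))
      = bal_cl B M N V (FA (mod_fun M \<star> mod_fun N) k (FA (mod_fun M \<star> mod_fun N) f
        (FA (mod_fun M \<star> mod_fun N) (Assoc_inv X Y Z)
          (cpr (mod_fun M) (mod_fun N) X (Y \<otimes> Z) m (ldot B N Y Z b n)))))"
      using bal_cl_balanced[OF c a(1-3) kf a(5-7)] a k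
      by (simp add: fun_simps conv_functor cmp_simps cpr_simps
          pairing_simps[OF is_pairing_pairing[OF F(4)]] pairing_simps[OF is_pairing_pairing[OF F(5)]])
  qed
  then show ?thesis using k by (simp add: bal_fun_def hom_iff)
qed

lemma bal_functor:
  assumes c: "composable B M N"
  shows "is_functor (bal_fun B M N)"
  unfolding is_functor_def bal_fun_FO
proof (intro conjI allI ballI; elim imageE; clarify)
  fix X Y f t assume f: "f \<in> hom C X Y" and t: "t \<in> FO (mod_fun M \<star> mod_fun N) X"
  have "FA (mod_fun M \<star> mod_fun N) f t \<in> FO (mod_fun M \<star> mod_fun N) Y"
    using f t by (auto simp: fun_typ conv_functor hom_iff)
  then show "FA (bal_fun B M N) f (bal_cl B M N X t) \<in> bal_cl B M N Y ` FO (mod_fun M \<star> mod_fun N) Y"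
    using bal_fun_FA[OF c f t] by simp
next
  fix X t assume X: "X \<in> Obj C" and t: "t \<in> FO (mod_fun M \<star> mod_fun N) X"
  then show "FA (bal_fun B M N) (Idn C X) (bal_cl B M N X t) = bal_cl B M N X t"
    using bal_fun_FA[OF c idn_hom t] by (simp add: fun_idn conv_functor)
next
  fix X Y Z f g t
  assume f: "f \<in> hom C X Y" and g: "g \<in> hom C Y Z" and t: "t \<in> FO (mod_fun M \<star> mod_fun N) X"
  have "FA (mod_fun M \<star> mod_fun N) f t \<in> FO (mod_fun M \<star> mod_fun N) Y"
    using f t by (auto simp: fun_typ conv_functor hom_iff)
  then show "FA (bal_fun B M N) (g \<cdot> f) (bal_cl B M N X t)
    = FA (bal_fun B M N) g (FA (bal_fun B M N) f (bal_cl B M N X t))"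
    using bal_fun_FA[OF c f t] bal_fun_FA[OF c g] bal_fun_FA[OF c cmp_hom[OF f g] t] f g t
    by (simp add: fun_cmp conv_functor hom_iff)
qed

lemma bal_nat_trans:
  assumes c: "composable B M N"
  shows "nat_trans (mod_fun M \<star> mod_fun N) (bal_fun B M N) (bal_cl B M N)"
  unfolding nat_trans_def using bal_fun_FA[OF c] by (auto simp: bal_fun_FO)

lemmas bpr_simps = pairing_simps[OF is_pairing_pairing[OF bal_nat_trans]]

text \<open>The familiar rule that a scalar crosses the balanced tensor sign. The two tensors live
  over \<open>(X \<otimes> Y) \<otimes> Z\<close> and \<open>X \<otimes> (Y \<otimes> Z)\<close>,
  whence the inverse associator.\<close>

lemma bpr_balanced:
  assumes c: "composable B M N"
    and a: "X \<in> Obj C" "Y \<in> Obj C" "Z \<in> Obj C"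
    "m \<in> FO (mod_fun M) X" "b \<in> FO (mon_fun B) Y" "n \<in> FO (mod_fun N) Z"
  shows "bpr B M N (X \<otimes> Y) Z (rdot B M X Y m b) n
    = FA (bal_fun B M N) (Assoc_inv X Y Z) (bpr B M N X (Y \<otimes> Z) m (ldot B N Y Z b n))"
proof -
  note F = composableD[OF c]
  note p = pairing_simps[OF is_pairing_pairing[OF F(4)]] pairing_simps[OF is_pairing_pairing[OF F(5)]]
  have i: "Idn C ((X \<otimes> Y) \<otimes> Z) \<in> hom C ((X \<otimes> Y) \<otimes> Z) ((X \<otimes> Y) \<otimes> Z)" using a by (simp add: arr_simps)
  have n: "Assoc_inv X Y Z \<in> hom C (X \<otimes> Y \<otimes> Z) ((X \<otimes> Y) \<otimes> Z)" using a by (simp add: arr_simps)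
  show ?thesis
    using bal_cl_balanced[OF c a(1-3) i a(4-6)] a
      nat_trans_conv[OF bal_nat_trans[OF c] _ _ n, of m "ldot B N Y Z b n"]
    by (simp add: fun_simps conv_functor cmp_simps cpr_simps p)
      (simp add: pairing_def)
qed

lemma bal_cases:
  assumes c: "composable B M N" and z: "z \<in> FO (bal_fun B M N) U"
  obtains X Y f m n where "X \<in> Obj C" "Y \<in> Obj C" "f \<in> hom C (X \<otimes> Y) U"
    "m \<in> FO (mod_fun M) X" "n \<in> FO (mod_fun N) Y" "z = FA (bal_fun B M N) f (bpr B M N X Y m n)"
proof -
  from z obtain t where t: "t \<in> FO (mod_fun M \<star> mod_fun N) U" "z = bal_cl B M N U t"
    by (auto simp: bal_fun_FO)
  from t(1) obtain X Y f m n where "X \<in> Obj C" "Y \<in> Obj C" "f \<in> hom C (X \<otimes> Y) U" "m \<in> FO (mod_fun M) X"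
    "n \<in> FO (mod_fun N) Y" "t = FA (mod_fun M \<star> mod_fun N) f (cpr (mod_fun M) (mod_fun N) X Y m n)"
    by (rule conv_FO_cases)
  with that show ?thesis using nat_trans_conv[OF bal_nat_trans[OF c]] t(2) by blast
qed

text \<open>Convolving with \<open>D\<close> keeps the universal property of the coequalizer: a
  transformation \<open>T\<close> out of \<open>(M \<star> N) \<star> D\<close> that respects
  balancing factors through the balanced quotient. \<open>S\<close> has the two-layer shape in which
  the right action on a composite module and the associativity constraint are defined: the outer
  \<open>induced\<close> removes the convolution class, the inner one the balanced class.\<close>

lemma induced_bal_conv:
  fixes T :: "'o \<Rightarrow> ('o, 'a, ('o, 'a, 'x, 'y) conv_elem, 'd) conv_elem \<Rightarrow> 'h"
  assumes c: "composable B M N" and D: "is_functor D" and H: "is_functor H"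
    and T: "nat_trans ((mod_fun M \<star> mod_fun N) \<star> D) H T"
    and bal: "\<And>X Y Z V m b n d. X \<in> Obj C \<Longrightarrow> Y \<in> Obj C \<Longrightarrow> Z \<in> Obj C \<Longrightarrow> V \<in> Obj C
      \<Longrightarrow> m \<in> FO (mod_fun M) X \<Longrightarrow> b \<in> FO (mon_fun B) Y \<Longrightarrow> n \<in> FO (mod_fun N) Z \<Longrightarrow> d \<in> FO D V
      \<Longrightarrow> pairing (mod_fun M \<star> mod_fun N) D T ((X \<otimes> Y) \<otimes> Z) V
          (cpr (mod_fun M) (mod_fun N) (X \<otimes> Y) Z (rdot B M X Y m b) n) d
        = pairing (mod_fun M \<star> mod_fun N) D T ((X \<otimes> Y) \<otimes> Z) V
          (FA (mod_fun M \<star> mod_fun N) (Assoc_inv X Y Z)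
            (cpr (mod_fun M) (mod_fun N) X (Y \<otimes> Z) m (ldot B N Y Z b n))) d"
  defines "S \<equiv> \<lambda>U. induced (\<lambda>(X, Y, f, q, d). induced (\<lambda>c.
      T U (conv_cl (mod_fun M \<star> mod_fun N) D U (X, Y, f, c, d))) q)"
  shows "nat_trans (bal_fun B M N \<star> D) H S"
    and "\<And>W V t d. W \<in> Obj C \<Longrightarrow> V \<in> Obj C \<Longrightarrow> t \<in> FO (mod_fun M \<star> mod_fun N) W \<Longrightarrow> d \<in> FO D V
      \<Longrightarrow> pairing (bal_fun B M N) D S W V (bal_cl B M N W t) d
        = pairing (mod_fun M \<star> mod_fun N) D T W V t d"
proof -
  note F = composableD[OF c]
  let ?P = "pairing (mod_fun M \<star> mod_fun N) D T"
  note p = pairing_simps[OF is_pairing_pairing[OF T]]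
  note p' = pairing_simps[OF is_pairing_pairing[OF F(4)]] pairing_simps[OF is_pairing_pairing[OF F(5)]]
  have inner: "induced (\<lambda>c. T U (conv_cl (mod_fun M \<star> mod_fun N) D U (W, V, f, c, d))) (bal_cl B M N W t)
      = FA H f (?P W V t d)"
    if a: "W \<in> Obj C" "V \<in> Obj C" "f \<in> hom C (W \<otimes> V) U" "t \<in> FO (mod_fun M \<star> mod_fun N) W" "d \<in> FO D V"
    for U W V f t d
  proof -
    have e: "T U (conv_cl (mod_fun M \<star> mod_fun N) D U (W, V, f, c, d)) = FA H f (?P W V c d)"
      if "c \<in> FO (mod_fun M \<star> mod_fun N) W" for c
      using that a by (simp add: conv_cl_cpr[OF a(3,1,2)] nat_trans_conv[OF T])
    show ?thesis
    proof (subst induced_bal[OF c])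
      fix X Y Z g m b n
      assume x: "X \<in> Obj C" "Y \<in> Obj C" "Z \<in> Obj C" "g \<in> hom C ((X \<otimes> Y) \<otimes> Z) W"
        "m \<in> FO (mod_fun M) X" "b \<in> FO (mon_fun B) Y" "n \<in> FO (mod_fun N) Z"
      let ?s = "cpr (mod_fun M) (mod_fun N) (X \<otimes> Y) Z (rdot B M X Y m b) n"
      let ?t = "FA (mod_fun M \<star> mod_fun N) (Assoc_inv X Y Z)
        (cpr (mod_fun M) (mod_fun N) X (Y \<otimes> Z) m (ldot B N Y Z b n))"
      have tys: "?s \<in> FO (mod_fun M \<star> mod_fun N) ((X \<otimes> Y) \<otimes> Z)"
        "?t \<in> FO (mod_fun M \<star> mod_fun N) ((X \<otimes> Y) \<otimes> Z)"
        using x by (simp_all add: fun_simps conv_functor arr_simps cpr_simps p')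
      have g: "g \<in> Arr C" "Cod C g = W" "Dom C g = (X \<otimes> Y) \<otimes> Z" using x(4) by (auto simp: hom_iff)
      \<comment> \<open>Naturality of \<open>T\<close> pulls the arrow \<open>g\<close> out of the
        pairing, leaving the two representatives over \<open>(X \<otimes> Y) \<otimes> Z\<close>,
        where the hypothesis \<open>bal\<close> compares them.\<close>
      have m: "FA (mod_fun M \<star> mod_fun N) g s \<in> FO (mod_fun M \<star> mod_fun N) W"
        and "?P W V (FA (mod_fun M \<star> mod_fun N) g s) d = FA H (g \<odot> Idn C V) (?P ((X \<otimes> Y) \<otimes> Z) V s d)"
        if "s \<in> FO (mod_fun M \<star> mod_fun N) ((X \<otimes> Y) \<otimes> Z)" for s
        using that g a(2,5) D by (simp_all add: p fun_typ conv_functor)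
      then have "?P W V (FA (mod_fun M \<star> mod_fun N) g ?s) d = ?P W V (FA (mod_fun M \<star> mod_fun N) g ?t) d"
        using tys bal[OF x(1-3) a(2) x(5-7) a(5)] by metis
      then show "T U (conv_cl (mod_fun M \<star> mod_fun N) D U (W, V, f, FA (mod_fun M \<star> mod_fun N) g ?s, d))
        = T U (conv_cl (mod_fun M \<star> mod_fun N) D U (W, V, f, FA (mod_fun M \<star> mod_fun N) g ?t, d))"
        using e[OF m[OF tys(1)]] e[OF m[OF tys(2)]] by metis
    qed (rule e[OF a(4)])
  qed
  have main: "S U (FA (bal_fun B M N \<star> D) f (cpr (bal_fun B M N) D W V (bal_cl B M N W t) d))
      = FA H f (?P W V t d)"
    if a: "W \<in> Obj C" "V \<in> Obj C" "f \<in> hom C (W \<otimes> V) U" "t \<in> FO (mod_fun M \<star> mod_fun N) W" "d \<in> FO D V"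
    for U W V f t d
    unfolding conv_cl_cpr[OF a(3,1,2), symmetric] S_def
  proof (subst induced_conv)
    fix W W' V V' g h f q d
    assume x: "g \<in> hom C W W'" "h \<in> hom C V V'" "f \<in> hom C (W' \<otimes> V') U"
      "q \<in> FO (bal_fun B M N) W" "d \<in> FO D V"
    then have o: "W \<in> Obj C" "W' \<in> Obj C" "V \<in> Obj C" "V' \<in> Obj C" using hom_obj by auto
    from x(4) obtain t where t: "t \<in> FO (mod_fun M \<star> mod_fun N) W" "q = bal_cl B M N W t"
      by (auto simp: bal_fun_FO)
    have fgh: "f \<cdot> (g \<odot> h) \<in> hom C (W \<otimes> V) U" using x by (simp add: arr_simps)
    have t': "FA (mod_fun M \<star> mod_fun N) g t \<in> FO (mod_fun M \<star> mod_fun N) W'" "FA D h d \<in> FO D V'"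
      using t x D by (simp_all add: fun_typ conv_functor hom_iff)
    show "(case (W, V, f \<cdot> (g \<odot> h), q, d) of (X, Y, f, q, d) \<Rightarrow>
        induced (\<lambda>c. T U (conv_cl (mod_fun M \<star> mod_fun N) D U (X, Y, f, c, d))) q)
      = (case (W', V', f, FA (bal_fun B M N) g q, FA D h d) of (X, Y, f, q, d) \<Rightarrow>
        induced (\<lambda>c. T U (conv_cl (mod_fun M \<star> mod_fun N) D U (X, Y, f, c, d))) q)"
      using inner[OF o(1,3) fgh t(1) x(5)] inner[OF o(2,4) x(3) t'] bal_fun_FA[OF c x(1) t(1)]
        x t o D H by (simp add: p fun_simps conv_functor cmp_simps)
  qed (simp add: inner[OF a])
  show pr: "pairing (bal_fun B M N) D S W V (bal_cl B M N W t) d = ?P W V t d"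
    if a: "W \<in> Obj C" "V \<in> Obj C" "t \<in> FO (mod_fun M \<star> mod_fun N) W" "d \<in> FO D V" for W V t d
    by (rule pairing_eq[where H = H]) (use a H main[OF a(1,2) _ a(3,4)] in \<open>auto simp: bal_fun_FO p\<close>)
  show "nat_trans (bal_fun B M N \<star> D) H S"
    by (rule nat_trans_convI[where p = "pairing (bal_fun B M N) D S"])
      (auto simp: bal_fun_FO pr main H p)
qed

text \<open>The same universal property with the quotient in the second factor, as the left action
  on a composite module requires.\<close>

lemma induced_conv_bal:
  fixes T :: "'o \<Rightarrow> ('o, 'a, 'd, ('o, 'a, 'x, 'y) conv_elem) conv_elem \<Rightarrow> 'h"
  assumes c: "composable B M N" and D: "is_functor D" and H: "is_functor H"
    and T: "nat_trans (D \<star> (mod_fun M \<star> mod_fun N)) H T"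
    and bal: "\<And>X Y Z V m b n d. X \<in> Obj C \<Longrightarrow> Y \<in> Obj C \<Longrightarrow> Z \<in> Obj C \<Longrightarrow> V \<in> Obj C
      \<Longrightarrow> m \<in> FO (mod_fun M) X \<Longrightarrow> b \<in> FO (mon_fun B) Y \<Longrightarrow> n \<in> FO (mod_fun N) Z \<Longrightarrow> d \<in> FO D V
      \<Longrightarrow> pairing D (mod_fun M \<star> mod_fun N) T V ((X \<otimes> Y) \<otimes> Z) d
          (cpr (mod_fun M) (mod_fun N) (X \<otimes> Y) Z (rdot B M X Y m b) n)
        = pairing D (mod_fun M \<star> mod_fun N) T V ((X \<otimes> Y) \<otimes> Z) d
          (FA (mod_fun M \<star> mod_fun N) (Assoc_inv X Y Z)
            (cpr (mod_fun M) (mod_fun N) X (Y \<otimes> Z) m (ldot B N Y Z b n)))"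
  defines "S \<equiv> \<lambda>U. induced (\<lambda>(X, Y, f, d, q). induced (\<lambda>c.
      T U (conv_cl D (mod_fun M \<star> mod_fun N) U (X, Y, f, d, c))) q)"
  shows "nat_trans (D \<star> bal_fun B M N) H S"
    and "\<And>W V t d. W \<in> Obj C \<Longrightarrow> V \<in> Obj C \<Longrightarrow> t \<in> FO (mod_fun M \<star> mod_fun N) W \<Longrightarrow> d \<in> FO D V
      \<Longrightarrow> pairing D (bal_fun B M N) S V W d (bal_cl B M N W t)
        = pairing D (mod_fun M \<star> mod_fun N) T V W d t"
proof -
  note F = composableD[OF c]
  let ?P = "pairing D (mod_fun M \<star> mod_fun N) T"
  note p = pairing_simps[OF is_pairing_pairing[OF T]]
  note p' = pairing_simps[OF is_pairing_pairing[OF F(4)]] pairing_simps[OF is_pairing_pairing[OF F(5)]]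
  have inner: "induced (\<lambda>c. T U (conv_cl D (mod_fun M \<star> mod_fun N) U (V, W, f, d, c))) (bal_cl B M N W t)
      = FA H f (?P V W d t)"
    if a: "V \<in> Obj C" "W \<in> Obj C" "f \<in> hom C (V \<otimes> W) U" "t \<in> FO (mod_fun M \<star> mod_fun N) W" "d \<in> FO D V"
    for U W V f t d
  proof -
    have e: "T U (conv_cl D (mod_fun M \<star> mod_fun N) U (V, W, f, d, c)) = FA H f (?P V W d c)"
      if "c \<in> FO (mod_fun M \<star> mod_fun N) W" for c
      using that a by (simp add: conv_cl_cpr[OF a(3,1,2)] nat_trans_conv[OF T])
    show ?thesis
    proof (subst induced_bal[OF c])
      fix X Y Z g m b n
      assume x: "X \<in> Obj C" "Y \<in> Obj C" "Z \<in> Obj C" "g \<in> hom C ((X \<otimes> Y) \<otimes> Z) W"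
        "m \<in> FO (mod_fun M) X" "b \<in> FO (mon_fun B) Y" "n \<in> FO (mod_fun N) Z"
      let ?s = "cpr (mod_fun M) (mod_fun N) (X \<otimes> Y) Z (rdot B M X Y m b) n"
      let ?t = "FA (mod_fun M \<star> mod_fun N) (Assoc_inv X Y Z)
        (cpr (mod_fun M) (mod_fun N) X (Y \<otimes> Z) m (ldot B N Y Z b n))"
      have tys: "?s \<in> FO (mod_fun M \<star> mod_fun N) ((X \<otimes> Y) \<otimes> Z)"
        "?t \<in> FO (mod_fun M \<star> mod_fun N) ((X \<otimes> Y) \<otimes> Z)"
        using x by (simp_all add: fun_simps conv_functor arr_simps cpr_simps p')
      have g: "g \<in> Arr C" "Cod C g = W" "Dom C g = (X \<otimes> Y) \<otimes> Z" using x(4) by (auto simp: hom_iff)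
      have m: "FA (mod_fun M \<star> mod_fun N) g s \<in> FO (mod_fun M \<star> mod_fun N) W"
        and "?P V W d (FA (mod_fun M \<star> mod_fun N) g s) = FA H (Idn C V \<odot> g) (?P V ((X \<otimes> Y) \<otimes> Z) d s)"
        if "s \<in> FO (mod_fun M \<star> mod_fun N) ((X \<otimes> Y) \<otimes> Z)" for s
        using that g a(1,5) D by (simp_all add: p fun_typ conv_functor)
      then have "?P V W d (FA (mod_fun M \<star> mod_fun N) g ?s) = ?P V W d (FA (mod_fun M \<star> mod_fun N) g ?t)"
        using tys bal[OF x(1-3) a(1) x(5-7) a(5)] by metis
      then show "T U (conv_cl D (mod_fun M \<star> mod_fun N) U (V, W, f, d, FA (mod_fun M \<star> mod_fun N) g ?s))
        = T U (conv_cl D (mod_fun M \<star> mod_fun N) U (V, W, f, d, FA (mod_fun M \<star> mod_fun N) g ?t))"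
        using e[OF m[OF tys(1)]] e[OF m[OF tys(2)]] by metis
    qed (rule e[OF a(4)])
  qed
  have main: "S U (FA (D \<star> bal_fun B M N) f (cpr D (bal_fun B M N) V W d (bal_cl B M N W t)))
      = FA H f (?P V W d t)"
    if a: "V \<in> Obj C" "W \<in> Obj C" "f \<in> hom C (V \<otimes> W) U" "t \<in> FO (mod_fun M \<star> mod_fun N) W" "d \<in> FO D V"
    for U W V f t d
    unfolding conv_cl_cpr[OF a(3,1,2), symmetric] S_def
  proof (subst induced_conv)
    fix V V' W W' h g f d q
    assume x: "h \<in> hom C V V'" "g \<in> hom C W W'" "f \<in> hom C (V' \<otimes> W') U"
      "d \<in> FO D V" "q \<in> FO (bal_fun B M N) W"
    then have o: "V \<in> Obj C" "V' \<in> Obj C" "W \<in> Obj C" "W' \<in> Obj C" using hom_obj by auto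
    from x(5) obtain t where t: "t \<in> FO (mod_fun M \<star> mod_fun N) W" "q = bal_cl B M N W t"
      by (auto simp: bal_fun_FO)
    have fgh: "f \<cdot> (h \<odot> g) \<in> hom C (V \<otimes> W) U" using x by (simp add: arr_simps)
    have t': "FA (mod_fun M \<star> mod_fun N) g t \<in> FO (mod_fun M \<star> mod_fun N) W'" "FA D h d \<in> FO D V'"
      using t x D by (simp_all add: fun_typ conv_functor hom_iff)
    show "(case (V, W, f \<cdot> (h \<odot> g), d, q) of (X, Y, f, d, q) \<Rightarrow>
        induced (\<lambda>c. T U (conv_cl D (mod_fun M \<star> mod_fun N) U (X, Y, f, d, c))) q)
      = (case (V', W', f, FA D h d, FA (bal_fun B M N) g q) of (X, Y, f, d, q) \<Rightarrow>
        induced (\<lambda>c. T U (conv_cl D (mod_fun M \<star> mod_fun N) U (X, Y, f, d, c))) q)"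
      using inner[OF o(1,3) fgh t(1) x(4)] inner[OF o(2,4) x(3) t'] bal_fun_FA[OF c x(2) t(1)]
        x t o D H by (simp add: p fun_simps conv_functor cmp_simps)
  qed (simp add: inner[OF a])
  show pr: "pairing D (bal_fun B M N) S V W d (bal_cl B M N W t) = ?P V W d t"
    if a: "W \<in> Obj C" "V \<in> Obj C" "t \<in> FO (mod_fun M \<star> mod_fun N) W" "d \<in> FO D V" for W V t d
    by (rule pairing_eq[where H = H]) (use a H main[OF a(2,1) _ a(3,4)] in \<open>auto simp: bal_fun_FO p\<close>)
  show "nat_trans (D \<star> bal_fun B M N) H S"
    by (rule nat_trans_convI[where p = "pairing D (bal_fun B M N) S"])
      (auto simp: bal_fun_FO pr main H p)
qed

end

subsection \<open>Composition of modules\<close>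

context monoidal_category
begin

text \<open>The pentagon with all arrows inverted: it compares the two ways of moving brackets to
  the left, the direction taken by right actions and by the balancing relation.\<close>

lemma pentagon_inv:
  assumes "W \<in> Obj C" "X \<in> Obj C" "Y \<in> Obj C" "Z \<in> Obj C"
  shows "Assoc_inv (W \<otimes> X) Y Z \<cdot> Assoc_inv W X (Y \<otimes> Z) =
    (Assoc_inv W X Y \<odot> Idn C Z) \<cdot> Assoc_inv W (X \<otimes> Y) Z \<cdot> (Idn C W \<odot> Assoc_inv X Y Z)"
proof (rule iso_cancel_left)
  let ?e = "Assoc C W X (Y \<otimes> Z) \<cdot> Assoc C (W \<otimes> X) Y Z"
  show "iso_arr C ?e" using assms by (simp add: arr_simps)
  have "?e \<cdot> (Assoc_inv W X Y \<odot> Idn C Z) \<cdot> Assoc_inv W (X \<otimes> Y) Z \<cdot> (Idn C W \<odot> Assoc_inv X Y Z)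
    = Idn C (W \<otimes> X \<otimes> Y \<otimes> Z)"
    unfolding pentagon[OF assms] using assms by (simp add: cmp_simps)
  then show "?e \<cdot> Assoc_inv (W \<otimes> X) Y Z \<cdot> Assoc_inv W X (Y \<otimes> Z) =
    ?e \<cdot> (Assoc_inv W X Y \<odot> Idn C Z) \<cdot> Assoc_inv W (X \<otimes> Y) Z \<cdot> (Idn C W \<odot> Assoc_inv X Y Z)"
    using assms by (simp add: cmp_simps)
qed (use assms in \<open>simp_all add: arr_simps\<close>)

text \<open>The pentagon solved for its middle associator. This form is met when a left action,
  which moves brackets to the right, crosses the balancing relation, which moves them to the
  left.\<close>

lemma pentagon_mixed:
  assumes "W \<in> Obj C" "X \<in> Obj C" "Y \<in> Obj C" "Z \<in> Obj C"
  shows "Assoc C W (X \<otimes> Y) Z = (Idn C W \<odot> Assoc_inv X Y Z) \<cdot> Assoc C W X (Y \<otimes> Z) \<cdot>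
    Assoc C (W \<otimes> X) Y Z \<cdot> (Assoc_inv W X Y \<odot> Idn C Z)"
proof -
  have "(Idn C W \<odot> Assoc_inv X Y Z) \<cdot> Assoc C W X (Y \<otimes> Z) \<cdot> Assoc C (W \<otimes> X) Y Z \<cdot> (Assoc_inv W X Y \<odot> Idn C Z)
    = (Idn C W \<odot> Assoc_inv X Y Z) \<cdot> (Assoc C W X (Y \<otimes> Z) \<cdot> Assoc C (W \<otimes> X) Y Z) \<cdot> (Assoc_inv W X Y \<odot> Idn C Z)"
    using assms by (simp add: arr_simps assoc_cmp)
  also have "\<dots> = Assoc C W (X \<otimes> Y) Z"
    unfolding pentagon[OF assms] using assms by (simp add: cmp_simps)
  finally show ?thesis by simp
qed

lemma assoc_inv_natural_left_tail:
  assumes "g \<in> Arr C" "Cod C g = W" "Y \<in> Obj C" "Z \<in> Obj C" "k \<in> Arr C" "Cod C k = Dom C g \<otimes> Y \<otimes> Z"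
  shows "Assoc_inv W Y Z \<cdot> (g \<odot> Idn C (Y \<otimes> Z)) \<cdot> k
    = ((g \<odot> Idn C Y) \<odot> Idn C Z) \<cdot> Assoc_inv (Dom C g) Y Z \<cdot> k"
  using assoc_inv_natural_tail[of g "Idn C Y" "Idn C Z" W Y Z k] assms
  by (simp add: idn_arr ten_idn)

text \<open>The part of the bimodule structure from which both actions on a balanced tensor product
  are built: naturality of the two actions and their compatibility, the latter already stated on
  elements.\<close>

definition biaction ::
  "('o, 'a, 'l) fmonoid \<Rightarrow> ('o, 'a, 'b) fmonoid \<Rightarrow> ('o, 'a, 'b, 'x, 'l) bimod \<Rightarrow> bool" where
  "biaction A B M \<longleftrightarrow>
     is_functor (mon_fun A) \<and> is_functor (mon_fun B) \<and> is_functor (mod_fun M) \<and>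
     nat_trans (mon_fun A \<star> mod_fun M) (mod_fun M) (lact M) \<and>
     nat_trans (mod_fun M \<star> mon_fun B) (mod_fun M) (ract M) \<and>
     (\<forall>X \<in> Obj C. \<forall>Y \<in> Obj C. \<forall>Z \<in> Obj C.
        \<forall>a \<in> FO (mon_fun A) X. \<forall>m \<in> FO (mod_fun M) Y. \<forall>b \<in> FO (mon_fun B) Z.
        rdot B M (X \<otimes> Y) Z (ldot A M X Y a m) b =
        FA (mod_fun M) (Assoc_inv X Y Z) (ldot A M X (Y \<otimes> Z) a (rdot B M Y Z m b)))"

lemma biactionD:
  assumes "biaction A B M"
  shows "is_functor (mon_fun A)" "is_functor (mon_fun B)" "is_functor (mod_fun M)"
    "nat_trans (mon_fun A \<star> mod_fun M) (mod_fun M) (lact M)"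
    "nat_trans (mod_fun M \<star> mon_fun B) (mod_fun M) (ract M)"
  using assms by (auto simp: biaction_def)

lemma biaction_law:
  "biaction A B M \<Longrightarrow> X \<in> Obj C \<Longrightarrow> Y \<in> Obj C \<Longrightarrow> Z \<in> Obj C
    \<Longrightarrow> a \<in> FO (mon_fun A) X \<Longrightarrow> m \<in> FO (mod_fun M) Y \<Longrightarrow> b \<in> FO (mon_fun B) Z
    \<Longrightarrow> rdot B M (X \<otimes> Y) Z (ldot A M X Y a m) b =
      FA (mod_fun M) (Assoc_inv X Y Z) (ldot A M X (Y \<otimes> Z) a (rdot B M Y Z m b))"
  by (auto simp: biaction_def)

lemma biaction_composable: "biaction A B M \<Longrightarrow> biaction B D N \<Longrightarrow> composable B M N"
  by (auto simp: biaction_def composable_def)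

lemma bimodule_biaction:
  assumes "bimodule A B M" "is_functor (mon_fun A)" "is_functor (mon_fun B)"
  shows "biaction A B M"
proof -
  have F: "is_functor (mod_fun M)" "nat_trans (mon_fun A \<star> mod_fun M) (mod_fun M) (lact M)"
    "nat_trans (mod_fun M \<star> mon_fun B) (mod_fun M) (ract M)"
    using assms(1) by (auto simp: bimodule_def left_module_def right_module_def)
  show ?thesis
    unfolding biaction_def
    using assms F assoc_law_iff[OF assms(2) F(1) assms(3) F(1) F(1) F(1) F(2,3,3,2)]
    by (auto simp: bimodule_def)
qed

lemma mod_comp_fun: "mod_fun (mod_comp A B D M N) = bal_fun B M N"
  by (simp add: mod_comp_def)

text \<open>Taking \<open>H' = N\<close> gives the right action on \<open>M *\<^sub>B N\<close>, and \<open>H' = N *\<^sub>D P\<close> the associativity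
  constraint; \<open>\<mu>\<close> is the left action of \<open>B\<close> on \<open>H'\<close>.\<close>

lemma induced_bal_assoc:
  assumes c: "composable B M N" and F: "is_functor D" "is_functor H'" "is_functor H"
    and \<gamma>: "nat_trans (mod_fun N \<star> D) H' \<gamma>" and \<delta>: "nat_trans (mod_fun M \<star> H') H \<delta>"
    and \<mu>: "nat_trans (mon_fun B \<star> H') H' \<mu>"
    and \<gamma>\<mu>: "\<And>Y Z V b n d. Y \<in> Obj C \<Longrightarrow> Z \<in> Obj C \<Longrightarrow> V \<in> Obj C \<Longrightarrow> b \<in> FO (mon_fun B) Y
      \<Longrightarrow> n \<in> FO (mod_fun N) Z \<Longrightarrow> d \<in> FO D V
      \<Longrightarrow> pairing (mod_fun N) D \<gamma> (Y \<otimes> Z) V (ldot B N Y Z b n) d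
        = FA H' (Assoc_inv Y Z V) (pairing (mon_fun B) H' \<mu> Y (Z \<otimes> V) b (pairing (mod_fun N) D \<gamma> Z V n d))"
    and \<delta>\<mu>: "\<And>X Y Z m b h. X \<in> Obj C \<Longrightarrow> Y \<in> Obj C \<Longrightarrow> Z \<in> Obj C \<Longrightarrow> m \<in> FO (mod_fun M) X
      \<Longrightarrow> b \<in> FO (mon_fun B) Y \<Longrightarrow> h \<in> FO H' Z
      \<Longrightarrow> pairing (mod_fun M) H' \<delta> (X \<otimes> Y) Z (rdot B M X Y m b) h
        = FA H (Assoc_inv X Y Z) (pairing (mod_fun M) H' \<delta> X (Y \<otimes> Z) m (pairing (mon_fun B) H' \<mu> Y Z b h))"
  defines "S \<equiv> \<lambda>U. induced (\<lambda>(X, Y, f, q, d). induced (\<lambda>c.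
      \<delta> U (conv_map (mod_fun M) H' idt \<gamma> U (conv_assoc (mod_fun M) (mod_fun N) D U
        (conv_cl (mod_fun M \<star> mod_fun N) D U (X, Y, f, c, d))))) q)"
  shows "nat_trans (bal_fun B M N \<star> D) H S"
    and "\<And>X Y Z m n d. X \<in> Obj C \<Longrightarrow> Y \<in> Obj C \<Longrightarrow> Z \<in> Obj C
      \<Longrightarrow> m \<in> FO (mod_fun M) X \<Longrightarrow> n \<in> FO (mod_fun N) Y \<Longrightarrow> d \<in> FO D Z
      \<Longrightarrow> pairing (bal_fun B M N) D S (X \<otimes> Y) Z (bpr B M N X Y m n) d
        = FA H (Assoc_inv X Y Z) (pairing (mod_fun M) H' \<delta> X (Y \<otimes> Z) m (pairing (mod_fun N) D \<gamma> Y Z n d))"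
proof -
  note c' = composableD[OF c]
  note p = pairing_simps[OF is_pairing_pairing[OF \<gamma>]] pairing_simps[OF is_pairing_pairing[OF \<delta>]]
    pairing_simps[OF is_pairing_pairing[OF \<mu>]]
    pairing_simps[OF is_pairing_pairing[OF c'(4)]] pairing_simps[OF is_pairing_pairing[OF c'(5)]]
  define T where "T = (\<lambda>U z. \<delta> U (conv_map (mod_fun M) H' idt \<gamma> U (conv_assoc (mod_fun M) (mod_fun N) D U z)))"
  have T: "nat_trans ((mod_fun M \<star> mod_fun N) \<star> D) H T"
    unfolding T_def
    by (intro nat_trans_comp[OF _ \<delta>] nat_trans_comp[OF conv_assoc_nat_trans]
        conv_map_nat_trans nat_trans_idt \<gamma> c' F conv_functor)
  have TP: "pairing (mod_fun M \<star> mod_fun N) D T (X \<otimes> Y) Z (cpr (mod_fun M) (mod_fun N) X Y m n) d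
    = FA H (Assoc_inv X Y Z) (pairing (mod_fun M) H' \<delta> X (Y \<otimes> Z) m (pairing (mod_fun N) D \<gamma> Y Z n d))"
    if a: "X \<in> Obj C" "Y \<in> Obj C" "Z \<in> Obj C" "m \<in> FO (mod_fun M) X" "n \<in> FO (mod_fun N) Y" "d \<in> FO D Z"
    for X Y Z m n d
  proof (rule pairing_eq[where H = H])
    fix f U assume "f \<in> hom C ((X \<otimes> Y) \<otimes> Z) U"
    then show "T U (FA ((mod_fun M \<star> mod_fun N) \<star> D) f
        (cpr (mod_fun M \<star> mod_fun N) D (X \<otimes> Y) Z (cpr (mod_fun M) (mod_fun N) X Y m n) d))
      = FA H f (FA H (Assoc_inv X Y Z) (pairing (mod_fun M) H' \<delta> X (Y \<otimes> Z) m (pairing (mod_fun N) D \<gamma> Y Z n d)))"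
      unfolding T_def using a by (intro conv_assoc_pairing[OF c'(1,3) F(1,3) \<gamma> \<delta>])
  qed (use a F in \<open>simp_all add: ten_obj cpr_simps fun_simps arr_simps p\<close>)
  have S: "S = (\<lambda>U. induced (\<lambda>(X, Y, f, q, d). induced (\<lambda>c.
      T U (conv_cl (mod_fun M \<star> mod_fun N) D U (X, Y, f, c, d))) q))"
    unfolding S_def T_def ..
  note * = induced_bal_conv[OF c F(1,3) T]
  \<comment> \<open>Both sides reduce to the value of \<open>\<delta>\<close> at \<open>m\<close>
    and \<open>\<mu>(b, \<gamma>(n, d))\<close>: on the left \<open>\<delta>\<mu>\<close> moves
    \<open>b\<close> past \<open>m\<close>, on the right \<open>\<gamma>\<mu>\<close> moves it out
    of \<open>\<gamma>\<close>. The remaining arrows agree by \<open>pentagon_inv\<close>.\<close>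
  have bal: "pairing (mod_fun M \<star> mod_fun N) D T ((X \<otimes> Y) \<otimes> Z) V
          (cpr (mod_fun M) (mod_fun N) (X \<otimes> Y) Z (rdot B M X Y m b) n) d
        = pairing (mod_fun M \<star> mod_fun N) D T ((X \<otimes> Y) \<otimes> Z) V
          (FA (mod_fun M \<star> mod_fun N) (Assoc_inv X Y Z)
            (cpr (mod_fun M) (mod_fun N) X (Y \<otimes> Z) m (ldot B N Y Z b n))) d"
    if "X \<in> Obj C" "Y \<in> Obj C" "Z \<in> Obj C" "V \<in> Obj C"
      "m \<in> FO (mod_fun M) X" "b \<in> FO (mon_fun B) Y" "n \<in> FO (mod_fun N) Z" "d \<in> FO D V"
    for X Y Z V m b n d
    using that F c' by (simp add: TP p arr_simps \<gamma>\<mu> \<delta>\<mu> fun_simps cpr_simps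
        pairing_simps[OF is_pairing_pairing[OF T]] pentagon_inv assoc_cmp)
  show "nat_trans (bal_fun B M N \<star> D) H S"
    unfolding S by (rule *(1)[OF bal])
  show "pairing (bal_fun B M N) D S (X \<otimes> Y) Z (bpr B M N X Y m n) d
      = FA H (Assoc_inv X Y Z) (pairing (mod_fun M) H' \<delta> X (Y \<otimes> Z) m (pairing (mod_fun N) D \<gamma> Y Z n d))"
    if a: "X \<in> Obj C" "Y \<in> Obj C" "Z \<in> Obj C" "m \<in> FO (mod_fun M) X" "n \<in> FO (mod_fun N) Y" "d \<in> FO D Z"
    for X Y Z m n d
    unfolding S pairing_def[of "mod_fun M" "mod_fun N"]
    using *(2)[OF bal, of "X \<otimes> Y" Z "cpr (mod_fun M) (mod_fun N) X Y m n" d] TP[OF a] a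
    by (simp add: ten_obj cpr_simps)
qed

lemma mod_comp_ract:
  assumes M: "biaction A B M" and N: "biaction B D N"
  shows "nat_trans (bal_fun B M N \<star> mon_fun D) (bal_fun B M N) (ract (mod_comp A B D M N))"
    and "\<And>X Y Z m n d. X \<in> Obj C \<Longrightarrow> Y \<in> Obj C \<Longrightarrow> Z \<in> Obj C
      \<Longrightarrow> m \<in> FO (mod_fun M) X \<Longrightarrow> n \<in> FO (mod_fun N) Y \<Longrightarrow> d \<in> FO (mon_fun D) Z
      \<Longrightarrow> rdot D (mod_comp A B D M N) (X \<otimes> Y) Z (bpr B M N X Y m n) d
        = FA (bal_fun B M N) (Assoc_inv X Y Z) (bpr B M N X (Y \<otimes> Z) m (rdot D N Y Z n d))"
proof -
  note c = biaction_composable[OF M N]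
  note * = induced_bal_assoc[OF c biactionD(2,3)[OF N] bal_functor[OF c] biactionD(5)[OF N]
      bal_nat_trans[OF c] biactionD(4)[OF N] biaction_law[OF N] bpr_balanced[OF c]]
  show "nat_trans (bal_fun B M N \<star> mon_fun D) (bal_fun B M N) (ract (mod_comp A B D M N))"
    using *(1) by (simp add: mod_comp_def)
  show "rdot D (mod_comp A B D M N) (X \<otimes> Y) Z (bpr B M N X Y m n) d
        = FA (bal_fun B M N) (Assoc_inv X Y Z) (bpr B M N X (Y \<otimes> Z) m (rdot D N Y Z n d))"
    if "X \<in> Obj C" "Y \<in> Obj C" "Z \<in> Obj C" "m \<in> FO (mod_fun M) X" "n \<in> FO (mod_fun N) Y" "d \<in> FO (mon_fun D) Z"
    for X Y Z m n d
    using that by (simp add: mod_comp_def *(2))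
qed

text \<open>The left action rebrackets in the opposite direction and has the quotient in the second
  factor, so it is obtained from \<open>induced_conv_bal\<close>. Balancing uses that the left
  action on \<open>M\<close> commutes with the right action of \<open>B\<close>.\<close>

lemma mod_comp_lact:
  assumes M: "biaction A B M" and N: "biaction B D N"
  shows "nat_trans (mon_fun A \<star> bal_fun B M N) (bal_fun B M N) (lact (mod_comp A B D M N))"
    and "\<And>X Y Z a m n. X \<in> Obj C \<Longrightarrow> Y \<in> Obj C \<Longrightarrow> Z \<in> Obj C
      \<Longrightarrow> a \<in> FO (mon_fun A) X \<Longrightarrow> m \<in> FO (mod_fun M) Y \<Longrightarrow> n \<in> FO (mod_fun N) Z
      \<Longrightarrow> ldot A (mod_comp A B D M N) X (Y \<otimes> Z) a (bpr B M N Y Z m n)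
        = FA (bal_fun B M N) (Assoc C X Y Z) (bpr B M N (X \<otimes> Y) Z (ldot A M X Y a m) n)"
proof -
  note c = biaction_composable[OF M N]
  note F = biactionD[OF M] biactionD[OF N] bal_functor[OF c]
  note p = pairing_simps[OF is_pairing_pairing[OF F(4)]] pairing_simps[OF is_pairing_pairing[OF F(5)]]
    pairing_simps[OF is_pairing_pairing[OF F(9)]] bpr_simps[OF c]
  let ?A = "mon_fun A" and ?M = "mod_fun M" and ?N = "mod_fun N" and ?H = "bal_fun B M N"
  define T where "T = (\<lambda>U z. bal_cl B M N U (conv_map ?M ?N (lact M) idt U (conv_assoc_inv ?A ?M ?N U z)))"
  have T: "nat_trans (?A \<star> (?M \<star> ?N)) ?H T"
    unfolding T_def
    by (intro nat_trans_comp[OF _ bal_nat_trans[OF c]] nat_trans_comp[OF conv_assoc_inv_nat_trans]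
        conv_map_nat_trans nat_trans_idt F conv_functor)
  have TP: "pairing ?A (?M \<star> ?N) T X (Y \<otimes> Z) a (cpr ?M ?N Y Z m n)
    = FA ?H (Assoc C X Y Z) (bpr B M N (X \<otimes> Y) Z (ldot A M X Y a m) n)"
    if a: "X \<in> Obj C" "Y \<in> Obj C" "Z \<in> Obj C" "a \<in> FO ?A X" "m \<in> FO ?M Y" "n \<in> FO ?N Z"
    for X Y Z a m n
  proof (rule pairing_eq[where H = ?H])
    fix f U assume "f \<in> hom C (X \<otimes> (Y \<otimes> Z)) U"
    then show "T U (FA (?A \<star> (?M \<star> ?N)) f (cpr ?A (?M \<star> ?N) X (Y \<otimes> Z) a (cpr ?M ?N Y Z m n)))
      = FA ?H f (FA ?H (Assoc C X Y Z) (bpr B M N (X \<otimes> Y) Z (ldot A M X Y a m) n))"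
      unfolding T_def using a by (intro conv_assoc_inv_pairing[OF F(1,3,8,11,4) bal_nat_trans[OF c]])
  qed (use a F in \<open>simp_all add: ten_obj cpr_simps fun_simps arr_simps p\<close>)
  have S: "lact (mod_comp A B D M N) = (\<lambda>U. induced (\<lambda>(X, Y, f, a, q). induced (\<lambda>c.
      T U (conv_cl ?A (?M \<star> ?N) U (X, Y, f, a, c))) q))"
    unfolding T_def by (simp add: mod_comp_def)
  have bal: "pairing ?A (?M \<star> ?N) T V ((X \<otimes> Y) \<otimes> Z) a (cpr ?M ?N (X \<otimes> Y) Z (rdot B M X Y m b) n)
      = pairing ?A (?M \<star> ?N) T V ((X \<otimes> Y) \<otimes> Z) a
        (FA (?M \<star> ?N) (Assoc_inv X Y Z) (cpr ?M ?N X (Y \<otimes> Z) m (ldot B N Y Z b n)))"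
    if x: "X \<in> Obj C" "Y \<in> Obj C" "Z \<in> Obj C" "V \<in> Obj C"
      "m \<in> FO ?M X" "b \<in> FO (mon_fun B) Y" "n \<in> FO ?N Z" "a \<in> FO ?A V"
    for X Y Z V m b n a
  proof -
    \<comment> \<open>Writing actions as products, \<open>(a m) \<otimes> (b n)\<close> is
      \<open>((a m) b) \<otimes> n\<close> by balancing, and then
      \<open>(a (m b)) \<otimes> n\<close> by compatibility of the actions on \<open>M\<close>, each
      time up to associators.\<close>
    have "bpr B M N (V \<otimes> X) (Y \<otimes> Z) (ldot A M V X a m) (ldot B N Y Z b n)
      = FA ?H (Assoc C (V \<otimes> X) Y Z) (bpr B M N ((V \<otimes> X) \<otimes> Y) Z (rdot B M (V \<otimes> X) Y (ldot A M V X a m) b) n)"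
      using x F by (simp add: bpr_balanced[OF c] fun_simps p cmp_simps)
    also have "\<dots> = FA ?H (Assoc C (V \<otimes> X) Y Z \<cdot> (Assoc_inv V X Y \<odot> Idn C Z))
        (bpr B M N (V \<otimes> (X \<otimes> Y)) Z (ldot A M V (X \<otimes> Y) a (rdot B M X Y m b)) n)"
      using x F by (simp add: biaction_law[OF M] fun_simps p cmp_simps)
    finally show ?thesis
      using x F by (simp add: TP p arr_simps fun_simps cpr_simps
        pairing_simps[OF is_pairing_pairing[OF T]] pentagon_mixed[of V X Y Z] assoc_cmp)
  qed
  note * = induced_conv_bal[OF c F(1,11) T bal]
  show "nat_trans (?A \<star> ?H) ?H (lact (mod_comp A B D M N))"
    unfolding S by (rule *(1))
  show "ldot A (mod_comp A B D M N) X (Y \<otimes> Z) a (bpr B M N Y Z m n)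
        = FA ?H (Assoc C X Y Z) (bpr B M N (X \<otimes> Y) Z (ldot A M X Y a m) n)"
    if a: "X \<in> Obj C" "Y \<in> Obj C" "Z \<in> Obj C" "a \<in> FO ?A X" "m \<in> FO ?M Y" "n \<in> FO ?N Z"
    for X Y Z a m n
    unfolding S mod_comp_fun pairing_def[of ?M ?N]
    using *(2)[of "Y \<otimes> Z" X "cpr ?M ?N Y Z m n" a] TP[OF a] a
    by (simp add: ten_obj cpr_simps pairing_def[of ?M ?N])
qed

lemma composable_mod_comp_right:
  "composable B M N \<Longrightarrow> biaction B D N \<Longrightarrow> biaction D E P \<Longrightarrow> composable B M (mod_comp B D E N P)"
  using mod_comp_lact(1) bal_functor[OF biaction_composable]
  by (auto simp: composable_def mod_comp_fun)

lemma composable_mod_comp_left: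
  "biaction A B M \<Longrightarrow> biaction B D N \<Longrightarrow> composable D N P \<Longrightarrow> composable D (mod_comp A B D M N) P"
  using mod_comp_ract(1) bal_functor[OF biaction_composable]
  by (auto simp: composable_def mod_comp_fun)

text \<open>Three layers of \<open>induced\<close> have to be evaluated. The inner two form
  \<open>S\<close> and are covered by \<open>induced_bal_assoc\<close>; the outermost, the balanced
  class over \<open>D\<close>, then requires \<open>S\<close> itself to be balanced over
  \<open>D\<close>.\<close>

lemma mod_assoc_bpr:
  assumes M: "biaction A B M" and N: "biaction B D N" and P: "biaction D E P"
    and a: "X \<in> Obj C" "Y \<in> Obj C" "Z \<in> Obj C" "f \<in> hom C ((X \<otimes> Y) \<otimes> Z) U"
    "m \<in> FO (mod_fun M) X" "n \<in> FO (mod_fun N) Y" "p \<in> FO (mod_fun P) Z"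
  shows "mod_assoc B D E M N P U (FA (bal_fun D (mod_comp A B D M N) P) f
      (bpr D (mod_comp A B D M N) P (X \<otimes> Y) Z (bpr B M N X Y m n) p))
    = FA (bal_fun B M (mod_comp B D E N P)) f (FA (bal_fun B M (mod_comp B D E N P)) (Assoc_inv X Y Z)
        (bpr B M (mod_comp B D E N P) X (Y \<otimes> Z) m (bpr D N P Y Z n p)))"
proof -
  let ?NP = "mod_comp B D E N P" and ?MN = "mod_comp A B D M N"
  let ?H = "bal_fun B M ?NP"
  note cMN = biaction_composable[OF M N] and cNP = biaction_composable[OF N P]
  note c1 = composable_mod_comp_left[OF M N cNP]
  note c2 = composable_mod_comp_right[OF cMN N P]
  note F = biactionD[OF M] biactionD[OF N] biactionD[OF P]
    bal_functor[OF cMN] bal_functor[OF cNP] bal_functor[OF c1] bal_functor[OF c2]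
  note p = bpr_simps[OF cMN] bpr_simps[OF cNP] bpr_simps[OF c2, unfolded mod_comp_fun]
    pairing_simps[OF is_pairing_pairing[OF F(5)]] pairing_simps[OF is_pairing_pairing[OF F(9)]]
    pairing_simps[OF is_pairing_pairing[OF F(10)]] pairing_simps[OF is_pairing_pairing[OF F(14)]]
    pairing_simps[OF is_pairing_pairing[OF mod_comp_ract(1)[OF M N]]]
  define S where "S = (\<lambda>U. induced (\<lambda>(X, Y, f, q, p). induced (\<lambda>c.
       bal_cl B M ?NP U
         (conv_map (mod_fun M) (bal_fun D N P) idt (bal_cl D N P) U
           (conv_assoc (mod_fun M) (mod_fun N) (mod_fun P) U
             (conv_cl (mod_fun M \<star> mod_fun N) (mod_fun P) U (X, Y, f, c, p))))) q))"
  \<comment> \<open>The condition \<open>\<gamma>\<mu>\<close> of \<open>induced_bal_assoc\<close>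
    when \<open>\<mu>\<close> is the left action of \<open>B\<close> on
    \<open>N *\<^sub>D P\<close>: the formula for that action, solved for the tensor of
    \<open>b n\<close> with \<open>d\<close>.\<close>
  have law: "bpr D N P (Y \<otimes> Z) V (ldot B N Y Z b n) d
      = FA (bal_fun D N P) (Assoc_inv Y Z V) (ldot B ?NP Y (Z \<otimes> V) b (bpr D N P Z V n d))"
    if "Y \<in> Obj C" "Z \<in> Obj C" "V \<in> Obj C" "b \<in> FO (mon_fun B) Y" "n \<in> FO (mod_fun N) Z"
      "d \<in> FO (mod_fun P) V" for Y Z V b n d
    using that F by (simp add: mod_comp_lact(2)[OF N P] fun_simps p cmp_simps)
  note * = induced_bal_assoc[OF cMN F(13,17,19) bal_nat_trans[OF cNP]
      bal_nat_trans[OF c2, unfolded mod_comp_fun] mod_comp_lact(1)[OF N P]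
      law[unfolded mod_comp_fun] bpr_balanced[OF c2, unfolded mod_comp_fun], folded S_def]
  have S: "nat_trans (bal_fun B M N \<star> mod_fun P) ?H S" by (rule *(1))
  note pS = pairing_simps[OF is_pairing_pairing[OF S]]
  have SP: "pairing (bal_fun B M N) (mod_fun P) S (X \<otimes> Y) Z (bpr B M N X Y m n) p
      = FA ?H (Assoc_inv X Y Z) (bpr B M ?NP X (Y \<otimes> Z) m (bpr D N P Y Z n p))"
    if "X \<in> Obj C" "Y \<in> Obj C" "Z \<in> Obj C" "m \<in> FO (mod_fun M) X" "n \<in> FO (mod_fun N) Y"
      "p \<in> FO (mod_fun P) Z" for X Y Z m n p
    using that by (simp add: *(2) mod_comp_fun)
  \<comment> \<open>Once \<open>q\<close> is written as a transported \<open>m \<otimes> n\<close>,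
    the scalar \<open>d\<close> acts on \<open>n\<close>, and it crosses to \<open>p\<close> inside
    \<open>N *\<^sub>D P\<close>; \<open>pentagon_inv\<close> matches the arrows.\<close>
  have bal: "pairing (bal_fun B M N) (mod_fun P) S (W \<otimes> Y) Z (rdot D ?MN W Y q d) p
      = FA ?H (Assoc_inv W Y Z) (pairing (bal_fun B M N) (mod_fun P) S W (Y \<otimes> Z) q (ldot D P Y Z d p))"
    if w: "W \<in> Obj C" "Y \<in> Obj C" "Z \<in> Obj C" "q \<in> FO (bal_fun B M N) W" "d \<in> FO (mon_fun D) Y"
      "p \<in> FO (mod_fun P) Z" for W Y Z q d p
    using cMN w(4)
  proof (rule bal_cases)
    fix X1 X2 g m n
    assume x: "X1 \<in> Obj C" "X2 \<in> Obj C" "g \<in> hom C (X1 \<otimes> X2) W" "m \<in> FO (mod_fun M) X1"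
      "n \<in> FO (mod_fun N) X2" and q: "q = FA (bal_fun B M N) g (bpr B M N X1 X2 m n)"
    show ?thesis
      using w x F unfolding q mod_comp_fun
      by (simp add: p mod_comp_ract(2)[OF M N, unfolded mod_comp_fun] pS SP[unfolded mod_comp_fun] fun_simps bpr_balanced[OF cNP]
          arr_simps assoc_cmp interchange interchange_tail idn_left idn_right pentagon_inv
          assoc_inv_natural_left_tail ten_idn)
  qed
  have FM: "FO (bal_fun D ?MN P) U = bal_cl D ?MN P U ` FO (bal_fun B M N \<star> mod_fun P) U" for U
    by (simp add: bal_fun_FO mod_comp_fun)
  let ?t = "FA (bal_fun B M N \<star> mod_fun P) f (cpr (bal_fun B M N) (mod_fun P) (X \<otimes> Y) Z (bpr B M N X Y m n) p)"
  have "bal_cl D ?MN P U ?t = FA (bal_fun D ?MN P) f (bpr D ?MN P (X \<otimes> Y) Z (bpr B M N X Y m n) p)"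
    using nat_trans_conv[OF bal_nat_trans[OF c1] _ _ a(4)] a by (simp add: mod_comp_fun p ten_obj)
  moreover have "mod_assoc B D E M N P U (bal_cl D ?MN P U ?t) = induced (S U) (bal_cl D ?MN P U ?t)"
    by (simp only: mod_assoc_def S_def)
  moreover have "induced (S U) (bal_cl D ?MN P U ?t) = S U ?t"
  proof (rule induced_bal[OF c1])
    fix X Y Z f m b n
    assume x: "X \<in> Obj C" "Y \<in> Obj C" "Z \<in> Obj C" "f \<in> hom C ((X \<otimes> Y) \<otimes> Z) U"
      "m \<in> FO (mod_fun ?MN) X" "b \<in> FO (mon_fun D) Y" "n \<in> FO (mod_fun P) Z"
    let ?c = "cpr (bal_fun B M N) (mod_fun P)"
    have m: "m \<in> FO (bal_fun B M N) X" using x(5) by (simp add: mod_comp_fun)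
    have r: "rdot D ?MN X Y m b \<in> FO (bal_fun B M N) (X \<otimes> Y)"
      using x m by (simp add: p mod_comp_fun)
    have fa: "f \<cdot> Assoc_inv X Y Z \<in> hom C (X \<otimes> Y \<otimes> Z) U" using x by (simp add: arr_simps)
    have "S U (FA (bal_fun B M N \<star> mod_fun P) f (?c (X \<otimes> Y) Z (rdot D ?MN X Y m b) n))
      = FA ?H f (FA ?H (Assoc_inv X Y Z) (pairing (bal_fun B M N) (mod_fun P) S X (Y \<otimes> Z) m (ldot D P Y Z b n)))"
      using x m r by (simp add: nat_trans_conv[OF S] ten_obj bal)
    also have "\<dots> = FA ?H (f \<cdot> Assoc_inv X Y Z) (pairing (bal_fun B M N) (mod_fun P) S X (Y \<otimes> Z) m (ldot D P Y Z b n))"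
      using x m F by (simp add: fun_simps pS p arr_simps)
    also have "\<dots> = S U (FA (bal_fun B M N \<star> mod_fun P) (f \<cdot> Assoc_inv X Y Z) (?c X (Y \<otimes> Z) m (ldot D P Y Z b n)))"
      using x m by (simp add: nat_trans_conv[OF S _ _ fa] ten_obj p)
    also have "FA (bal_fun B M N \<star> mod_fun P) (f \<cdot> Assoc_inv X Y Z) (?c X (Y \<otimes> Z) m (ldot D P Y Z b n))
      = FA (bal_fun B M N \<star> mod_fun P) f (FA (bal_fun B M N \<star> mod_fun P) (Assoc_inv X Y Z) (?c X (Y \<otimes> Z) m (ldot D P Y Z b n)))"
      using x m by (simp add: fun_simps conv_functor arr_simps cpr_simps p)
    finally show "S U (FA (mod_fun ?MN \<star> mod_fun P) f (cpr (mod_fun ?MN) (mod_fun P) (X \<otimes> Y) Z (rdot D ?MN X Y m b) n))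
      = S U (FA (mod_fun ?MN \<star> mod_fun P) f (FA (mod_fun ?MN \<star> mod_fun P) (Assoc_inv X Y Z)
          (cpr (mod_fun ?MN) (mod_fun P) X (Y \<otimes> Z) m (ldot D P Y Z b n))))"
      by (simp only: mod_comp_fun)
  qed
  ultimately show ?thesis
    using nat_trans_conv[OF S _ _ a(4)] a SP by (simp add: p ten_obj)
qed

end

subsection \<open>Modules over monoids and the retraction\<close>

context monoidal_category
begin

text \<open>The universal property of the balanced tensor product, in evaluated form: a
  transformation out of \<open>M \<star> N\<close> whose pairing is balanced descends to the
  quotient.\<close>

lemma induced_bal_pairing:
  assumes c: "composable B M N" and H: "is_functor H" and \<sigma>: "nat_trans (mod_fun M \<star> mod_fun N) H \<sigma>"
    and bal: "\<And>X Y Z m b n. X \<in> Obj C \<Longrightarrow> Y \<in> Obj C \<Longrightarrow> Z \<in> Obj C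
      \<Longrightarrow> m \<in> FO (mod_fun M) X \<Longrightarrow> b \<in> FO (mon_fun B) Y \<Longrightarrow> n \<in> FO (mod_fun N) Z
      \<Longrightarrow> pairing (mod_fun M) (mod_fun N) \<sigma> (X \<otimes> Y) Z (rdot B M X Y m b) n
        = FA H (Assoc_inv X Y Z) (pairing (mod_fun M) (mod_fun N) \<sigma> X (Y \<otimes> Z) m (ldot B N Y Z b n))"
    and a: "X \<in> Obj C" "Y \<in> Obj C" "f \<in> hom C (X \<otimes> Y) U" "m \<in> FO (mod_fun M) X" "n \<in> FO (mod_fun N) Y"
  shows "induced (\<sigma> U) (FA (bal_fun B M N) f (bpr B M N X Y m n))
    = FA H f (pairing (mod_fun M) (mod_fun N) \<sigma> X Y m n)"
proof -
  note F = composableD[OF c]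
  note p = pairing_simps[OF is_pairing_pairing[OF F(4)]] pairing_simps[OF is_pairing_pairing[OF F(5)]]
    pairing_simps[OF is_pairing_pairing[OF \<sigma>]]
  let ?F = "mod_fun M \<star> mod_fun N" and ?c = "cpr (mod_fun M) (mod_fun N)"
  have "induced (\<sigma> U) (bal_cl B M N U (FA ?F f (?c X Y m n))) = \<sigma> U (FA ?F f (?c X Y m n))"
  proof (rule induced_bal[OF c])
    fix X Y Z f m b n
    assume x: "X \<in> Obj C" "Y \<in> Obj C" "Z \<in> Obj C" "f \<in> hom C ((X \<otimes> Y) \<otimes> Z) U"
      "m \<in> FO (mod_fun M) X" "b \<in> FO (mon_fun B) Y" "n \<in> FO (mod_fun N) Z"
    have fa: "f \<cdot> Assoc_inv X Y Z \<in> hom C (X \<otimes> Y \<otimes> Z) U" using x by (simp add: arr_simps)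
    have e: "FA ?F f (FA ?F (Assoc_inv X Y Z) (?c X (Y \<otimes> Z) m (ldot B N Y Z b n)))
      = FA ?F (f \<cdot> Assoc_inv X Y Z) (?c X (Y \<otimes> Z) m (ldot B N Y Z b n))"
      using x by (simp add: fun_simps conv_functor arr_simps cpr_simps p)
    show "\<sigma> U (FA ?F f (?c (X \<otimes> Y) Z (rdot B M X Y m b) n))
      = \<sigma> U (FA ?F f (FA ?F (Assoc_inv X Y Z) (?c X (Y \<otimes> Z) m (ldot B N Y Z b n))))"
      unfolding e using x fa
      by (simp add: nat_trans_conv[OF \<sigma>] ten_obj p bal) (simp add: fun_simps H p arr_simps)
  qed
  then show ?thesis
    using nat_trans_conv[OF bal_nat_trans[OF c] a] nat_trans_conv[OF \<sigma> a] by simp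
qed

text \<open>Linearity over the middle monoid is what makes the horizontal composite well defined:
  \<open>\<sigma>\<close> has to respect the right action of \<open>B\<close>, \<open>\<tau>\<close>
  the left action.\<close>

lemma hcomp_bpr:
  assumes c: "composable B M N" and c': "composable B M' N'"
    and \<sigma>: "nat_trans (mod_fun M) (mod_fun M') \<sigma>" and \<tau>: "nat_trans (mod_fun N) (mod_fun N') \<tau>"
    and \<sigma>_act: "\<And>X Y m b. X \<in> Obj C \<Longrightarrow> Y \<in> Obj C \<Longrightarrow> m \<in> FO (mod_fun M) X \<Longrightarrow> b \<in> FO (mon_fun B) Y
      \<Longrightarrow> \<sigma> (X \<otimes> Y) (rdot B M X Y m b) = rdot B M' X Y (\<sigma> X m) b"
    and \<tau>_act: "\<And>Y Z b n. Y \<in> Obj C \<Longrightarrow> Z \<in> Obj C \<Longrightarrow> b \<in> FO (mon_fun B) Y \<Longrightarrow> n \<in> FO (mod_fun N) Z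
      \<Longrightarrow> \<tau> (Y \<otimes> Z) (ldot B N Y Z b n) = ldot B N' Y Z b (\<tau> Z n)"
    and a: "X \<in> Obj C" "Y \<in> Obj C" "f \<in> hom C (X \<otimes> Y) U" "m \<in> FO (mod_fun M) X" "n \<in> FO (mod_fun N) Y"
  shows "hcomp B M' N' \<sigma> \<tau> U (FA (bal_fun B M N) f (bpr B M N X Y m n))
    = FA (bal_fun B M' N') f (bpr B M' N' X Y (\<sigma> X m) (\<tau> Y n))"
proof -
  note F = composableD[OF c] and H = bal_functor[OF c']
  note p = pairing_simps[OF is_pairing_pairing[OF F(4)]] pairing_simps[OF is_pairing_pairing[OF F(5)]]
    bpr_simps[OF c'] nat_typ[OF \<sigma>] nat_typ[OF \<tau>]
  define T where "T = (\<lambda>U c. bal_cl B M' N' U (conv_map (mod_fun M') (mod_fun N') \<sigma> \<tau> U c))"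
  have T: "nat_trans (mod_fun M \<star> mod_fun N) (bal_fun B M' N') T"
    unfolding T_def by (rule nat_trans_comp[OF conv_map_nat_trans[OF \<sigma> \<tau> F(1,3)] bal_nat_trans[OF c']])
  have TP: "pairing (mod_fun M) (mod_fun N) T X Y m n = bpr B M' N' X Y (\<sigma> X m) (\<tau> Y n)"
    if x: "X \<in> Obj C" "Y \<in> Obj C" "m \<in> FO (mod_fun M) X" "n \<in> FO (mod_fun N) Y" for X Y m n
    by (rule pairing_eq[OF x _ H])
      (use x in \<open>simp_all add: T_def conv_map_cpr[OF \<sigma> \<tau> F(1,3)] nat_trans_conv[OF bal_nat_trans[OF c']] p\<close>)
  have "hcomp B M' N' \<sigma> \<tau> U = induced (T U)" by (simp add: hcomp_def T_def)
  then show ?thesis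
    using induced_bal_pairing[OF c H T _ a] TP[OF a(1,2,4,5)]
    by (simp add: TP p ten_obj \<sigma>_act \<tau>_act bpr_balanced[OF c'])
qed

section \<open>Laws of monoids and modules on elements\<close>

lemma is_monoidD:
  assumes "is_monoid A"
  shows "is_functor (mon_fun A)" "nat_trans (mon_fun A \<star> mon_fun A) (mon_fun A) (mon_mult A)"
    "nat_trans J (mon_fun A) (mon_unit A)"
  using assms by (auto simp: is_monoid_def)

abbreviation mdot where
  "mdot A \<equiv> pairing (mon_fun A) (mon_fun A) (mon_mult A)"

lemma mdot_assoc:
  assumes "is_monoid A" "X \<in> Obj C" "Y \<in> Obj C" "Z \<in> Obj C"
    "a \<in> FO (mon_fun A) X" "b \<in> FO (mon_fun A) Y" "c \<in> FO (mon_fun A) Z"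
  shows "mdot A (X \<otimes> Y) Z (mdot A X Y a b) c
    = FA (mon_fun A) (Assoc_inv X Y Z) (mdot A X (Y \<otimes> Z) a (mdot A Y Z b c))"
proof -
  note A = is_monoidD[OF assms(1)]
  show ?thesis
    using assms assoc_law_iff[OF A(1,1,1,1,1,1,2,2,2,2)] by (auto simp: is_monoid_def)
qed

lemma mdot_unit:
  assumes "is_monoid A" "X \<in> Obj C" "Y \<in> Obj C" "a \<in> FO (mon_fun A) X" "j \<in> hom C \<I> Y"
  shows "mdot A X Y a (mon_unit A Y j) = FA (mon_fun A) ((Idn C X \<odot> j) \<cdot> inv_arr C (Run C X)) a"
proof -
  note A = is_monoidD[OF assms(1)]
  show ?thesis using assms run_law_iff[OF A(1,1,2,3)] by (auto simp: is_monoid_def)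
qed

text \<open>Needed in both directions: to extract the laws of the given module on elements, and to
  establish \<open>A(K \<otimes> -)\<close> as a right module by computing with elements.\<close>

lemma right_module_iff:
  assumes A: "is_functor (mon_fun A)" "nat_trans (mon_fun A \<star> mon_fun A) (mon_fun A) (mon_mult A)"
    "nat_trans J (mon_fun A) (mon_unit A)"
  shows "right_module A M \<longleftrightarrow> is_functor (mod_fun M) \<and>
    nat_trans (mod_fun M \<star> mon_fun A) (mod_fun M) (ract M) \<and>
    (\<forall>X \<in> Obj C. \<forall>Y \<in> Obj C. \<forall>Z \<in> Obj C.
      \<forall>m \<in> FO (mod_fun M) X. \<forall>a \<in> FO (mon_fun A) Y. \<forall>b \<in> FO (mon_fun A) Z.
      rdot A M (X \<otimes> Y) Z (rdot A M X Y m a) b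
      = FA (mod_fun M) (Assoc_inv X Y Z) (rdot A M X (Y \<otimes> Z) m (mdot A Y Z a b))) \<and>
    (\<forall>X \<in> Obj C. \<forall>Y \<in> Obj C. \<forall>m \<in> FO (mod_fun M) X. \<forall>j \<in> hom C \<I> Y.
      rdot A M X Y m (mon_unit A Y j) = FA (mod_fun M) ((Idn C X \<odot> j) \<cdot> inv_arr C (Run C X)) m)"
proof -
  have "is_functor (mod_fun M) \<Longrightarrow> nat_trans (mod_fun M \<star> mon_fun A) (mod_fun M) (ract M) \<Longrightarrow> ?thesis"
    unfolding right_module_def
    using assoc_law_iff[OF _ A(1,1) _ A(1) _ _ _ A(2), of "mod_fun M" "mod_fun M" "mod_fun M" "ract M" "ract M" "ract M"]
      run_law_iff[OF _ A(1) _ A(3), of "mod_fun M" "ract M"] by simp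
  then show ?thesis unfolding right_module_def by blast
qed

lemma left_module_unit_law:
  assumes "left_module A M" "is_functor (mon_fun A)" "nat_trans J (mon_fun A) (mon_unit A)"
    "X \<in> Obj C" "Y \<in> Obj C" "m \<in> FO (mod_fun M) Y" "j \<in> hom C \<I> X"
  shows "ldot A M X Y (mon_unit A X j) m = FA (mod_fun M) ((j \<odot> Idn C Y) \<cdot> inv_arr C (Lun C Y)) m"
  using assms lun_law[of "mod_fun M" "mon_fun A" "lact M" "mon_unit A" X Y m j]
  by (auto simp: left_module_def)

lemma left_module_assoc_law:
  assumes "left_module A M" and A: "is_functor (mon_fun A)"
    "nat_trans (mon_fun A \<star> mon_fun A) (mon_fun A) (mon_mult A)"
    and "X \<in> Obj C" "Y \<in> Obj C" "Z \<in> Obj C" "a \<in> FO (mon_fun A) X" "b \<in> FO (mon_fun A) Y" "m \<in> FO (mod_fun M) Z"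
  shows "ldot A M (X \<otimes> Y) Z (mdot A X Y a b) m
    = FA (mod_fun M) (Assoc_inv X Y Z) (ldot A M X (Y \<otimes> Z) a (ldot A M Y Z b m))"
proof -
  have M: "is_functor (mod_fun M)" "nat_trans (mon_fun A \<star> mod_fun M) (mod_fun M) (lact M)"
    using assms(1) by (auto simp: left_module_def)
  show ?thesis
    using assms assoc_law_iff[OF A(1,1) M(1) A(1) M(1,1) A(2) M(2,2,2)] by (auto simp: left_module_def)
qed

lemma id_mod_simps:
  "mod_fun (id_mod A) = mon_fun A" "ract (id_mod A) = mon_mult A" "lact (id_mod A) = mon_mult A"
  by (simp_all add: id_mod_def)

text \<open>The left action descends to \<open>A *\<^sub>A M\<close> because its associativity law
  is exactly the balancing condition.\<close>

lemma mod_lun_bpr: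
  assumes M: "left_module A M" and A: "is_functor (mon_fun A)"
    "nat_trans (mon_fun A \<star> mon_fun A) (mon_fun A) (mon_mult A)"
    and a: "X \<in> Obj C" "Y \<in> Obj C" "f \<in> hom C (X \<otimes> Y) U" "a \<in> FO (mon_fun A) X" "m \<in> FO (mod_fun M) Y"
  shows "mod_lun M U (FA (bal_fun A (id_mod A) M) f (bpr A (id_mod A) M X Y a m)) = FA (mod_fun M) f (ldot A M X Y a m)"
proof -
  have F: "is_functor (mod_fun M)" "nat_trans (mon_fun A \<star> mod_fun M) (mod_fun M) (lact M)"
    using M by (auto simp: left_module_def)
  have c: "composable A (id_mod A) M" using A F by (simp add: composable_def id_mod_simps)
  show ?thesis
    unfolding mod_lun_def
    using induced_bal_pairing[OF c F(1), of "lact M" X Y f U a m] a F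
      left_module_assoc_law[OF M A] by (simp add: id_mod_simps)
qed

lemma mod_run_bpr:
  assumes M: "right_module A M" and A: "is_functor (mon_fun A)"
    "nat_trans (mon_fun A \<star> mon_fun A) (mon_fun A) (mon_mult A)" "nat_trans J (mon_fun A) (mon_unit A)"
    and a: "X \<in> Obj C" "Y \<in> Obj C" "f \<in> hom C (X \<otimes> Y) U" "m \<in> FO (mod_fun M) X" "a \<in> FO (mon_fun A) Y"
  shows "mod_run M U (FA (bal_fun A M (id_mod A)) f (bpr A M (id_mod A) X Y m a)) = FA (mod_fun M) f (rdot A M X Y m a)"
proof -
  note F = M[unfolded right_module_iff[OF A]]
  have c: "composable A M (id_mod A)" using A F by (simp add: composable_def id_mod_simps)
  show ?thesis
    unfolding mod_run_def
    using induced_bal_pairing[OF c, of "mod_fun M" "ract M" X Y f U m a] a F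
    by (simp add: id_mod_simps)
qed

text \<open>Inverse form of \<open>run_ten\<close>; it carries the right unit law of
  \<open>A\<close> at \<open>K \<otimes> X\<close> over to the unit law of
  \<open>A(K \<otimes> -)\<close> at \<open>X\<close>.\<close>

lemma assoc_run_inv:
  assumes "X \<in> Obj C" "Y \<in> Obj C"
  shows "Assoc C X Y \<I> \<cdot> inv_arr C (Run C (X \<otimes> Y)) = Idn C X \<odot> inv_arr C (Run C Y)"
proof (rule iso_cancel_left)
  show "iso_arr C (Idn C X \<odot> Run C Y)" using assms by (simp add: arr_simps)
  have "(Idn C X \<odot> Run C Y) \<cdot> Assoc C X Y \<I> \<cdot> inv_arr C (Run C (X \<otimes> Y))
    = ((Idn C X \<odot> Run C Y) \<cdot> Assoc C X Y \<I>) \<cdot> inv_arr C (Run C (X \<otimes> Y))"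
    using assms by (simp add: arr_simps assoc_cmp)
  also have "\<dots> = Idn C (X \<otimes> Y)"
    unfolding run_ten[OF assms] using assms by (simp add: cmp_simps)
  finally show "(Idn C X \<odot> Run C Y) \<cdot> Assoc C X Y \<I> \<cdot> inv_arr C (Run C (X \<otimes> Y))
    = (Idn C X \<odot> Run C Y) \<cdot> (Idn C X \<odot> inv_arr C (Run C Y))"
    using assms by (simp add: cmp_simps)
qed (use assms in \<open>simp_all add: arr_simps\<close>)

text \<open>The arrow identity behind associativity of the action on
  \<open>A(K \<otimes> -)\<close>, with \<open>W\<close> in the role of \<open>K\<close>.\<close>

lemma pentagon_rep:
  assumes "W \<in> Obj C" "X \<in> Obj C" "Y \<in> Obj C" "Z \<in> Obj C"
  shows "Assoc C W (X \<otimes> Y) Z \<cdot> (Assoc C W X Y \<odot> Idn C Z) \<cdot> Assoc_inv (W \<otimes> X) Y Z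
    = (Idn C W \<odot> Assoc_inv X Y Z) \<cdot> Assoc C W X (Y \<otimes> Z)"
  unfolding pentagon_mixed[OF assms] using assms by (simp add: cmp_simps)

section \<open>The right module \<open>A(K \<otimes> -)\<close>\<close>

lemma rep_mod_fun:
  "FO (mod_fun (rep_mod A K)) U = FO (mon_fun A) (K \<otimes> U)"
  "FA (mod_fun (rep_mod A K)) g = FA (mon_fun A) (Idn C K \<odot> g)"
  by (simp_all add: rep_mod_def)

lemma rep_mod_functor:
  assumes "is_functor (mon_fun A)" "K \<in> Obj C"
  shows "is_functor (mod_fun (rep_mod A K))"
  unfolding is_functor_def rep_mod_fun
  using assms by (auto simp: fun_simps cmp_simps)

text \<open>Multiplication in \<open>A\<close> and the associator are natural, hence so is the
  pairing \<open>q\<close>; therefore the action, defined on representatives, descends to the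
  coend.\<close>

lemma rep_mod_ract:
  assumes A: "is_monoid A" and K: "K \<in> Obj C"
  shows "nat_trans (mod_fun (rep_mod A K) \<star> mon_fun A) (mod_fun (rep_mod A K)) (ract (rep_mod A K))"
    and "\<And>X Y a b. X \<in> Obj C \<Longrightarrow> Y \<in> Obj C \<Longrightarrow> a \<in> FO (mon_fun A) (K \<otimes> X) \<Longrightarrow> b \<in> FO (mon_fun A) Y
      \<Longrightarrow> rdot A (rep_mod A K) X Y a b = FA (mon_fun A) (Assoc C K X Y) (mdot A (K \<otimes> X) Y a b)"
proof -
  note F = is_monoidD[OF A] and R = rep_mod_functor[OF is_monoidD(1)[OF A] K]
  note p = pairing_simps[OF is_pairing_pairing[OF F(2)]]
  let ?R = "rep_mod A K"
  define q where "q = (\<lambda>X Y a b. FA (mon_fun A) (Assoc C K X Y) (mdot A (K \<otimes> X) Y a b))"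
  have q: "is_pairing (mod_fun ?R) (mon_fun A) (mod_fun ?R) q"
    unfolding is_pairing_def q_def rep_mod_fun
    using F K by (auto simp: fun_simps p cmp_simps assoc_natural)
  have e: "ract ?R U (FA (mod_fun ?R \<star> mon_fun A) f (cpr (mod_fun ?R) (mon_fun A) X Y a b))
    = FA (mod_fun ?R) f (q X Y a b)"
    if x: "X \<in> Obj C" "Y \<in> Obj C" "f \<in> hom C (X \<otimes> Y) U" "a \<in> FO (mod_fun ?R) X" "b \<in> FO (mon_fun A) Y"
    for X Y f U a b
  proof -
    have "ract ?R U = induced (\<lambda>(X, Y, f, a, b). FA (mon_fun A) ((Idn C K \<odot> f) \<cdot> Assoc C K X Y) (mdot A (K \<otimes> X) Y a b))"
      by (simp add: rep_mod_def pairing_def cpr_def)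
    then show ?thesis
      by (simp only:) (rule induced_conv_pairing[OF _ q R F(1) R x],
        use F K in \<open>simp add: q_def rep_mod_fun fun_simps arr_simps p\<close>)
  qed
  show "nat_trans (mod_fun ?R \<star> mon_fun A) (mod_fun ?R) (ract ?R)"
    by (rule nat_trans_convI[where p = q]) (use e R q in \<open>auto simp: pairing_typ\<close>)
  show "rdot A ?R X Y a b = FA (mon_fun A) (Assoc C K X Y) (mdot A (K \<otimes> X) Y a b)"
    if x: "X \<in> Obj C" "Y \<in> Obj C" "a \<in> FO (mon_fun A) (K \<otimes> X)" "b \<in> FO (mon_fun A) Y" for X Y a b
  proof -
    have "rdot A ?R X Y a b = q X Y a b"
      by (rule pairing_eq[where H = "mod_fun ?R"]) (use x e R pairing_typ[OF q, of X Y a b] in \<open>auto simp: rep_mod_fun(1)\<close>)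
    then show ?thesis by (simp add: q_def)
  qed
qed

text \<open>Both laws are those of \<open>A\<close> at \<open>K \<otimes> X\<close>, transported
  along associators: associativity by \<open>pentagon_rep\<close>, the unit law by
  \<open>assoc_run_inv\<close>.\<close>

lemma rep_mod_right_module:
  assumes A: "is_monoid A" and K: "K \<in> Obj C"
  shows "right_module A (rep_mod A K)"
  unfolding right_module_iff[OF is_monoidD[OF A]]
proof (intro conjI ballI)
  note F = is_monoidD[OF A]
  note p = pairing_simps[OF is_pairing_pairing[OF F(2)]]
  let ?R = "rep_mod A K"
  show "is_functor (mod_fun ?R)" using rep_mod_functor F K by blast
  show "nat_trans (mod_fun ?R \<star> mon_fun A) (mod_fun ?R) (ract ?R)" using rep_mod_ract[OF A K] by blast
  fix X Y assume XY: "X \<in> Obj C" "Y \<in> Obj C"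
  fix m assume "m \<in> FO (mod_fun ?R) X"
  then have m: "m \<in> FO (mon_fun A) (K \<otimes> X)" by (simp add: rep_mod_fun)
  show "rdot A ?R X Y m (mon_unit A Y j) = FA (mod_fun ?R) ((Idn C X \<odot> j) \<cdot> inv_arr C (Run C X)) m"
    if j: "j \<in> hom C \<I> Y" for j
  proof -
    have u: "mon_unit A Y j \<in> FO (mon_fun A) Y" using nat_typ[OF F(3) XY(2)] j by (simp add: J_simps)
    have n: "Assoc C K X Y \<cdot> (Idn C (K \<otimes> X) \<odot> j) \<cdot> inv_arr C (Run C (K \<otimes> X))
      = Idn C K \<odot> ((Idn C X \<odot> j) \<cdot> inv_arr C (Run C X))"
      using assoc_natural_tail[of "Idn C K" "Idn C X" j K X Y "inv_arr C (Run C (K \<otimes> X))"] XY K j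
      by (simp add: cmp_simps assoc_run_inv)
    show ?thesis
      using XY K m j u F
      by (simp add: rep_mod_ract(2)[OF A K] rep_mod_fun mdot_unit[OF A] ten_obj)
        (simp add: fun_simps arr_simps n)
  qed
  fix Z a b assume x: "Z \<in> Obj C" "a \<in> FO (mon_fun A) Y" "b \<in> FO (mon_fun A) Z"
  show "rdot A ?R (X \<otimes> Y) Z (rdot A ?R X Y m a) b
    = FA (mod_fun ?R) (Assoc_inv X Y Z) (rdot A ?R X (Y \<otimes> Z) m (mdot A Y Z a b))"
    using x XY K m F
    by (simp add: rep_mod_ract(2)[OF A K] rep_mod_fun fun_simps arr_simps p mdot_assoc[OF A]
        assoc_cmp pentagon_rep)
qed

section \<open>Module maps on elements and the retraction\<close>

lemma hom_rdot:
  assumes "is_functor (mon_fun B)" "is_functor (mod_fun M)" "is_functor (mod_fun N)"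
    and "nat_trans (mod_fun M \<star> mon_fun B) (mod_fun M) (ract M)"
    and "nat_trans (mod_fun N \<star> mon_fun B) (mod_fun N) (ract N)"
  shows "right_module_hom B M N \<sigma> \<longleftrightarrow> nat_trans (mod_fun M) (mod_fun N) \<sigma> \<and>
    (\<forall>X \<in> Obj C. \<forall>Y \<in> Obj C. \<forall>m \<in> FO (mod_fun M) X. \<forall>b \<in> FO (mon_fun B) Y.
      \<sigma> (X \<otimes> Y) (rdot B M X Y m b) = rdot B N X Y (\<sigma> X m) b)"
  unfolding right_module_hom_def
  using hom_law_iff[OF assms(2,1,2,3,4,5) _ nat_trans_idt[OF assms(1)], of \<sigma> \<sigma>]
  by (auto simp: idt_def)

lemma hom_ldot:
  assumes "is_functor (mon_fun A)" "is_functor (mod_fun M)" "is_functor (mod_fun N)"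
    and "nat_trans (mon_fun A \<star> mod_fun M) (mod_fun M) (lact M)"
    and "nat_trans (mon_fun A \<star> mod_fun N) (mod_fun N) (lact N)"
    and "two_cell A B M N \<sigma>" and "X \<in> Obj C" "Y \<in> Obj C" "a \<in> FO (mon_fun A) X" "m \<in> FO (mod_fun M) Y"
  shows "\<sigma> (X \<otimes> Y) (ldot A M X Y a m) = ldot A N X Y a (\<sigma> Y m)"
proof -
  have \<sigma>: "nat_trans (mod_fun M) (mod_fun N) \<sigma>"
    and l: "\<forall>U \<in> Obj C. \<forall>z \<in> FO (mon_fun A \<star> mod_fun M) U.
        \<sigma> U (lact M U z) = lact N U (conv_map (mon_fun A) (mod_fun N) idt \<sigma> U z)"
    using assms(6) by (auto simp: two_cell_def right_module_hom_def)
  from l[unfolded hom_law_iff[OF assms(1,2,2,3,4,5) nat_trans_idt[OF assms(1)] \<sigma> \<sigma>]] assms(7-)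
  show ?thesis by (simp add: idt_def)
qed

lemma unit_monoid_simps:
  "mon_fun unit_monoid = J" "mon_mult unit_monoid = conv_lun J" "mon_unit unit_monoid = idt"
  by (simp_all add: unit_monoid_def)

lemma retract_of_rep_mod:
  fixes A :: "('o, 'a, 'b) fmonoid" and M :: "('o, 'a, 'b, 'x, 'a) bimod"
  assumes A: "is_monoid A" and M: "M \<in> cauchy_completion TYPE('n) A"
  shows "\<exists>K \<in> Obj C. right_module_retract A M (rep_mod A K)"
proof -
  let ?J = "unit_monoid"
  from M obtain N :: "('o, 'a, 'a, 'n, 'b) bimod" and \<eta> \<epsilon>
    where M: "bimodule ?J A M" and N: "bimodule A ?J N" and adj: "adjunction ?J A M N \<eta> \<epsilon>"
    unfolding cauchy_completion_def by blast
  note FA = is_monoidD[OF A]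
  have FJ: "is_functor (mon_fun ?J)" "nat_trans (mon_fun ?J \<star> mon_fun ?J) (mon_fun ?J) (mon_mult ?J)"
    "nat_trans J (mon_fun ?J) (mon_unit ?J)"
    by (simp_all add: unit_monoid_simps J_functor conv_lun_nat_trans nat_trans_idt)
  note bM = bimodule_biaction[OF M FJ(1) FA(1)] and bN = bimodule_biaction[OF N FA(1) FJ(1)]
  have lM: "left_module ?J M" and rM: "right_module A M" using M by (auto simp: bimodule_def)
  note rM' = rM[unfolded right_module_iff[OF FA]]
  let ?MN = "mod_comp ?J A ?J M N" and ?NM = "mod_comp A ?J A N M"
  have \<eta>: "two_cell ?J ?J (id_mod ?J) ?MN \<eta>" and \<epsilon>: "two_cell A A ?NM (id_mod A) \<epsilon>"
    and tri: "\<And>U z. U \<in> Obj C \<Longrightarrow> z \<in> FO (bal_fun ?J (id_mod ?J) M) U \<Longrightarrow>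
        mod_run M U (hcomp A M (id_mod A) idt \<epsilon> U
          (mod_assoc A ?J A M N M U (hcomp ?J ?MN M \<eta> idt U z))) = mod_lun M U z"
    using adj by (auto simp: adjunction_def)
  note cMN = biaction_composable[OF bM bN] and cNM = biaction_composable[OF bN bM]
  have cJM: "composable ?J (id_mod ?J) M" and cMA: "composable A M (id_mod A)"
    using FA FJ biactionD[OF bM] by (auto simp: composable_def id_mod_simps)
  note cMNM = composable_mod_comp_left[OF bM bN cNM] and cMNM' = composable_mod_comp_right[OF cMN bN bM]
  note bF = biactionD[OF bM] biactionD[OF bN] bal_functor[OF cMN] bal_functor[OF cNM]
  note p = bpr_simps[OF cMN] bpr_simps[OF cNM] bpr_simps[OF cMNM, unfolded mod_comp_fun]
    bpr_simps[OF cMNM', unfolded mod_comp_fun] bpr_simps[OF cJM, unfolded id_mod_simps]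
    pairing_simps[OF is_pairing_pairing[OF bF(5)]] pairing_simps[OF is_pairing_pairing[OF FA(2)]]
  note rNM = mod_comp_ract[OF bN bM] and lNM = mod_comp_lact[OF bN bM]
  have \<epsilon>_nat: "nat_trans (bal_fun ?J N M) (mon_fun A) \<epsilon>"
    and \<eta>_nat: "nat_trans J (bal_fun A M N) \<eta>"
    using \<epsilon> \<eta> by (auto simp: two_cell_def right_module_hom_def mod_comp_fun id_mod_simps unit_monoid_simps)
  \<comment> \<open>Right linearity of \<open>\<epsilon>\<close> will make \<open>s\<close> a module
    map. Left linearity of \<open>\<epsilon>\<close> over \<open>A\<close> and right linearity of
    \<open>\<eta>\<close> over the unit monoid allow the two horizontal composites in the triangle
    identity to be evaluated.\<close>
  have \<epsilon>_r: "\<epsilon> (X \<otimes> Y) (rdot A ?NM X Y m b) = mdot A X Y (\<epsilon> X m) b"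
    if "X \<in> Obj C" "Y \<in> Obj C" "m \<in> FO (bal_fun ?J N M) X" "b \<in> FO (mon_fun A) Y" for X Y m b
    using \<epsilon> that hom_rdot[of A ?NM "id_mod A" \<epsilon>] FA rNM(1) bF
    by (simp add: two_cell_def mod_comp_fun id_mod_simps)
  have \<epsilon>_l: "\<epsilon> (X \<otimes> Y) (ldot A ?NM X Y a m) = ldot A (id_mod A) X Y a (\<epsilon> Y m)"
    if "X \<in> Obj C" "Y \<in> Obj C" "a \<in> FO (mon_fun A) X" "m \<in> FO (mod_fun ?NM) Y" for X Y a m
    by (rule hom_ldot[OF _ _ _ _ _ \<epsilon> that]) (use FA lNM(1) bF in \<open>simp_all add: mod_comp_fun id_mod_simps\<close>)
  have \<eta>_r: "\<eta> (X \<otimes> Y) (rdot ?J (id_mod ?J) X Y m b) = rdot ?J ?MN X Y (\<eta> X m) b"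
    if "X \<in> Obj C" "Y \<in> Obj C" "m \<in> FO (mod_fun (id_mod ?J)) X" "b \<in> FO (mon_fun ?J) Y" for X Y m b
    using \<eta> that hom_rdot[of ?J "id_mod ?J" ?MN \<eta>] FJ mod_comp_ract(1)[OF bM bN] bF
    by (simp add: two_cell_def mod_comp_fun id_mod_simps)
  have i: "Idn C \<I> \<in> FO J \<I>" using idn_hom unt_obj by (simp add: J_simps)
  \<comment> \<open>The object \<open>Y\<close> is the \<open>K\<close> of the conclusion.\<close>
  obtain X Y f m n where o: "X \<in> Obj C" "Y \<in> Obj C" and f: "f \<in> hom C (X \<otimes> Y) \<I>"
    and m: "m \<in> FO (mod_fun M) X" and n: "n \<in> FO (mod_fun N) Y"
    and \<eta>1: "\<eta> \<I> (Idn C \<I>) = FA (bal_fun A M N) f (bpr A M N X Y m n)"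
    using bal_cases[OF cMN nat_typ[OF \<eta>_nat unt_obj i]] by blast
  have f': "f \<in> Arr C" "Dom C f = X \<otimes> Y" "Cod C f = \<I>" using f by (auto simp: hom_iff)
  \<comment> \<open>Since \<open>f\<close> is an arbitrary arrow, \<open>w U\<close> need not be
    invertible. What \<open>r\<close> requires of it is naturality in \<open>U\<close>, for
    naturality of \<open>r\<close>, and stability under tensoring on the right, for right linearity
    of \<open>r\<close>.\<close>
  define w where "w = (\<lambda>U. Lun C U \<cdot> (f \<odot> Idn C U) \<cdot> Assoc_inv X Y U)"
  define s where "s = (\<lambda>U u. \<epsilon> (Y \<otimes> U) (bpr ?J N M Y U n u))"
  define r where "r = (\<lambda>U a. FA (mod_fun M) (w U) (rdot A M X (Y \<otimes> U) m a))"
  have w: "w U \<in> Arr C" "Dom C (w U) = X \<otimes> Y \<otimes> U" "Cod C (w U) = U" if "U \<in> Obj C" for U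
    using that o f' by (simp_all add: w_def arr_simps)
  have w_nat: "w V \<cdot> (Idn C X \<odot> Idn C Y \<odot> g) = g \<cdot> w U" if g: "g \<in> hom C U V" for g U V
  proof -
    have UV: "U \<in> Obj C" "V \<in> Obj C" using g hom_obj by auto
    have "w V \<cdot> (Idn C X \<odot> Idn C Y \<odot> g) = Lun C V \<cdot> (Idn C \<I> \<odot> g) \<cdot> (f \<odot> Idn C U) \<cdot> Assoc_inv X Y U"
      using g UV o f' by (simp add: w_def cmp_simps assoc_inv_natural)
    also have "\<dots> = (Lun C V \<cdot> (Idn C \<I> \<odot> g)) \<cdot> (f \<odot> Idn C U) \<cdot> Assoc_inv X Y U"
      using g UV o f' by (simp add: arr_simps assoc_cmp)
    also have "\<dots> = g \<cdot> w U"
      unfolding lun_nat[OF g] w_def using g UV o f' by (simp add: arr_simps assoc_cmp)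
    finally show ?thesis .
  qed
  \<comment> \<open>The inverse pentagon separates the factor \<open>V\<close> from the rebracketing
    of \<open>X\<close>, \<open>Y\<close>, \<open>U\<close>, and \<open>lun_ten\<close> separates it
    from the left unitor.\<close>
  have w_ten: "w (U \<otimes> V) \<cdot> (Idn C X \<odot> Assoc C Y U V) = (w U \<odot> Idn C V) \<cdot> Assoc_inv X (Y \<otimes> U) V"
    if UV: "U \<in> Obj C" "V \<in> Obj C" for U V
  proof -
    let ?k = "(Assoc_inv X Y U \<odot> Idn C V) \<cdot> Assoc_inv X (Y \<otimes> U) V"
    have "Assoc_inv X Y (U \<otimes> V) \<cdot> (Idn C X \<odot> Assoc C Y U V)
      = Assoc C (X \<otimes> Y) U V \<cdot> (Assoc_inv (X \<otimes> Y) U V \<cdot> Assoc_inv X Y (U \<otimes> V)) \<cdot> (Idn C X \<odot> Assoc C Y U V)"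
      using UV o by (simp add: cmp_simps)
    also have "\<dots> = Assoc C (X \<otimes> Y) U V \<cdot> ?k"
      unfolding pentagon_inv[OF o UV] using UV o by (simp add: cmp_simps)
    finally have "w (U \<otimes> V) \<cdot> (Idn C X \<odot> Assoc C Y U V)
      = Lun C (U \<otimes> V) \<cdot> (f \<odot> Idn C U \<odot> Idn C V) \<cdot> Assoc C (X \<otimes> Y) U V \<cdot> ?k"
      using UV o f' by (simp add: w_def arr_simps assoc_cmp ten_idn)
    also have "\<dots> = Lun C (U \<otimes> V) \<cdot> Assoc C \<I> U V \<cdot> ((f \<odot> Idn C U) \<odot> Idn C V) \<cdot> ?k"
      using UV o f' by (simp add: assoc_natural_tail arr_simps)
    also have "\<dots> = (Lun C (U \<otimes> V) \<cdot> Assoc C \<I> U V) \<cdot> ((f \<odot> Idn C U) \<odot> Idn C V) \<cdot> ?k"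
      using UV o f' by (simp add: arr_simps assoc_cmp)
    also have "\<dots> = (w U \<odot> Idn C V) \<cdot> Assoc_inv X (Y \<otimes> U) V"
      unfolding lun_ten[OF UV] w_def using UV o f' by (simp add: cmp_simps)
    finally show ?thesis .
  qed
  have rs: "r U (s U u) = u" if U: "U \<in> Obj C" and u: "u \<in> FO (mod_fun M) U" for U u
  proof -
    have lun: "Lun C U \<in> hom C (\<I> \<otimes> U) U" using U by (rule lun_hom)
    \<comment> \<open>The tensor of the identity of \<open>\<I>\<close> with \<open>u\<close> lies
      over \<open>\<I> \<otimes> U\<close>; moving it along the left unitor to \<open>U\<close>
      makes \<open>mod_lun\<close> return \<open>u\<close> itself, by the left unit law of
      \<open>M\<close>.\<close>
    let ?z = "FA (bal_fun ?J (id_mod ?J) M) (Lun C U) (bpr ?J (id_mod ?J) M \<I> U (Idn C \<I>) u)"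
    let ?G = "bal_fun A M ?NM"
    have i': "Idn C \<I> \<in> FO (mod_fun (id_mod ?J)) \<I>" using i by (simp add: id_mod_simps unit_monoid_simps)
    have fU: "Lun C U \<cdot> (f \<odot> Idn C U) \<in> hom C ((X \<otimes> Y) \<otimes> U) U"
      and wU: "w U \<in> hom C (X \<otimes> Y \<otimes> U) U" using U o f' w by (simp_all add: arr_simps)
    have idtM: "nat_trans (mod_fun M) (mod_fun M) idt" using bF by (simp add: nat_trans_idt)
    have z: "?z \<in> FO (bal_fun ?J (id_mod ?J) M) U"
      using pairing_typ[OF is_pairing_pairing[OF bal_nat_trans[OF cJM]] unt_obj U i' u] lun
      by (intro fun_typ[OF bal_functor[OF cJM]]) (auto simp: hom_iff)
    have "mod_lun M U ?z = FA (mod_fun M) (Lun C U) (ldot ?J M \<I> U (mon_unit ?J \<I> (Idn C \<I>)) u)"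
      using mod_lun_bpr[OF lM FJ(1,2) unt_obj U lun _ u, of "Idn C \<I>"] i
      by (simp add: unit_monoid_simps idt_def)
    also have "\<dots> = u"
      using U u bF left_module_unit_law[OF lM FJ(1,3) unt_obj U u idn_hom[OF unt_obj]]
      by (simp add: fun_simps cmp_simps)
    finally have R: "mod_lun M U ?z = u" .
    \<comment> \<open>The other side of the triangle identity, followed on elements:
      \<open>\<eta>\<close> replaces the identity of \<open>\<I>\<close> by
      \<open>m \<otimes> n\<close> transported along \<open>f\<close>, the constraint rebrackets
      \<open>(m \<otimes> n) \<otimes> u\<close> as \<open>m \<otimes> (n \<otimes> u)\<close>,
      \<open>\<epsilon>\<close> turns \<open>n \<otimes> u\<close> into \<open>s U u\<close>, and
      the action on \<open>m\<close> gives \<open>r U (s U u)\<close>. The arrows collected on the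
      way compose to \<open>w U\<close>.\<close>
    have "hcomp ?J ?MN M \<eta> idt U ?z = FA (bal_fun ?J ?MN M) (Lun C U) (bpr ?J ?MN M \<I> U (\<eta> \<I> (Idn C \<I>)) u)"
      using hcomp_bpr[OF cJM cMNM _ idtM \<eta>_r _ unt_obj U lun i' u] \<eta>_nat
      by (simp add: id_mod_simps unit_monoid_simps mod_comp_fun idt_def)
    also have "\<dots> = FA (bal_fun ?J ?MN M) (Lun C U \<cdot> (f \<odot> Idn C U)) (bpr ?J ?MN M (X \<otimes> Y) U (bpr A M N X Y m n) u)"
      unfolding \<eta>1 using U u o f' m n bF
      by (simp add: p mod_comp_fun fun_simps bal_functor[OF cMNM] arr_simps)
    finally have "mod_assoc A ?J A M N M U (hcomp ?J ?MN M \<eta> idt U ?z)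
      = FA ?G (Lun C U \<cdot> (f \<odot> Idn C U)) (FA ?G (Assoc_inv X Y U) (bpr A M ?NM X (Y \<otimes> U) m (bpr ?J N M Y U n u)))"
      using mod_assoc_bpr[OF bM bN bM o U fU m n u] by simp
    also have "\<dots> = FA ?G (w U) (bpr A M ?NM X (Y \<otimes> U) m (bpr ?J N M Y U n u))"
      using U u o f' m n bF by (simp add: p mod_comp_fun fun_simps bal_functor[OF cMNM'] arr_simps assoc_cmp w_def)
    finally have "hcomp A M (id_mod A) idt \<epsilon> U (mod_assoc A ?J A M N M U (hcomp ?J ?MN M \<eta> idt U ?z))
      = FA (bal_fun A M (id_mod A)) (w U) (bpr A M (id_mod A) X (Y \<otimes> U) m (s U u))"
      using hcomp_bpr[OF cMNM' cMA idtM _ _ \<epsilon>_l o(1) _ wU m, of "bpr ?J N M Y U n u"] \<epsilon>_nat U u o n bF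
      by (simp add: id_mod_simps mod_comp_fun idt_def s_def p ten_obj)
    then have "mod_run M U (hcomp A M (id_mod A) idt \<epsilon> U (mod_assoc A ?J A M N M U (hcomp ?J ?MN M \<eta> idt U ?z)))
      = r U (s U u)"
      using mod_run_bpr[OF rM FA o(1) _ wU m, of "s U u"] nat_typ[OF \<epsilon>_nat] U u o n bF
      by (simp add: r_def s_def p ten_obj)
    then show ?thesis using tri[OF U z] R by simp
  qed
  have s_typ: "s U u \<in> FO (mon_fun A) (Y \<otimes> U)" if "U \<in> Obj C" "u \<in> FO (mod_fun M) U" for U u
    using that o n nat_typ[OF \<epsilon>_nat] by (simp add: s_def p ten_obj)
  note R = rep_mod_right_module[OF A o(2)]
  note R' = R[unfolded right_module_iff[OF FA]]
  have "right_module_hom A M (rep_mod A Y) s"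
  proof (subst hom_rdot)
    have "nat_trans (mod_fun M) (mod_fun (rep_mod A Y)) s"
      unfolding nat_trans_def rep_mod_fun
    proof (intro conjI allI ballI)
      fix U V g u assume g: "g \<in> hom C U V" and u: "u \<in> FO (mod_fun M) U"
      then have "U \<in> Obj C" "V \<in> Obj C" using hom_obj by auto
      then show "s V (FA (mod_fun M) g u) = FA (mon_fun A) (Idn C Y \<odot> g) (s U u)"
        using g u o n bF by (simp add: s_def p hom_iff nat_FA[OF \<epsilon>_nat] arr_simps)
    qed (rule s_typ)
    moreover have "s (U \<otimes> V) (rdot A M U V u a) = rdot A (rep_mod A Y) U V (s U u) a"
      if x: "U \<in> Obj C" "V \<in> Obj C" "u \<in> FO (mod_fun M) U" "a \<in> FO (mon_fun A) V" for U V u a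
    proof -
      \<comment> \<open>Right linearity of \<open>\<epsilon>\<close> moves \<open>a\<close> inside,
        and on the composite module it acts on the second factor \<open>u\<close>. The inverse
        associator that appears cancels against the associator in the action on
        \<open>A(Y \<otimes> -)\<close>.\<close>
      have "mdot A (Y \<otimes> U) V (s U u) a = \<epsilon> ((Y \<otimes> U) \<otimes> V) (rdot A ?NM (Y \<otimes> U) V (bpr ?J N M Y U n u) a)"
        using x o n by (simp add: \<epsilon>_r s_def p ten_obj)
      also have "\<dots> = FA (mon_fun A) (Assoc_inv Y U V) (s (U \<otimes> V) (rdot A M U V u a))"
        using x o n by (simp add: rNM(2) s_def nat_FA[OF \<epsilon>_nat] arr_simps p)
      finally show ?thesis
        using x o FA s_typ[of "U \<otimes> V" "rdot A M U V u a"]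
        by (simp add: rep_mod_ract(2)[OF A o(2)] s_typ fun_simps cmp_simps p)
    qed
    ultimately show "nat_trans (mod_fun M) (mod_fun (rep_mod A Y)) s \<and>
      (\<forall>X\<in>Obj C. \<forall>Ya\<in>Obj C. \<forall>m\<in>FO (mod_fun M) X. \<forall>b\<in>FO (mon_fun A) Ya.
        s (X \<otimes> Ya) (rdot A M X Ya m b) = rdot A (rep_mod A Y) X Ya (s X m) b)"
      by blast
  qed (use FA rM' R' in auto)
  moreover have "right_module_hom A (rep_mod A Y) M r"
  proof (subst hom_rdot)
    have "nat_trans (mod_fun (rep_mod A Y)) (mod_fun M) r"
      unfolding nat_trans_def rep_mod_fun
    proof (intro conjI allI ballI)
      fix U a assume "U \<in> Obj C" "a \<in> FO (mon_fun A) (Y \<otimes> U)"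
      then show "r U a \<in> FO (mod_fun M) U" using o m bF w by (simp add: r_def fun_simps p ten_obj)
    next
      fix U V g a assume g: "g \<in> hom C U V" and a: "a \<in> FO (mon_fun A) (Y \<otimes> U)"
      then have UV: "U \<in> Obj C" "V \<in> Obj C" using hom_obj by auto
      then show "r V (FA (mon_fun A) (Idn C Y \<odot> g) a) = FA (mod_fun M) g (r U a)"
        using g a o m bF FA w w_nat[OF g] by (simp add: r_def p fun_simps arr_simps)
    qed
    moreover have "r (U \<otimes> V) (rdot A (rep_mod A Y) U V a b) = rdot A M U V (r U a) b"
      if x: "U \<in> Obj C" "V \<in> Obj C" "a \<in> FO (mon_fun A) (Y \<otimes> U)" "b \<in> FO (mon_fun A) V" for U V a b
    proof -
      \<comment> \<open>On elements this is the associativity law for \<open>m\<close>,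
        \<open>a\<close>, \<open>b\<close> in \<open>M\<close>; on arrows it is
        \<open>w_ten\<close>.\<close>
      have "r (U \<otimes> V) (rdot A (rep_mod A Y) U V a b)
        = FA (mod_fun M) (w (U \<otimes> V) \<cdot> (Idn C X \<odot> Assoc C Y U V)) (rdot A M X ((Y \<otimes> U) \<otimes> V) m (mdot A (Y \<otimes> U) V a b))"
        using x o m bF FA w by (simp add: r_def rep_mod_ract(2)[OF A o(2)] p fun_simps arr_simps)
      also have "\<dots> = rdot A M U V (r U a) b"
        unfolding w_ten[OF x(1,2)] using x o m bF FA w rM' by (simp add: r_def p fun_simps arr_simps)
      finally show ?thesis .
    qed
    ultimately show "nat_trans (mod_fun (rep_mod A Y)) (mod_fun M) r \<and>
      (\<forall>X\<in>Obj C. \<forall>Ya\<in>Obj C. \<forall>m\<in>FO (mod_fun (rep_mod A Y)) X. \<forall>b\<in>FO (mon_fun A) Ya.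
        r (X \<otimes> Ya) (rdot A (rep_mod A Y) X Ya m b) = rdot A M X Ya (r X m) b)"
      by (auto simp: rep_mod_fun(1))
  qed (use FA rM' R' in auto)
  ultimately have "right_module_retract A M (rep_mod A Y)"
    unfolding right_module_retract_def using rM R rs by blast
  with o(2) show ?thesis by blast
qed

end

theorem proposition14p2:
  fixes C :: "('o, 'a) mcat"
    and A :: "('o, 'a, 'b) fmonoid"
    and M :: "('o, 'a, 'b, 'x, 'a) bimod"
  assumes "monoidal_category C"
    and "monoidal_category.is_monoid C A"
    and "M \<in> monoidal_category.cauchy_completion C TYPE('n) A"
  shows "\<exists>K \<in> Obj C.
    monoidal_category.right_module_retract C A M (monoidal_category.rep_mod C A K)"
proof -
  interpret monoidal_category C by fact
  show ?thesis using retract_of_rep_mod assms(2,3) by blast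
qed

end
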